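(* Let $N$ be a positive integer and let $\mathrm{BS}(N,N)=\langle a,b\mid a^Nb=ba^N\rangle$. Let $G(z;q)=\sum_{n,k}g_{n,k}z^nq^k$ be the generating function in which $g_{n,k}$ is the number of words of length $n$ in $\{a^{\pm1},b^{\pm1}\}^*$ (not necessarily freely reduced) that represent an element of the subgroup $\langle a\rangle$ and have normal form with $a$-exponent $k$. Then $G(z;q)$ is algebraic. Consequently the cogrowth series $[q^0]G(z;q)=\sum_n g_{n,0}z^n=\sum_n c(n)z^n$ of $\mathrm{BS}(N,N)$ is D-finite, and the cogrowth rate $\limsup_{n\to\infty}c(n)^{1/n}$ of $\mathrm{BS}(N,N)$ is an algebraic number.
   Context: $c(n)$ is the number of words of length $n$ over $\{a,a^{-1},b,b^{-1}\}$ (not necessarily freely reduced) that represent the identity of the group (the cogrowth function); its generating function $\sum_n c(n)z^n$ is the cogrowth series. Normal form in $\mathrm{BS}(N,N)$: every group element is uniquely represented by a word $Pa^k$ with $k\in\mathbb Z$ and $P$ a freely reduced word that is a (possibly empty) product of words from $\{b,ab,\dots,a^{N-1}b,\,b^{-1},ab^{-1},\dots,a^{N-1}b^{-1}\}$; $P$ is the prefix and $k$ the $a$-exponent. The normal form of a word is that of the element it represents. $G(z;q)$ is a formal power series in $z$ whose coefficients are Laurent polynomials in $q$. Algebraic means that it satisfies a nontrivial polynomial equation whose coefficients are polynomials in $z$, $q$, $q^{-1}$. A power series in $z$ is D-finite if it satisfies a nontrivial linear differential equation with coefficients polynomial in $z$. $[q^0]$ denotes extraction of the coefficient of $q^0$,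 as a power series in $z$. *)

theory Defs
  imports
    "HOL-Algebra.Generated_Groups"
    "HOL-Analysis.Analysis"
    "HOL-Computational_Algebra.Computational_Algebra"
    "HOL-Library.Poly_Mapping"
begin

section \<open>The group \<open>BS(N,N)\<close>\<close>

text \<open>\<open>A'\<close> and \<open>B'\<close> are the formal inverses of \<open>A\<close> and \<open>B\<close>.\<close>

datatype letter = A | A' | B | B'

fun inv_letter :: "letter \<Rightarrow> letter" where
  "inv_letter A = A'"
| "inv_letter A' = A"
| "inv_letter B = B'"
| "inv_letter B' = B"

inductive bs_eq :: "nat \<Rightarrow> letter list \<Rightarrow> letter list \<Rightarrow> bool" for N where
  refl: "bs_eq N u u"
| sym: "bs_eq N u v \<Longrightarrow> bs_eq N v u"
| trans: "bs_eq N u v \<Longrightarrow> bs_eq N v w \<Longrightarrow> bs_eq N u w"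
| cong: "bs_eq N u u' \<Longrightarrow> bs_eq N v v' \<Longrightarrow> bs_eq N (u @ v) (u' @ v')"
| cancel: "bs_eq N [x, inv_letter x] []"
| relator: "bs_eq N (replicate N A @ [B]) (B # replicate N A)"

text \<open>The element of the group represented by a word, as a congruence class of words.\<close>

definition bs_class :: "nat \<Rightarrow> letter list \<Rightarrow> letter list set" where
  "bs_class N w = {v. bs_eq N w v}"

definition BS :: "nat \<Rightarrow> letter list set monoid" where
  "BS N = \<lparr>carrier = range (bs_class N),
           monoid.mult = (\<lambda>X Y. \<Union>x\<in>X. \<Union>y\<in>Y. bs_class N (x @ y)),
           monoid.one = bs_class N []\<rparr>"

lemma bs_class_eq_iff: "bs_class N u = bs_class N v \<longleftrightarrow> bs_eq N u v"
proof
  assume "bs_class N u = bs_class N v"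
  then have "v \<in> bs_class N u" by (simp add: bs_class_def bs_eq.refl)
  then show "bs_eq N u v" by (simp add: bs_class_def)
next
  assume "bs_eq N u v"
  then show "bs_class N u = bs_class N v"
    unfolding bs_class_def by (blast intro: bs_eq.trans bs_eq.trans[OF bs_eq.sym])
qed

lemma BS_mult: "bs_class N u \<otimes>\<^bsub>BS N\<^esub> bs_class N v = bs_class N (u @ v)"
proof -
  have *: "bs_class N (x @ y) = bs_class N (u @ v)" if "x \<in> bs_class N u" "y \<in> bs_class N v" for x y
  proof -
    from that have "bs_eq N u x" "bs_eq N v y" by (simp_all add: bs_class_def)
    then show ?thesis unfolding bs_class_eq_iff by (rule bs_eq.sym[OF bs_eq.cong])
  qed
  have "u \<in> bs_class N u" "v \<in> bs_class N v" by (simp_all add: bs_class_def bs_eq.refl)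
  then have "(\<Union>x\<in>bs_class N u. \<Union>y\<in>bs_class N v. bs_class N (x @ y)) = bs_class N (u @ v)"
    using * by blast
  then show ?thesis by (simp add: BS_def)
qed

lemma inv_letter_inv_letter [simp]: "inv_letter (inv_letter x) = x"
  by (cases x) auto

lemma bs_eq_inverse: "bs_eq N (rev (map inv_letter w) @ w) []"
proof (induction w)
  case Nil
  then show ?case by (simp add: bs_eq.refl)
next
  case (Cons x w)
  have "bs_eq N [inv_letter x, x] []"
    using bs_eq.cancel[of N "inv_letter x"] by simp
  then have "bs_eq N (rev (map inv_letter w) @ ([inv_letter x, x] @ w))
     (rev (map inv_letter w) @ ([] @ w))"
    by (intro bs_eq.cong bs_eq.refl)
  from bs_eq.trans[OF this] Cons.IH show ?case by simp
qed

lemma group_BS: "group (BS N)"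
proof (rule groupI)
  fix x assume "x \<in> carrier (BS N)"
  then obtain w where x: "x = bs_class N w" by (auto simp: BS_def)
  have one: "\<one>\<^bsub>BS N\<^esub> = bs_class N []" by (simp add: BS_def)
  show "\<one>\<^bsub>BS N\<^esub> \<otimes>\<^bsub>BS N\<^esub> x = x" by (simp add: x one BS_mult)
  have "bs_class N (rev (map inv_letter w)) \<in> carrier (BS N)" by (simp add: BS_def)
  moreover have "bs_class N (rev (map inv_letter w)) \<otimes>\<^bsub>BS N\<^esub> x = \<one>\<^bsub>BS N\<^esub>"
    by (simp add: x one BS_mult bs_class_eq_iff bs_eq_inverse)
  ultimately show "\<exists>y\<in>carrier (BS N). y \<otimes>\<^bsub>BS N\<^esub> x = \<one>\<^bsub>BS N\<^esub>" by blast
next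
  show "\<one>\<^bsub>BS N\<^esub> \<in> carrier (BS N)" by (simp add: BS_def)
next
  fix x y z assume "x \<in> carrier (BS N)" "y \<in> carrier (BS N)"
  then obtain u v where xy: "x = bs_class N u" "y = bs_class N v" by (auto simp: BS_def)
  show "x \<otimes>\<^bsub>BS N\<^esub> y \<in> carrier (BS N)" unfolding xy BS_mult by (simp add: BS_def)
  assume "z \<in> carrier (BS N)"
  then obtain w where z: "z = bs_class N w" by (auto simp: BS_def)
  show "x \<otimes>\<^bsub>BS N\<^esub> y \<otimes>\<^bsub>BS N\<^esub> z = x \<otimes>\<^bsub>BS N\<^esub> (y \<otimes>\<^bsub>BS N\<^esub> z)"
    by (simp add: xy z BS_mult)
qed


section \<open>Normal forms\<close>

definition a_power :: "int \<Rightarrow> letter list" where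
  "a_power k = (if k \<ge> 0 then replicate (nat k) A else replicate (nat (- k)) A')"

definition freely_reduced :: "letter list \<Rightarrow> bool" where
  "freely_reduced w \<longleftrightarrow> (\<nexists>u x v. w = u @ [x, inv_letter x] @ v)"

definition nf_blocks :: "nat \<Rightarrow> letter list set" where
  "nf_blocks N = {replicate i A @ [x] | i x. i < N \<and> x \<in> {B, B'}}"

definition nf_prefix :: "nat \<Rightarrow> letter list \<Rightarrow> bool" where
  "nf_prefix N P \<longleftrightarrow> freely_reduced P \<and> (\<exists>ps. set ps \<subseteq> nf_blocks N \<and> P = concat ps)"

text \<open>\<open>has_normal_form N w P k\<close>: the normal form of the element represented by \<open>w\<close> is \<open>P a\<^sup>k\<close>.
  That \<open>k\<close> is determined by \<open>w\<close> is \<open>has_normal_form_unique\<close> below.\<close>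

definition has_normal_form :: "nat \<Rightarrow> letter list \<Rightarrow> letter list \<Rightarrow> int \<Rightarrow> bool" where
  "has_normal_form N w P k \<longleftrightarrow> nf_prefix N P \<and> bs_class N w = bs_class N (P @ a_power k)"


section \<open>The generating functions\<close>

definition g_count :: "nat \<Rightarrow> nat \<Rightarrow> int \<Rightarrow> nat" where
  "g_count N n k = card {w. length w = n \<and> bs_class N w \<in> generate (BS N) {bs_class N [A]}
                              \<and> (\<exists>P. has_normal_form N w P k)}"

definition cogrowth :: "nat \<Rightarrow> nat \<Rightarrow> nat" where
  "cogrowth N n = card {w :: letter list. length w = n \<and> bs_class N w = \<one>\<^bsub>BS N\<^esub>}"

text \<open>The ring of Laurent polynomials in \<open>q\<close> over the rationals is \<open>int \<Rightarrow>\<^sub>0 rat\<close> with the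
  convolution product: \<open>lookup p k\<close> is the coefficient of \<open>q\<^sup>k\<close> in \<open>p\<close>. The argument of
  \<open>Abs_poly_mapping\<close> has finite support for \<open>N > 0\<close>, see \<open>lookup_G_series\<close> below.\<close>

definition G_series :: "nat \<Rightarrow> (int \<Rightarrow>\<^sub>0 rat) fps" where
  "G_series N = Abs_fps (\<lambda>n. Abs_poly_mapping (\<lambda>k. of_nat (g_count N n k)))"

definition q0_coeff :: "(int \<Rightarrow>\<^sub>0 rat) fps \<Rightarrow> rat fps" where
  "q0_coeff F = Abs_fps (\<lambda>n. Poly_Mapping.lookup (fps_nth F n) 0)"

definition cogrowth_series :: "nat \<Rightarrow> rat fps" where
  "cogrowth_series N = Abs_fps (\<lambda>n. of_nat (cogrowth N n))"

text \<open>A limsup in the extended reals, so that it is defined without a boundedness assumption.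
  The convention \<open>root 0 x = 0\<close> only affects the term \<open>n = 0\<close>.\<close>

definition cogrowth_rate :: "nat \<Rightarrow> ereal" where
  "cogrowth_rate N = limsup (\<lambda>n. ereal (root n (real (cogrowth N n))))"

text \<open>With \<open>'a = int \<Rightarrow>\<^sub>0 rat\<close>, the coefficients of \<open>p\<close> are polynomials in \<open>z\<close> over the Laurent
  polynomials in \<open>q\<close>, i.e. polynomials in \<open>z\<close>, \<open>q\<close> and \<open>q\<^sup>-\<^sup>1\<close>.\<close>

definition algebraic_series :: "'a::comm_ring_1 fps \<Rightarrow> bool" where
  "algebraic_series F \<longleftrightarrow>
     (\<exists>p :: 'a poly poly. p \<noteq> 0 \<and> (\<Sum>i\<le>degree p. fps_of_poly (coeff p i) * F ^ i) = 0)"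

definition D_finite :: "'a::field fps \<Rightarrow> bool" where
  "D_finite f \<longleftrightarrow>
     (\<exists>p :: 'a poly poly. p \<noteq> 0 \<and>
        (\<Sum>i\<le>degree p. fps_of_poly (coeff p i) * (fps_deriv ^^ i) f) = 0)"


section \<open>Uniqueness of normal forms\<close>

text \<open>Right multiplication by a letter on normal forms: the state \<open>(ps, k)\<close> stands for the
  normal form with \<open>a\<close>-exponent \<open>k\<close> whose prefix has, from right to left, the blocks \<open>ps\<close>;
  the pair \<open>(i, True)\<close> is the block \<open>a\<^sup>i b\<close> and \<open>(i, False)\<close> is the block \<open>a\<^sup>i b\<^sup>-\<^sup>1\<close>.\<close>

type_synonym nf_state = "(nat \<times> bool) list \<times> int"

fun nf_push :: "nat \<Rightarrow> bool \<Rightarrow> nf_state \<Rightarrow> nf_state" where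
  "nf_push N s ([], k) = ([(nat (k mod int N), s)], k - k mod int N)"
| "nf_push N s ((j, t) # ps, k) =
     (if k mod int N = 0 \<and> t \<noteq> s then (ps, int j + k)
      else ((nat (k mod int N), s) # (j, t) # ps, k - k mod int N))"

fun nf_step :: "nat \<Rightarrow> letter \<Rightarrow> nf_state \<Rightarrow> nf_state" where
  "nf_step N A (ps, k) = (ps, k + 1)"
| "nf_step N A' (ps, k) = (ps, k - 1)"
| "nf_step N B st = nf_push N True st"
| "nf_step N B' st = nf_push N False st"

fun nf_valid :: "nat \<Rightarrow> (nat \<times> bool) list \<Rightarrow> bool" where
  "nf_valid N [] \<longleftrightarrow> True"
| "nf_valid N [(i, s)] \<longleftrightarrow> i < N"
| "nf_valid N ((i, s) # (j, t) # ps) \<longleftrightarrow> i < N \<and> \<not> (i = 0 \<and> s \<noteq> t) \<and> nf_valid N ((j, t) # ps)"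

lemma nf_valid_tl: "nf_valid N (x # ps) \<Longrightarrow> nf_valid N ps"
  by (cases x; cases ps) auto

lemma nf_valid_hd: "nf_valid N ((i, s) # ps) \<Longrightarrow> i < N"
  by (cases ps) auto

lemma nf_push_cases:
  obtains (pop) j qs where "ps = (j, \<not> s) # qs" "k mod int N = 0" "nf_push N s (ps, k) = (qs, int j + k)"
  | (push) "\<nexists>j qs. ps = (j, \<not> s) # qs \<and> k mod int N = 0"
      "nf_push N s (ps, k) = ((nat (k mod int N), s) # ps, k - k mod int N)"
proof (cases "\<exists>j qs. ps = (j, \<not> s) # qs \<and> k mod int N = 0")
  case True
  then show ?thesis using pop by auto
next
  case False
  moreover from False have "nf_push N s (ps, k) = ((nat (k mod int N), s) # ps, k - k mod int N)"
    by (cases ps) auto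
  ultimately show ?thesis using push by blast
qed

lemma nf_push_valid:
  assumes "N > 0" "nf_valid N (fst st)"
  shows "nf_valid N (fst (nf_push N s st))"
proof -
  obtain ps k where st: "st = (ps, k)" by (cases st)
  have lt: "nat (k mod int N) < N" using assms(1) by (simp add: nat_less_iff)
  have nn: "0 \<le> k mod int N" using assms(1) by simp
  show ?thesis
  proof (cases rule: nf_push_cases[of ps s k N])
    case (pop j qs)
    then show ?thesis using assms(2) nf_valid_tl by (simp add: st)
  next
    case push
    show ?thesis
    proof (cases ps)
      case Nil
      then show ?thesis using push(2) lt by (simp add: st)
    next
      case (Cons x qs)
      obtain j t where x: "x = (j, t)" by (cases x)
      have "\<not> (nat (k mod int N) = 0 \<and> s \<noteq> t)"
        using push(1) nn unfolding Cons x by auto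
      then show ?thesis using assms(2) push(2) lt unfolding st Cons x by simp
    qed
  qed
qed

lemma nf_step_valid:
  assumes "N > 0" "nf_valid N (fst st)"
  shows "nf_valid N (fst (nf_step N x st))"
  using assms nf_push_valid by (cases x; cases st) auto

lemma nf_push_push:
  assumes "N > 0" "nf_valid N (fst st)"
  shows "nf_push N (\<not> s) (nf_push N s st) = st"
proof -
  obtain ps k where st: "st = (ps, k)" by (cases st)
  have nn: "0 \<le> k mod int N" using assms(1) by simp
  have z: "(k - k mod int N) mod int N = 0" by (simp add: mod_diff_right_eq)
  show ?thesis
  proof (cases rule: nf_push_cases[of ps s k N])
    case push
    have "nf_push N (\<not> s) ((nat (k mod int N), s) # ps, k - k mod int N)
      = (ps, int (nat (k mod int N)) + (k - k mod int N))"
      by (simp only: nf_push.simps z) simp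
    then show ?thesis using nn push(2) unfolding st by simp
  next
    case (pop j qs)
    have j: "j < N" using assms(2) nf_valid_hd unfolding st pop(1) by auto
    have "(int j + k) mod int N = (int j + k mod int N) mod int N" by (simp only: mod_add_right_eq)
    then have m: "(int j + k) mod int N = int j" using j pop(2) by simp
    have "\<nexists>i rs. qs = (i, s) # rs \<and> j = 0"
      using assms(2) unfolding st pop(1) by auto
    then have "nf_push N (\<not> s) (qs, int j + k) = ((j, \<not> s) # qs, k)"
      using m by (cases rule: nf_push_cases[of qs "\<not> s" "int j + k" N]) auto
    then show ?thesis using pop unfolding st by simp
  qed
qed

lemma nf_step_inverse:
  assumes "N > 0" "nf_valid N (fst st)"
  shows "nf_step N (inv_letter x) (nf_step N x st) = st"
  using nf_push_push[OF assms, of True] nf_push_push[OF assms, of False]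
  by (cases x; cases st) auto

definition nf_act :: "nat \<Rightarrow> letter list \<Rightarrow> nf_state \<Rightarrow> nf_state" where
  "nf_act N w = fold (nf_step N) w"

lemma nf_act_simps [simp]:
  "nf_act N [] st = st"
  "nf_act N (x # w) st = nf_act N w (nf_step N x st)"
  "nf_act N (u @ v) st = nf_act N v (nf_act N u st)"
  by (simp_all add: nf_act_def)

lemma nf_act_valid:
  "N > 0 \<Longrightarrow> nf_valid N (fst st) \<Longrightarrow> nf_valid N (fst (nf_act N w st))"
  by (induction w arbitrary: st) (simp_all add: nf_step_valid)

lemma nf_act_replicate_A: "nf_act N (replicate n A) (ps, k) = (ps, k + int n)"
  by (induction n arbitrary: k) auto

lemma nf_act_replicate_A': "nf_act N (replicate n A') (ps, k) = (ps, k - int n)"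
  by (induction n arbitrary: k) auto

lemma nf_act_a_power: "nf_act N (a_power j) (ps, k) = (ps, k + j)"
  by (simp add: a_power_def nf_act_replicate_A nf_act_replicate_A')

lemma nf_push_shift:
  "nf_push N s (ps, k + int N) = (fst (nf_push N s (ps, k)), snd (nf_push N s (ps, k)) + int N)"
  by (cases ps) auto

lemma nf_act_cong:
  assumes "N > 0"
  shows "bs_eq N u v \<Longrightarrow> nf_valid N (fst st) \<Longrightarrow> nf_act N u st = nf_act N v st"
proof (induction arbitrary: st rule: bs_eq.induct)
  case (cong u u' v v')
  then show ?case using nf_act_valid[OF assms] by simp
next
  case (cancel x)
  then show ?case using nf_step_inverse[OF assms] by simp
next
  case relator
  obtain ps k where st: "st = (ps, k)" by (cases st)
  obtain ps' k' where st': "nf_push N True (ps, k) = (ps', k')" by fastforce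
  show ?case using nf_push_shift[of N True ps k]
    by (simp add: st st' nf_act_replicate_A)
qed simp_all

lemma nf_blocks_last:
  assumes "p \<in> nf_blocks N"
  obtains i s where "p = replicate i A @ [if s then B else B']" "i < N"
proof -
  obtain i x where ix: "p = replicate i A @ [x]" "i < N" "x \<in> {B, B'}"
    using assms unfolding nf_blocks_def by auto
  then show ?thesis using that[of i True] that[of i False] by auto
qed

lemma freely_reduced_appendD: "freely_reduced (u @ v) \<Longrightarrow> freely_reduced u"
  unfolding freely_reduced_def by (metis append.assoc)

text \<open>The invariant records the last letter of the prefix.\<close>

lemma nf_act_prefix:
  assumes "N > 0" "set ps \<subseteq> nf_blocks N" "freely_reduced (concat ps)"
  shows "\<exists>qs. nf_act N (concat ps) ([], 0) = (qs, 0) \<and> concat ps =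
           concat (map (\<lambda>(i, s). replicate i A @ [if s then B else B']) (rev qs))"
  using assms(2,3)
proof (induction ps rule: rev_induct)
  case (snoc p ps)
  let ?f = "\<lambda>(i, s). replicate i A @ [if s then B else B']"
  from snoc obtain qs where qs: "nf_act N (concat ps) ([], 0) = (qs, 0)"
      "concat ps = concat (map ?f (rev qs))"
    using freely_reduced_appendD by fastforce
  from snoc.prems(1) obtain i s where p: "p = replicate i A @ [if s then B else B']" "i < N"
    using nf_blocks_last[of p N] by auto
  have step: "nf_act N p (qs, 0) = nf_push N s (qs, int i)"
    by (simp add: p nf_act_replicate_A)
  have nc: False if h: "qs = (j, \<not> s) # rs" "i = 0" for j rs
  proof -
    let ?x = "if s then B' else B"
    have "concat (ps @ [p]) = (concat (map ?f (rev rs)) @ replicate j A) @ [?x, inv_letter ?x] @ []"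
      using h by (simp add: qs(2) p)
    then show False using snoc.prems(2) unfolding freely_reduced_def by blast
  qed
  have "nf_push N s (qs, int i) = ((i, s) # qs, 0)"
    using p(2) nc by (cases rule: nf_push_cases[of qs s "int i" N]) auto
  then show ?case using qs step by (simp add: p)
qed simp

theorem has_normal_form_unique:
  assumes "N > 0" "has_normal_form N w P k" "has_normal_form N w P' k'"
  shows "P = P'" "k = k'"
proof -
  let ?f = "\<lambda>(i, s). replicate i A @ [if s then B else B']"
  have *: "\<exists>qs. nf_act N w ([], 0) = (qs, k) \<and> P = concat (map ?f (rev qs))"
    if "has_normal_form N w P k" for P k
  proof -
    from that obtain ps where ps: "set ps \<subseteq> nf_blocks N" "P = concat ps" "freely_reduced P"
      "bs_eq N w (P @ a_power k)"
      unfolding has_normal_form_def nf_prefix_def bs_class_eq_iff by blast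
    from nf_act_prefix[OF assms(1) ps(1)] ps(2,3)
    obtain qs where "nf_act N P ([], 0) = (qs, 0)" "P = concat (map ?f (rev qs))" by blast
    then show ?thesis using nf_act_cong[OF assms(1) ps(4), of "([], 0)"]
      by (simp add: nf_act_a_power)
  qed
  from *[OF assms(2)] *[OF assms(3)] show "P = P'" "k = k'" by auto
qed

lemma finite_words: "finite {w :: letter list. length w = n}"
proof -
  have "x \<in> {A, A', B, B'}" for x by (cases x) auto
  then have "(UNIV :: letter set) = {A, A', B, B'}" by blast
  then have "finite (UNIV :: letter set)" by (metis finite.emptyI finite.insertI)
  then show ?thesis using finite_lists_length_eq[of "UNIV :: letter set" n] by simp
qed

theorem lookup_G_series:
  assumes "N > 0"
  shows "Poly_Mapping.lookup (fps_nth (G_series N) n) k = of_nat (g_count N n k)"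
proof -
  let ?W = "{w :: letter list. length w = n}"
  have "finite {k. \<exists>P. has_normal_form N w P k}" for w
  proof (cases "\<exists>P k. has_normal_form N w P k")
    case True
    then obtain P k where "has_normal_form N w P k" by blast
    then have "{k. \<exists>P. has_normal_form N w P k} \<subseteq> {k}"
      using has_normal_form_unique(2)[OF assms] by blast
    then show ?thesis using finite_subset by blast
  qed auto
  then have "finite (\<Union>w\<in>?W. {k. \<exists>P. has_normal_form N w P k})"
    using finite_words by blast
  moreover have "{k. (of_nat (g_count N n k) :: rat) \<noteq> 0} \<subseteq> (\<Union>w\<in>?W. {k. \<exists>P. has_normal_form N w P k})"
    unfolding g_count_def by (auto simp: card_eq_0_iff)
  ultimately have "finite {k. (of_nat (g_count N n k) :: rat) \<noteq> 0}" using finite_subset by blast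
  then show ?thesis by (simp add: G_series_def Abs_poly_mapping_inverse)
qed

end

theory Submission
  imports Defs
begin

text \<open>
  The normal form of a word is computed letter by letter by \<open>nf_act\<close>, whose states are a stack of
  blocks and an \<open>a\<close>-exponent.  So \<open>g_count\<close> counts paths on these states that return to the empty
  stack, and \<open>cogrowth\<close> those that also have exponent \<open>0\<close> (\<open>g_count_nf_act\<close>, \<open>cogrowth_eq_g_count\<close>).

  \<^emph>\<open>Algebraicity.\<close>  Let \<open>Psi k\<close> be the generating function of the paths that start with exponent
  \<open>k\<close> above some block and end when this block is first removed.  A step changes \<open>k\<close>, or pushes a block
  that must be removed again (a factor \<open>Exc = z * Psi 0\<close>), or removes the block, which is possible
  when \<open>N\<close> divides \<open>k\<close>.  As \<open>a\<^sup>N\<close> is central, \<open>Psi (k + N) = q\<^sup>N * Psi k\<close>.  For fixed \<open>Exc\<close> this is a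
  linear three-term recurrence with quasi-periodic boundary conditions.  Its solution by Lucas
  polynomials gives a polynomial equation for \<open>Exc\<close> (\<open>Exc_algebraic\<close>), and the wanted series is
  \<open>G = 1 / (1 - z * (q + 1/q) - 2 * Exc)\<close>.

  \<^emph>\<open>D-finiteness.\<close>  The constant term of \<open>G\<close> is the residue of \<open>G / q\<close>, and residues of algebraic
  series are D-finite by the counting argument of Lipshitz and Zeilberger.  For a common denominator, the
  numerators of the \<open>(n + 1)\<^sup>3\<close> series \<open>z\<^sup>i \<partial>\<^sub>z\<^sup>j \<partial>\<^sub>q\<^sup>k (G / q)\<close> with \<open>i, j, k \<le> n\<close> lie in a space of dimension
  \<open>O(n\<^sup>2)\<close>, because the degrees in \<open>z\<close> and \<open>q\<close> grow linearly and the degree in the algebraic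
  series stays bounded.  So there is an operator in \<open>z\<close>, \<open>\<partial>\<^sub>z\<close> and \<open>\<partial>\<^sub>q\<close> that annihilates
  \<open>G / q\<close> (\<open>annihilator\<close>).  A suitable coefficient in \<open>q\<close> of this relation sees the terms of lowest
  order in \<open>\<partial>\<^sub>q\<close> only, and these form a differential equation for the residue (\<open>residue_D_finite\<close>).

  \<^emph>\<open>Growth.\<close>  If \<open>u\<close> and \<open>v\<close> represent the same power of \<open>a\<close>, then \<open>u v\<^sup>-\<^sup>1\<close> represents the identity.
  Hence \<open>g_count N n k ^ 2 \<le> cogrowth N (2 * n)\<close>, and as at most \<open>2 * n + 1\<close> values of \<open>k\<close> occur, the
  cogrowth rate is the growth rate of the coefficients of \<open>G\<close> at \<open>q = 1\<close>.  There the equation for \<open>Exc\<close> has the explicit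
  parametrization \<open>1 / z = tilt_rate N t\<close>, \<open>t \<ge> 1\<close>, so the rate is at least the minimum of
  \<open>tilt_rate N\<close>.  Conversely every \<open>tilt_rate N t\<close> is an upper bound, because there is a
  positive function on the states for which the sum over the four neighbours of a state is at most
  \<open>tilt_rate N t\<close> times the value at the state (\<open>tilt_potential_step\<close>).  Finally, \<open>tilt_rate N\<close> is an
  algebraic function of \<open>t\<close> with an explicit quadratic equation, so its minimum is attained at \<open>1\<close> or
  at a root of a nonzero polynomial with integer coefficients (\<open>critical_point_root\<close>).
\<close>

section \<open>Words that represent powers of \<open>a\<close>\<close>

lemma bs_eq_append_left: "bs_eq N u v \<Longrightarrow> bs_eq N (w @ u) (w @ v)"
  by (intro bs_eq.cong bs_eq.refl)

lemma bs_eq_append_right: "bs_eq N u v \<Longrightarrow> bs_eq N (u @ w) (v @ w)"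
  by (intro bs_eq.cong bs_eq.refl)

lemma bs_eq_inverse_right: "bs_eq N (w @ rev (map inv_letter w)) []"
  using bs_eq_inverse[of N "rev (map inv_letter w)"] by (simp add: rev_map comp_def)

lemma bs_eq_a_power_Suc: "bs_eq N (a_power k @ [A]) (a_power (k + 1))"
proof (cases "k \<ge> 0")
  case True
  then show ?thesis
    by (simp add: a_power_def nat_add_distrib replicate_append_same bs_eq.refl)
next
  case False
  then have n: "nat (- k) = Suc (nat (- (k + 1)))" by simp
  have "a_power k = replicate (nat (- (k + 1))) A' @ [A']"
    using False by (simp only: a_power_def n if_False replicate_append_same replicate_Suc)
  moreover have "a_power (k + 1) = replicate (nat (- (k + 1))) A'"
    using False by (cases "k = -1") (simp_all add: a_power_def)
  ultimately have "a_power k @ [A] = a_power (k + 1) @ [A', inv_letter A'] @ []"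
    by simp
  then show ?thesis
    using bs_eq_append_left[OF bs_eq.cancel[of N A'], of "a_power (k + 1)"] by simp
qed

lemma bs_eq_a_power_pred: "bs_eq N (a_power k @ [A']) (a_power (k - 1))"
proof -
  have 1: "bs_eq N (a_power (k - 1) @ [A, A']) (a_power k @ [A'])"
    using bs_eq_append_right[OF bs_eq_a_power_Suc[of N "k - 1"], of "[A']"] by simp
  have "bs_eq N (a_power (k - 1) @ [A, A']) (a_power (k - 1))"
    using bs_eq_append_left[OF bs_eq.cancel[of N A], of "a_power (k - 1)"] by simp
  then show ?thesis using 1 bs_eq.trans bs_eq.sym by blast
qed

lemma bs_eq_a_power_add: "bs_eq N (a_power j @ a_power k) (a_power (j + k))"
proof (induction k rule: int_induct[where k = 0])
  case base
  then show ?case by (simp add: a_power_def bs_eq.refl)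
next
  case (step1 i)
  have "bs_eq N (a_power j @ a_power (i + 1)) (a_power j @ a_power i @ [A])"
    by (intro bs_eq_append_left bs_eq.sym[OF bs_eq_a_power_Suc])
  also note [trans] = bs_eq.trans
  have "bs_eq N (a_power j @ a_power i @ [A]) (a_power (j + i) @ [A])"
    using bs_eq_append_right[OF step1.IH, of "[A]"] by simp
  also have "bs_eq N (a_power (j + i) @ [A]) (a_power (j + i + 1))"
    by (rule bs_eq_a_power_Suc)
  finally show ?case by (simp add: add.assoc)
next
  case (step2 i)
  have "bs_eq N (a_power j @ a_power (i - 1)) (a_power j @ a_power i @ [A'])"
    by (intro bs_eq_append_left bs_eq.sym[OF bs_eq_a_power_pred])
  also note [trans] = bs_eq.trans
  have "bs_eq N (a_power j @ a_power i @ [A']) (a_power (j + i) @ [A'])"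
    using bs_eq_append_right[OF step2.IH, of "[A']"] by simp
  also have "bs_eq N (a_power (j + i) @ [A']) (a_power (j + i - 1))"
    by (rule bs_eq_a_power_pred)
  finally show ?case by (simp add: algebra_simps)
qed

definition b_letter :: "bool \<Rightarrow> letter" where
  "b_letter s = (if s then B else B')"

lemma commute_inverse:
  assumes "bs_eq N (u @ v) (v @ u)"
  shows "bs_eq N (rev (map inv_letter u) @ v) (v @ rev (map inv_letter u))"
proof -
  let ?i = "rev (map inv_letter u)"
  note [trans] = bs_eq.trans
  have "bs_eq N (?i @ v @ []) (?i @ v @ u @ ?i)"
    by (intro bs_eq_append_left bs_eq.sym[OF bs_eq_inverse_right])
  also have "bs_eq N (?i @ v @ u @ ?i) (?i @ u @ v @ ?i)"
    using bs_eq_append_left[OF bs_eq_append_right[OF bs_eq.sym[OF assms]], of ?i ?i] by simp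
  also have "bs_eq N (?i @ u @ v @ ?i) (v @ ?i)"
    using bs_eq_append_right[OF bs_eq_inverse[of N u], of "v @ ?i"] by simp
  finally show ?thesis by simp
qed

lemma commute_replicate:
  assumes "bs_eq N (u @ v) (v @ u)"
  shows "bs_eq N (concat (replicate n u) @ v) (v @ concat (replicate n u))"
proof (induction n)
  case (Suc n)
  note [trans] = bs_eq.trans
  have "bs_eq N (u @ concat (replicate n u) @ v) (u @ v @ concat (replicate n u))"
    by (intro bs_eq_append_left Suc.IH)
  also have "bs_eq N (u @ v @ concat (replicate n u)) (v @ u @ concat (replicate n u))"
    using bs_eq_append_right[OF assms] by simp
  finally show ?case by simp
qed (simp add: bs_eq.refl)

lemma concat_replicate_replicate: "concat (replicate n (replicate m x)) = replicate (n * m) x"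
  by (induction n) (simp_all add: replicate_add)

text \<open>
  The case of a single \<open>a\<^sup>N\<close> is the relator; inverses and powers of an element that commutes with
  a word commute with it as well.
\<close>

lemma bs_eq_central:
  assumes "int N dvd d"
  shows "bs_eq N (a_power d @ [b_letter s]) (b_letter s # a_power d)"
proof -
  let ?t = "replicate N A"
  have "bs_eq N ([B] @ ?t) (?t @ [B])"
    using bs_eq.sym[OF bs_eq.relator[of N]] by simp
  from bs_eq.sym[OF commute_inverse[OF this]] bs_eq.relator[of N]
  have t: "bs_eq N (?t @ [b_letter s]) ([b_letter s] @ ?t)"
    by (cases s) (simp_all add: b_letter_def)
  have p: "bs_eq N (replicate (n * N) A @ [b_letter s]) ([b_letter s] @ replicate (n * N) A)" for n
    using commute_replicate[OF t, of n] by (simp add: concat_replicate_replicate)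
  obtain m where d: "d = int N * m" using assms by auto
  show ?thesis
  proof (cases "m \<ge> 0")
    case True
    then have "a_power d = replicate (nat m * N) A"
      by (simp add: a_power_def d nat_mult_distrib mult.commute)
    then show ?thesis using p[of "nat m"] by simp
  next
    case False
    then have n: "nat (- d) = nat (- m) * N"
      unfolding d using nat_mult_distrib[of "- m" "int N"] by (simp add: mult.commute)
    have "a_power d = rev (map inv_letter (replicate (nat (- m) * N) A))"
    proof (cases "d = 0")
      case False
      then have "\<not> 0 \<le> d" using \<open>\<not> 0 \<le> m\<close> unfolding d by (auto simp: zero_le_mult_iff)
      then show ?thesis by (simp add: a_power_def flip: n)
    qed (use n in \<open>simp add: a_power_def\<close>)
    then show ?thesis using commute_inverse[OF p[of "nat (- m)"]] by simp
  qed
qed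

text \<open>
  The normal form that a state stands for.  It links the action \<open>nf_act\<close> back to the group: the
  action is already known to be constant on classes, and \<open>state_word_act\<close> shows that a state
  determines the class.
\<close>

fun state_word :: "nf_state \<Rightarrow> letter list" where
  "state_word ([], k) = a_power k"
| "state_word ((j, s) # ps, k) = state_word (ps, int j) @ b_letter s # a_power k"

lemma state_word_add: "bs_eq N (state_word (ps, k) @ a_power d) (state_word (ps, k + d))"
proof (cases ps)
  case Nil
  then show ?thesis using bs_eq_a_power_add by simp
next
  case (Cons x qs)
  obtain j s where "x = (j, s)" by (cases x)
  then show ?thesis
    using bs_eq_append_left[OF bs_eq_a_power_add[of N k d], of "state_word (qs, int j) @ [b_letter s]"] Cons
    by simp
qed

text \<open>
  The part of the exponent that is divisible by \<open>N\<close> is central and moves past the new letter. If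
  nothing else is left, this letter may cancel the last letter of the prefix.
\<close>

lemma state_word_push:
  assumes "N > 0"
  shows "bs_eq N (state_word (ps, k) @ [b_letter s]) (state_word (nf_push N s (ps, k)))"
proof -
  note [trans] = bs_eq.trans
  show ?thesis
  proof (cases rule: nf_push_cases[of ps s k N])
    case (pop j qs)
    have "int N dvd k" using pop(2) by (simp add: dvd_eq_mod_eq_0)
    then have "bs_eq N (state_word (qs, int j) @ [b_letter (\<not> s)] @ a_power k @ [b_letter s])
        (state_word (qs, int j) @ [b_letter (\<not> s)] @ [b_letter s] @ a_power k)"
      using bs_eq_central by (intro bs_eq_append_left) simp
    also have "bs_eq N (state_word (qs, int j) @ [b_letter (\<not> s)] @ [b_letter s] @ a_power k)
        (state_word (qs, int j) @ [] @ a_power k)"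
    proof (intro bs_eq_append_left)
      show "bs_eq N ([b_letter (\<not> s)] @ [b_letter s] @ a_power k) ([] @ a_power k)"
        using bs_eq_append_right[OF bs_eq.cancel[of N "b_letter (\<not> s)"], of "a_power k"]
        by (cases s) (simp_all add: b_letter_def)
    qed
    also have "bs_eq N (state_word (qs, int j) @ [] @ a_power k) (state_word (qs, int j + k))"
      using state_word_add by simp
    finally show ?thesis using pop by simp
  next
    case push
    let ?r = "k mod int N"
    have d: "int N dvd k - ?r" by (simp add: mod_eq_dvd_iff[symmetric])
    have "bs_eq N (state_word (ps, k) @ [b_letter s]) (state_word (ps, ?r) @ a_power (k - ?r) @ [b_letter s])"
      using bs_eq_append_right[OF bs_eq.sym[OF state_word_add[of N ps ?r "k - ?r"]], of "[b_letter s]"] by simp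
    also have "bs_eq N (state_word (ps, ?r) @ a_power (k - ?r) @ [b_letter s])
        (state_word (ps, ?r) @ b_letter s # a_power (k - ?r))"
      by (intro bs_eq_append_left bs_eq_central d)
    finally show ?thesis using push(2) assms by simp
  qed
qed

lemma state_word_step:
  assumes "N > 0"
  shows "bs_eq N (state_word st @ [x]) (state_word (nf_step N x st))"
proof -
  obtain ps k where st: "st = (ps, k)" by (cases st)
  show ?thesis
    using state_word_add[of N ps k 1] state_word_add[of N ps k "- 1"]
      state_word_push[OF assms, of ps k True] state_word_push[OF assms, of ps k False]
    by (cases x) (simp_all add: st b_letter_def a_power_def)
qed

lemma state_word_act:
  assumes "N > 0"
  shows "bs_eq N (state_word st @ w) (state_word (nf_act N w st))"
proof (induction w arbitrary: st)
  case (Cons x w)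
  show ?case
    using bs_eq.trans[OF bs_eq_append_right[OF state_word_step[OF assms, of st x], of w] Cons.IH] by simp
qed (simp add: bs_eq.refl)

lemma bs_eq_a_power_iff:
  assumes "N > 0"
  shows "bs_eq N w (a_power k) \<longleftrightarrow> nf_act N w ([], 0) = ([], k)"
proof
  assume "bs_eq N w (a_power k)"
  then show "nf_act N w ([], 0) = ([], k)"
    using nf_act_cong[OF assms, of w "a_power k" "([], 0)"] by (simp add: nf_act_a_power)
next
  assume "nf_act N w ([], 0) = ([], k)"
  then show "bs_eq N w (a_power k)"
    using state_word_act[OF assms, of "([], 0)" w] by (simp add: a_power_def)
qed

lemma bs_class_a_power: "bs_class N (a_power k) = bs_class N [A] [^]\<^bsub>BS N\<^esub> k"
proof -
  interpret group "BS N" by (rule group_BS)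
  have c: "bs_class N w \<in> carrier (BS N)" for w by (simp add: BS_def)
  have one: "bs_class N [] = \<one>\<^bsub>BS N\<^esub>" by (simp add: BS_def)
  have n: "bs_class N (replicate n A) = bs_class N [A] [^]\<^bsub>BS N\<^esub> n" for n :: nat
  proof (induction n)
    case (Suc n)
    have "bs_class N (replicate (Suc n) A) = bs_class N (replicate n A) \<otimes>\<^bsub>BS N\<^esub> bs_class N [A]"
      by (simp add: BS_mult replicate_append_same)
    then show ?case using Suc by simp
  qed (simp add: one)
  have p: "bs_class N (a_power (int n)) = bs_class N [A] [^]\<^bsub>BS N\<^esub> int n" for n :: nat
    by (simp add: a_power_def n int_pow_int)
  show ?thesis
  proof (cases "k \<ge> 0")
    case True
    then show ?thesis using p[of "nat k"] by simp
  next
    case False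
    have "bs_class N (a_power k) \<otimes>\<^bsub>BS N\<^esub> bs_class N (a_power (- k)) = \<one>\<^bsub>BS N\<^esub>"
      unfolding BS_mult one[symmetric] bs_class_eq_iff
      using bs_eq_a_power_add[of N k "- k"] by (simp add: a_power_def)
    then have "bs_class N (a_power k) = inv\<^bsub>BS N\<^esub> (bs_class N (a_power (- k)))"
      using inv_equality c by metis
    also have "bs_class N (a_power (- k)) = bs_class N [A] [^]\<^bsub>BS N\<^esub> (- k)"
      using p[of "nat (- k)"] False by simp
    finally show ?thesis by (simp add: int_pow_neg c)
  qed
qed

text \<open>
  For an element of \<open>\<langle>a\<rangle>\<close> the prefix of the normal form is empty, so by uniqueness of normal forms
  the condition on the \<open>a\<close>-exponent says that the element is \<open>a\<^sup>k\<close>.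
\<close>

theorem g_count_nf_act:
  assumes "N > 0"
  shows "g_count N n k = card {w. length w = n \<and> nf_act N w ([], 0) = ([], k)}"
proof -
  interpret group "BS N" by (rule group_BS)
  have c: "bs_class N w \<in> carrier (BS N)" for w by (simp add: BS_def)
  have gen: "generate (BS N) {bs_class N [A]} = range (\<lambda>m. bs_class N (a_power m))"
    by (auto simp: generate_pow[OF c] bs_class_a_power)
  have nf: "has_normal_form N (a_power m) [] m" for m
    by (auto simp: has_normal_form_def nf_prefix_def freely_reduced_def intro: exI[of _ "[]"])
  have "bs_class N w \<in> generate (BS N) {bs_class N [A]} \<and> (\<exists>P. has_normal_form N w P k)
      \<longleftrightarrow> bs_eq N w (a_power k)" for w
  proof
    assume a: "bs_class N w \<in> generate (BS N) {bs_class N [A]} \<and> (\<exists>P. has_normal_form N w P k)"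
    then obtain m P where m: "bs_class N w = bs_class N (a_power m)" and P: "has_normal_form N w P k"
      unfolding gen by auto
    from m have "has_normal_form N w [] m" using nf[of m] by (simp add: has_normal_form_def)
    then have "m = k" using has_normal_form_unique(2)[OF assms _ P] by blast
    then show "bs_eq N w (a_power k)" using m by (simp add: bs_class_eq_iff)
  next
    assume "bs_eq N w (a_power k)"
    then have "bs_class N w = bs_class N (a_power k)" by (simp add: bs_class_eq_iff)
    then show "bs_class N w \<in> generate (BS N) {bs_class N [A]} \<and> (\<exists>P. has_normal_form N w P k)"
      unfolding gen using nf[of k] by (auto simp: has_normal_form_def)
  qed
  then show ?thesis by (simp add: g_count_def bs_eq_a_power_iff[OF assms])
qed

theorem cogrowth_eq_g_count:
  assumes "N > 0"
  shows "cogrowth N n = g_count N n 0"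
proof -
  have "bs_class N w = \<one>\<^bsub>BS N\<^esub> \<longleftrightarrow> nf_act N w ([], 0) = ([], 0)" for w
    using bs_eq_a_power_iff[OF assms, of w 0] by (simp add: BS_def bs_class_eq_iff a_power_def)
  then show ?thesis by (simp add: cogrowth_def g_count_nf_act[OF assms])
qed

section \<open>Generating functions of paths on the normal forms\<close>

text \<open>
  The homogeneous form of the Lucas (or Chebyshev) polynomials of the second kind:
  \<open>(\<alpha>\<^sup>n - \<beta>\<^sup>n) / (\<alpha> - \<beta>)\<close> for the roots \<open>\<alpha>\<close>, \<open>\<beta>\<close> of \<open>y\<^sup>2 - x y + z\<^sup>2\<close>.
\<close>

fun lucas_U :: "'a::comm_ring_1 \<Rightarrow> 'a \<Rightarrow> nat \<Rightarrow> 'a" where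
  "lucas_U x z 0 = 0"
| "lucas_U x z (Suc 0) = 1"
| "lucas_U x z (Suc (Suc n)) = x * lucas_U x z (Suc n) - z\<^sup>2 * lucas_U x z n"

lemma lucas_U_three_term:
  fixes x z :: "'a::comm_ring_1"
  assumes rec: "\<And>i. 0 < i \<Longrightarrow> i < n \<Longrightarrow> x * f i = z * (f (i + 1) + f (i - 1))" and n: "0 < n"
  shows "z ^ (n - 1) * f n = lucas_U x z n * f 1 - z * lucas_U x z (n - 1) * f 0"
proof -
  have "Suc m \<le> n \<Longrightarrow> z ^ m * f (Suc m) = lucas_U x z (Suc m) * f 1 - z * lucas_U x z m * f 0" for m
  proof (induction m rule: induct_nat_012)
    case 1
    then show ?case using rec[of 1] by (simp add: algebra_simps)
  next
    case (ge2 m)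
    have "z ^ Suc (Suc m) * f (Suc (Suc (Suc m))) = z ^ Suc m * (x * f (Suc (Suc m)) - z * f (Suc m))"
      using rec[of "Suc (Suc m)"] ge2.prems by (simp add: algebra_simps)
    also have "\<dots> = x * (z ^ Suc m * f (Suc (Suc m))) - z\<^sup>2 * (z ^ m * f (Suc m))"
      by (simp add: algebra_simps power2_eq_square)
    also have "z ^ Suc m * f (Suc (Suc m)) = lucas_U x z (Suc (Suc m)) * f 1 - z * lucas_U x z (Suc m) * f 0"
      using ge2 by simp
    also have "z ^ m * f (Suc m) = lucas_U x z (Suc m) * f 1 - z * lucas_U x z m * f 0"
      using ge2 by simp
    finally show ?case by (simp add: algebra_simps power2_eq_square)
  qed simp
  from this[of "n - 1"] n show ?thesis by simp
qed

text \<open>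
  Solving the recurrence upwards from \<open>f 0\<close>, \<open>f 1\<close> and downwards from \<open>f N\<close>, \<open>f (N - 1)\<close> gives two
  relations between \<open>f 0\<close>, \<open>f 1\<close> and \<open>f (-1)\<close>.  Only the sum \<open>f 1 + f (-1)\<close> occurs in the equation at
  \<open>0\<close>, so the sum of the two relations eliminates everything but \<open>f 0\<close>.
\<close>

lemma lucas_U_periodic:
  fixes x z l s t y :: "'a::comm_ring_1" and f :: "int \<Rightarrow> 'a"
  assumes rec: "\<And>i. 0 < i \<Longrightarrow> i < int N \<Longrightarrow> x * f i = z * (f (i + 1) + f (i - 1))"
    and per: "\<And>i. f (i + int N) = s * f i" and st: "s * t = 1" and N: "0 < N"
    and at0: "(x + l) * f 0 = z * (f 1 + f (- 1)) + z" and l: "l = z * f 0"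
  shows "l * (x * lucas_U x z N - 2 * z\<^sup>2 * lucas_U x z (N - 1) - z ^ N * (s + t))
       = lucas_U x z N * (z\<^sup>2 - l\<^sup>2)"
proof -
  let ?U = "lucas_U x z N" and ?V = "lucas_U x z (N - 1)"
  have "z ^ (N - 1) * f (int N) = ?U * f (int 1) - z * ?V * f (int 0)"
    by (rule lucas_U_three_term[of N x "\<lambda>i. f (int i)" z])
      (use rec N in \<open>auto simp: of_nat_diff add.commute\<close>)
  then have 1: "z ^ (N - 1) * (s * f 0) = ?U * f 1 - z * ?V * f 0"
    using per[of 0] by simp
  have "z ^ (N - 1) * f (int N - int N) = ?U * f (int N - int 1) - z * ?V * f (int N - int 0)"
  proof (rule lucas_U_three_term[of N x "\<lambda>i. f (int N - int i)" z])
    fix i assume i: "0 < i" "i < N"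
    have e: "int N - int (i + 1) = int N - int i - 1" "int N - int (i - 1) = int N - int i + 1"
      using i by auto
    show "x * f (int N - int i) = z * (f (int N - int (i + 1)) + f (int N - int (i - 1)))"
      unfolding e using rec[of "int N - int i"] i by (simp add: add.commute)
  qed (use N in auto)
  then have "z ^ (N - 1) * f 0 = ?U * (s * f (- 1)) - z * ?V * (s * f 0)"
    using per[of "-1"] per[of 0] by simp
  then have "t * (z ^ (N - 1) * f 0) = t * (?U * (s * f (- 1)) - z * ?V * (s * f 0))"
    by (rule arg_cong)
  also have "\<dots> = (s * t) * (?U * f (- 1) - z * ?V * f 0)"
    by (simp only: algebra_simps)
  finally have "t * (z ^ (N - 1) * f 0) = (s * t) * (?U * f (- 1) - z * ?V * f 0)" .
  then have 2: "t * (z ^ (N - 1) * f 0) = ?U * f (- 1) - z * ?V * f 0"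
    by (simp add: st)
  have "z ^ N * (s + t) * f 0 = z * (z ^ (N - 1) * (s * f 0) + t * (z ^ (N - 1) * f 0))"
    using N by (cases N) (simp_all add: algebra_simps)
  also have "\<dots> = ?U * (z * (f 1 + f (- 1))) - 2 * z\<^sup>2 * ?V * f 0"
    unfolding 1 2 by (simp add: algebra_simps power2_eq_square)
  also have "z * (f 1 + f (- 1)) = (x + l) * f 0 - z"
    using at0 by simp
  finally have "z * (z ^ N * (s + t) * f 0) = z * (?U * ((x + l) * f 0 - z) - 2 * z\<^sup>2 * ?V * f 0)"
    by simp
  then show ?thesis unfolding l by (simp add: algebra_simps power2_eq_square)
qed

lemma sum_words_Suc:
  "(\<Sum>w | length w = Suc n. h w) = (\<Sum>x\<in>{A, A', B, B'}. \<Sum>w | length w = n. h (x # w))"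
  for h :: "letter list \<Rightarrow> 'b::comm_monoid_add"
proof -
  have U: "x \<in> {A, A', B, B'}" for x by (cases x) auto
  have "(\<Sum>w | length w = Suc n. h w) = (\<Sum>(x, w)\<in>{A, A', B, B'} \<times> {w. length w = n}. h (x # w))"
  proof -
    have bij: "bij_betw (\<lambda>(x, w). x # w) ({A, A', B, B'} \<times> {w. length w = n}) {w. length w = Suc n}"
      using U by (auto simp: bij_betw_def inj_on_def image_iff length_Suc_conv)
    show ?thesis
      using sum.reindex_bij_betw[OF bij, of h] by (simp only: prod.case_distrib)
  qed
  also have "\<dots> = (\<Sum>x\<in>{A, A', B, B'}. \<Sum>w | length w = n. h (x # w))"
    by (rule sum.cartesian_product[symmetric])
  finally show ?thesis .
qed

text \<open>
  The weight \<open>e k\<close> of the \<open>a\<close>-exponent \<open>k\<close> is the monomial \<open>q\<^sup>k\<close> for the full generating function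
  and the constant \<open>1\<close> for its specialization at \<open>q = 1\<close>.
\<close>

locale bs_walk =
  fixes N :: nat and e :: "int \<Rightarrow> 'r::comm_ring_1"
  assumes N_pos: "0 < N" and e_0: "e 0 = 1" and e_add: "e (j + k) = e j * e k"
begin

text \<open>
  The coefficients of the only power series solution of the first-passage equations \<open>Psi_eq\<close>: each
  factor \<open>z\<close> makes the next coefficient depend on earlier ones only.  That the solution does count
  paths is the content of \<open>path_gf_nth\<close>.
\<close>

function psi_coeff :: "nat \<Rightarrow> int \<Rightarrow> 'r" where
  "psi_coeff 0 k = 0"
| "psi_coeff (Suc n) k = psi_coeff n (k + 1) + psi_coeff n (k - 1)
     + (if int N dvd k then 1 else 2) * (\<Sum>i\<le>n. psi_coeff i 0 * psi_coeff (n - i) k)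
     + (if int N dvd k \<and> n = 0 then e k else 0)"
  by pat_completeness auto
termination by (relation "Wellfounded.measure fst") auto

definition Psi :: "int \<Rightarrow> 'r fps" where
  "Psi k = Abs_fps (\<lambda>n. psi_coeff n k)"

text \<open>
  The generating function of the excursions: a letter \<open>b\<close> or \<open>b\<^sup>-\<^sup>1\<close> that pushes a block, up to and
  including the letter that first removes this block.
\<close>

definition Exc :: "'r fps" where
  "Exc = fps_X * Psi 0"

definition X :: "'r fps" where
  "X = 1 - 2 * Exc"

definition G :: "'r fps" where
  "G = fps_right_inverse (X - fps_X * fps_const (e 1 + e (- 1))) 1"

lemma Psi_eq:
  "Psi k = fps_X * (Psi (k + 1) + Psi (k - 1)) + (if int N dvd k then 1 else 2) * (Exc * Psi k)
     + (if int N dvd k then fps_X * fps_const (e k) else 0)"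
proof (rule fps_ext)
  have two: "(2::'r fps) = fps_const 2" by (simp add: numeral_fps_const)
  fix n
  show "fps_nth (Psi k) n = fps_nth (fps_X * (Psi (k + 1) + Psi (k - 1)) + (if int N dvd k then 1 else 2) * (Exc * Psi k)
     + (if int N dvd k then fps_X * fps_const (e k) else 0)) n"
  proof (cases n)
    case 0
    then show ?thesis by (simp add: Psi_def Exc_def mult.assoc two fps_mult_nth)
  next
    case (Suc m)
    have "fps_nth (Exc * Psi k) n = (\<Sum>i\<le>m. psi_coeff i 0 * psi_coeff (m - i) k)"
      unfolding Exc_def mult.assoc Suc fps_X_mult_nth by (simp add: fps_mult_nth Psi_def atMost_atLeast0)
    moreover have "fps_nth Exc 0 = 0" by (simp add: Exc_def)
    ultimately show ?thesis
      by (simp add: Suc two Psi_def fps_mult_left_const_nth)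
  qed
qed

text \<open>
  The source term \<open>e k\<close> is the only place where \<open>k\<close> enters other than through its residue modulo \<open>N\<close>.
\<close>

lemma psi_coeff_shift: "psi_coeff n (k + int N) = e (int N) * psi_coeff n k"
proof (induction n arbitrary: k rule: less_induct)
  case (less n)
  show ?case
  proof (cases n)
    case (Suc m)
    have IH: "psi_coeff i (k + int N) = e (int N) * psi_coeff i k" if "i \<le> m" for i k
      using less Suc that by simp
    have [simp]: "k + int N + 1 = (k + 1) + int N" "k + int N - 1 = (k - 1) + int N" by auto
    have "(\<Sum>i\<le>m. psi_coeff i 0 * psi_coeff (m - i) (k + int N))
        = e (int N) * (\<Sum>i\<le>m. psi_coeff i 0 * psi_coeff (m - i) k)"
      by (simp add: sum_distrib_left IH mult.left_commute)
    then show ?thesis by (simp add: Suc IH e_add distrib_left mult.left_commute mult.commute)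
  qed simp
qed

lemma Psi_shift: "Psi (k + int N) = fps_const (e (int N)) * Psi k"
  by (rule fps_ext) (simp add: Psi_def psi_coeff_shift)

lemma e_uminus: "e k * e (- k) = 1"
  using e_add[of k "- k"] by (simp add: e_0)

lemma Psi_shift_dvd:
  assumes "int N dvd d"
  shows "Psi (k + d) = fps_const (e d) * Psi k"
proof -
  obtain m where d: "d = int N * m" using assms by auto
  have n: "Psi (k + int N * int n) = fps_const (e (int N * int n)) * Psi k" for n k
  proof (induction n)
    case (Suc n)
    have "Psi (k + int N * int (Suc n)) = Psi (k + int N * int n + int N)"
      by (simp add: algebra_simps)
    also have "\<dots> = fps_const (e (int N) * e (int N * int n)) * Psi k"
      by (simp only: Psi_shift Suc.IH mult.assoc flip: fps_const_mult)
    finally show ?case by (simp add: algebra_simps flip: e_add)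
  qed (simp add: e_0)
  show ?thesis
  proof (cases m)
    case (nonneg j)
    then show ?thesis using n[of k j] by (simp add: d)
  next
    case (neg j)
    define i where "i = int N * int (Suc j)"
    have di: "d = - i" using neg by (simp only: i_def d mult_minus_right)
    have "Psi k = fps_const (e i) * Psi (k - i)"
      using n[of "k - i" "Suc j"] by (simp add: i_def)
    then have "fps_const (e (- i)) * Psi k = fps_const (e i * e (- i)) * Psi (k - i)"
      by (simp flip: fps_const_mult add: mult_ac)
    then show ?thesis by (simp add: e_uminus di)
  qed
qed

lemma G_inverse: "G * (X - fps_X * fps_const (e 1 + e (- 1))) = 1"
  unfolding G_def
  by (subst mult.commute, rule fps_right_inverse) (simp add: X_def Exc_def)

lemma G_eq: "G = 1 + fps_X * fps_const (e 1 + e (- 1)) * G + 2 * Exc * G"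
  using G_inverse by (simp add: X_def algebra_simps)

theorem Exc_algebraic:
  "Exc * (X * lucas_U X fps_X N - 2 * fps_X\<^sup>2 * lucas_U X fps_X (N - 1)
       - fps_X ^ N * fps_const (e (int N) + e (- int N))) = lucas_U X fps_X N * (fps_X\<^sup>2 - Exc\<^sup>2)"
proof -
  have "Exc * (X * lucas_U X fps_X N - 2 * fps_X\<^sup>2 * lucas_U X fps_X (N - 1)
       - fps_X ^ N * (fps_const (e (int N)) + fps_const (e (- int N)))) = lucas_U X fps_X N * (fps_X\<^sup>2 - Exc\<^sup>2)"
  proof (rule lucas_U_periodic[where f = Psi])
    fix i assume "0 < i" "i < int N"
    then have "\<not> int N dvd i" using zdvd_not_zless by blast
    then show "X * Psi i = fps_X * (Psi (i + 1) + Psi (i - 1))"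
      using Psi_eq[of i] by (simp add: X_def algebra_simps)
  next
    show "(X + Exc) * Psi 0 = fps_X * (Psi 1 + Psi (- 1)) + fps_X"
      using Psi_eq[of 0] by (simp add: X_def algebra_simps e_0)
  qed (use N_pos in \<open>auto simp: Psi_shift Exc_def e_uminus\<close>)
  then show ?thesis by simp
qed

text \<open>
  The blocks must be removed one after the other.  The block on top is removed at an exponent that is
  divisible by \<open>N\<close>, which is central and already accounted for in \<open>Psi k\<close>; the path then goes on
  with the exponent stored in the block.
\<close>

fun path_gf :: "nf_state \<Rightarrow> 'r fps" where
  "path_gf ([], k) = fps_const (e k) * G"
| "path_gf ((j, s) # ps, k) = Psi k * path_gf (ps, int j)"

fun path_weight :: "nf_state \<Rightarrow> 'r" where
  "path_weight (ps, k) = (if ps = [] then e k else 0)"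

lemma path_gf_shift:
  assumes "int N dvd d"
  shows "path_gf (ps, k + d) = fps_const (e d) * path_gf (ps, k)"
  by (cases ps; use Psi_shift_dvd[OF assms] in \<open>force simp: e_add mult_ac simp flip: fps_const_mult\<close>)

text \<open>
  Pushing a block moves the central part of the exponent out of the way; since \<open>Psi\<close> and \<open>path_gf\<close>
  are quasi-periodic with the same factor, it cancels out and the effect is the factor \<open>Psi 0\<close>.
\<close>

lemma path_gf_push:
  assumes "\<nexists>j qs. ps = (j, \<not> s) # qs \<and> k mod int N = 0"
  shows "path_gf (nf_push N s (ps, k)) = Psi 0 * path_gf (ps, k)"
proof -
  let ?r = "k mod int N"
  have r: "0 \<le> ?r" using N_pos by simp
  have d: "int N dvd k - ?r" by (simp add: mod_eq_dvd_iff[symmetric])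
  have "nf_push N s (ps, k) = ((nat ?r, s) # ps, k - ?r)"
    using assms by (cases rule: nf_push_cases[of ps s k N]) auto
  then have "path_gf (nf_push N s (ps, k)) = Psi (k - ?r) * path_gf (ps, ?r)"
    using r by simp
  also have "Psi (k - ?r) = fps_const (e (k - ?r)) * Psi 0"
    using Psi_shift_dvd[OF d, of 0] by simp
  also have "\<dots> * path_gf (ps, ?r) = Psi 0 * path_gf (ps, ?r + (k - ?r))"
    using path_gf_shift[OF d, of ps ?r] by (simp only: mult_ac)
  finally show ?thesis by simp
qed

text \<open>
  Both sides of the one-step equation for path counts agree, so the product formula \<open>path_gf\<close> and the
  numbers of paths satisfy the same recursion in the length.
\<close>

lemma path_gf_step:
  "path_gf st = fps_const (path_weight st)
     + fps_X * (\<Sum>x\<in>{A, A', B, B'}. path_gf (nf_step N x st))"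
proof -
  obtain ps k where st: "st = (ps, k)" by (cases st)
  have sum: "(\<Sum>x\<in>{A, A', B, B'}. path_gf (nf_step N x st)) = path_gf (ps, k + 1) + path_gf (ps, k - 1)
    + path_gf (nf_push N True (ps, k)) + path_gf (nf_push N False (ps, k))"
    by (simp add: st add_ac)
  show ?thesis
  proof (cases ps)
    case Nil
    have "path_gf st = fps_const (e k) * (1 + fps_X * fps_const (e 1 + e (- 1)) * G + 2 * Exc * G)"
      unfolding G_eq[symmetric] by (simp add: st Nil)
    also have "\<dots> = fps_const (e k) + fps_X * (fps_const (e k * e 1) * G + fps_const (e k * e (- 1)) * G
        + Psi 0 * path_gf (ps, k) + Psi 0 * path_gf (ps, k))"
      by (simp add: Nil Exc_def algebra_simps flip: fps_const_add fps_const_mult)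
    also have "\<dots> = fps_const (path_weight st) + fps_X * (\<Sum>x\<in>{A, A', B, B'}. path_gf (nf_step N x st))"
      unfolding sum by (subst (1 2) path_gf_push) (simp_all add: Nil st flip: e_add)
    finally show ?thesis .
  next
    case (Cons x qs)
    obtain j t where x: "x = (j, t)" by (cases x)
    let ?F = "path_gf (qs, int j)"
    have F: "path_gf (ps, i) = Psi i * ?F" for i by (simp add: Cons x)
    have w: "path_weight st = 0" by (simp add: st Cons)
    have push: "path_gf (nf_push N t (ps, k)) = Psi 0 * Psi k * ?F"
      by (subst path_gf_push) (simp_all add: Cons x)
    \<comment> \<open>the letter inverse to the one on top removes the block, or pushes if \<open>N\<close> does not divide \<open>k\<close>\<close>
    have other: "fps_X * path_gf (nf_push N (\<not> t) (ps, k))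
        = (if int N dvd k then fps_X * fps_const (e k) else Exc * Psi k) * ?F"
    proof (cases "int N dvd k")
      case True
      then have "path_gf (nf_push N (\<not> t) (ps, k)) = path_gf (qs, int j + k)"
        by (simp add: Cons x)
      then show ?thesis using True path_gf_shift[OF True] by simp
    next
      case False
      then show ?thesis
        by (subst path_gf_push) (simp_all add: Cons x Exc_def dvd_eq_mod_eq_0)
    qed
    have "path_gf st = Psi k * ?F" by (simp add: st F)
    also have "\<dots> = fps_X * (Psi (k + 1) * ?F + Psi (k - 1) * ?F) + fps_X * (Psi 0 * Psi k * ?F)
        + (if int N dvd k then fps_X * fps_const (e k) else Exc * Psi k) * ?F"
      by (subst Psi_eq) (simp add: Exc_def algebra_simps)
    also have "\<dots> = fps_X * (path_gf (ps, k + 1) + path_gf (ps, k - 1) + path_gf (nf_push N t (ps, k))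
        + path_gf (nf_push N (\<not> t) (ps, k)))"
      unfolding other[symmetric] push F by (simp add: algebra_simps)
    finally show ?thesis unfolding sum w by (cases t) (simp_all add: add_ac)
  qed
qed

theorem path_gf_nth: "fps_nth (path_gf st) n = (\<Sum>w | length w = n. path_weight (nf_act N w st))"
proof (induction n arbitrary: st)
  case 0
  have "fps_nth (path_gf st) 0 = path_weight st" by (subst path_gf_step) simp
  then show ?case by simp
next
  case (Suc n)
  have "fps_nth (path_gf st) (Suc n) = (\<Sum>x\<in>{A, A', B, B'}. fps_nth (path_gf (nf_step N x st)) n)"
    by (subst path_gf_step) (simp only: fps_add_nth fps_X_mult_nth fps_sum_nth, simp)
  then show ?case by (simp only: Suc.IH sum_words_Suc nf_act_simps)
qed

corollary G_nth: "fps_nth G n = (\<Sum>w | length w = n. path_weight (nf_act N w ([], 0)))"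
  using path_gf_nth[of "([], 0)" n] by (simp add: e_0)

end

section \<open>The generating function is algebraic\<close>

text \<open>
  Evaluation at a power series of a polynomial whose coefficients are polynomials in \<open>z\<close>.
\<close>

definition poly_at :: "'a::comm_ring_1 fps \<Rightarrow> 'a poly poly \<Rightarrow> 'a fps" where
  "poly_at F p = poly (map_poly fps_of_poly p) F"

lemma poly_at_pCons [simp]: "poly_at F (pCons a p) = fps_of_poly a + F * poly_at F p"
  by (simp add: poly_at_def map_poly_pCons)

lemma poly_at_0 [simp]: "poly_at F 0 = 0"
  by (simp add: poly_at_def)

lemma poly_at_1 [simp]: "poly_at F 1 = 1"
  by (simp add: poly_at_def)

lemma poly_at_add [simp]: "poly_at F (p + q) = poly_at F p + poly_at F q"
  by (induction p q rule: poly_induct2) (simp_all add: algebra_simps fps_of_poly_add)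

lemma poly_at_smult [simp]: "poly_at F (smult c p) = fps_of_poly c * poly_at F p"
  by (induction p) (simp_all add: algebra_simps fps_of_poly_mult)

lemma poly_at_minus [simp]: "poly_at F (- p) = - poly_at F p"
  by (induction p) (simp_all add: fps_of_poly_uminus)

lemma poly_at_diff [simp]: "poly_at F (p - q) = poly_at F p - poly_at F q"
  using poly_at_add[of F p "- q"] by simp

lemma poly_at_mult [simp]: "poly_at F (p * q) = poly_at F p * poly_at F q"
  by (induction p) (simp_all add: algebra_simps)

lemma poly_at_power [simp]: "poly_at F (p ^ n) = poly_at F p ^ n"
  by (induction n) simp_all

lemma poly_at_numeral [simp]: "poly_at F (numeral n) = numeral n"
  by (induction n) (simp_all only: numeral.simps poly_at_add poly_at_1)

lemma poly_at_sum [simp]: "poly_at F (sum f I) = (\<Sum>i\<in>I. poly_at F (f i))"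
  by (induction I rule: infinite_finite_induct) simp_all

lemma poly_at_altdef: "poly_at F p = (\<Sum>i\<le>degree p. fps_of_poly (coeff p i) * F ^ i)"
proof -
  have "degree (map_poly fps_of_poly p) = degree p"
    by (rule degree_map_poly) (metis fps_of_poly_0 fps_of_poly_eq_iff)
  then show ?thesis by (simp add: poly_at_def poly_altdef coeff_map_poly)
qed

lemma algebraic_series_poly_at: "algebraic_series F \<longleftrightarrow> (\<exists>p. p \<noteq> 0 \<and> poly_at F p = 0)"
  by (simp add: algebraic_series_def poly_at_altdef)

text \<open>
  Substitute \<open>X = 1 / G + v\<close> in \<open>Q\<close> and clear the denominators by a power of \<open>G\<close>.
\<close>

lemma algebraic_series_inverse_shift:
  assumes Q: "Q \<noteq> 0" "poly_at X Q = 0" and G: "G * (X - fps_of_poly v) = 1"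
  shows "algebraic_series G"
proof -
  let ?d = "degree Q"
  define P where "P = (\<Sum>i\<le>?d. smult (coeff Q i) ([:1, v:] ^ i * [:0, 1:] ^ (?d - i)))"
  have GX: "1 + G * fps_of_poly v = G * X" using G by (simp add: algebra_simps)
  have "poly_at G P = (\<Sum>i\<le>?d. fps_of_poly (coeff Q i) * ((1 + G * fps_of_poly v) ^ i * G ^ (?d - i)))"
    by (simp add: P_def)
  also have "\<dots> = (\<Sum>i\<le>?d. G ^ ?d * (fps_of_poly (coeff Q i) * X ^ i))"
  proof (rule sum.cong[OF HOL.refl])
    fix i assume "i \<in> {..?d}"
    then have "G ^ ?d = G ^ i * G ^ (?d - i)" by (simp flip: power_add)
    then show "fps_of_poly (coeff Q i) * ((1 + G * fps_of_poly v) ^ i * G ^ (?d - i))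
        = G ^ ?d * (fps_of_poly (coeff Q i) * X ^ i)"
      unfolding GX by (simp add: power_mult_distrib mult_ac)
  qed
  also have "\<dots> = 0"
    using Q(2) by (simp add: poly_at_altdef flip: sum_distrib_left)
  finally have "poly_at G P = 0" .
  \<comment> \<open>at \<open>0\<close> only the summand without a power of the variable survives\<close>
  moreover have "poly P 0 = (\<Sum>i\<le>?d. if i = ?d then coeff Q i else 0)"
    unfolding P_def poly_sum by (intro sum.cong) (auto simp: power_0_left)
  then have "poly P 0 = lead_coeff Q" by simp
  then have "P \<noteq> 0" using Q(1) by auto
  ultimately show ?thesis unfolding algebraic_series_poly_at by blast
qed

lemma coeff_mult_top:
  assumes "degree p \<le> m" "degree q \<le> n"
  shows "coeff (p * q) (m + n) = coeff p m * coeff q n"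
proof -
  have "coeff (p * q) (m + n) = (\<Sum>i\<le>m + n. coeff p i * coeff q (m + n - i))"
    by (rule coeff_mult)
  also have "\<dots> = (\<Sum>i\<in>{m}. coeff p i * coeff q (m + n - i))"
  proof (intro sum.mono_neutral_right ballI)
    fix i assume "i \<in> {..m + n} - {m}"
    then have "degree p < i \<or> degree q < m + n - i" using assms by auto
    then show "coeff p i * coeff q (m + n - i) = 0" by (auto simp: coeff_eq_0)
  qed auto
  finally show ?thesis by simp
qed

lemma lucas_U_poly_at: "poly_at F (lucas_U x z n) = lucas_U (poly_at F x) (poly_at F z) n"
  by (induction n rule: induct_nat_012) simp_all

lemma lucas_U_monic:
  "degree (lucas_U [:0, 1:] [:c:] (Suc n)) \<le> n \<and> coeff (lucas_U [:0, 1:] [:c:] (Suc n)) n = 1"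
proof (induction n rule: induct_nat_012)
  case (ge2 n)
  let ?U = "lucas_U [:0, 1:] [:c:]"
  have "degree ([:0, 1:] * ?U (Suc (Suc n))) \<le> Suc (Suc n)"
    using ge2 by (intro order.trans[OF degree_mult_le]) simp
  moreover have "degree ([:c:]\<^sup>2 * ?U (Suc n)) \<le> n"
    using ge2 by (intro order.trans[OF degree_mult_le]) (simp add: power2_eq_square)
  moreover have "coeff ([:c:]\<^sup>2 * ?U (Suc n)) (Suc (Suc n)) = 0"
    by (rule coeff_eq_0) (use calculation(2) in simp)
  ultimately show ?case
    using ge2 by (auto intro!: degree_diff_le)
qed simp_all

lemma lucas_U_nth_0:
  assumes "fps_nth F 0 = 1"
  shows "fps_nth (lucas_U F fps_X (Suc n)) 0 = 1"
  by (induction n rule: induct_nat_012) (simp_all add: assms power2_eq_square)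

context bs_walk
begin

text \<open>
  Four times the equation \<open>Exc_algebraic\<close>, written in terms of \<open>X = 1 - 2 * Exc\<close>.  In this form it is
  monic in \<open>X\<close> up to the sign (\<open>kernel_monic\<close>).
\<close>

definition kernel :: "'r poly poly" where
  "kernel = (let x = [:0, 1:]; z = [:[:0, 1:]:]; U = lucas_U x z in
     2 * (1 - x) * (x * U N - 2 * z\<^sup>2 * U (N - 1) - z ^ N * [:[:e (int N) + e (- int N):]:])
     - U N * (4 * z\<^sup>2 - (1 - x)\<^sup>2))"

lemma fps_nth_X_0 [simp]: "fps_nth X 0 = 1"
  by (simp add: X_def Exc_def)

lemma poly_at_kernel: "poly_at X kernel = 0"
proof -
  have X: "1 - X = 2 * Exc" by (simp add: X_def)
  have z: "poly_at X [:[:0, 1:]:] = fps_X" by (simp add: fps_of_poly_linear)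
  have x: "poly_at X [:0, 1:] = X" by simp
  have u: "poly_at X [:[:c:]:] = fps_const c" for c by simp
  have "poly_at X kernel = 4 * (Exc * (X * lucas_U X fps_X N - 2 * fps_X\<^sup>2 * lucas_U X fps_X (N - 1)
       - fps_X ^ N * fps_const (e (int N) + e (- int N))) - lucas_U X fps_X N * (fps_X\<^sup>2 - Exc\<^sup>2))"
    unfolding kernel_def Let_def poly_at_diff poly_at_mult poly_at_power lucas_U_poly_at x z u
      poly_at_numeral poly_at_1 X by (simp add: algebra_simps power2_eq_square)
  then show ?thesis using Exc_algebraic by simp
qed

text \<open>
  The first summand contributes \<open>- 2\<close> and the second one \<open>1\<close> to the coefficient of \<open>X\<^bsup>N + 1\<^esup>\<close>.
\<close>

lemma kernel_monic: "degree kernel \<le> Suc N" "coeff kernel (Suc N) = - 1"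
proof -
  let ?x = "[:0, 1:] :: 'r poly poly" and ?z = "[:[:0, 1:]:] :: 'r poly poly"
  let ?U = "lucas_U ?x ?z"
  let ?u = "[:[:e (int N) + e (- int N):]:] :: 'r poly poly"
  obtain n where n: "N = Suc n" using N_pos by (cases N) auto
  have U: "degree (?U N) \<le> n" "coeff (?U N) n = 1"
    using lucas_U_monic[of "[:0, 1:]" n] by (auto simp: n)
  have V: "degree (?U n) \<le> n"
    using lucas_U_monic[of "[:0, 1:] :: 'r poly" "n - 1"] by (cases n) auto
  have deg_const: "degree (p * q) \<le> degree q" if "degree p = 0" for p q :: "'r poly poly"
    using degree_mult_le[of p q] that by simp
  have deg0: "degree (2 * ?z\<^sup>2) = 0" "degree (?z ^ N * ?u) = 0"
    by (simp_all add: power2_eq_square numeral_poly poly_const_pow)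
  let ?A = "?x * ?U N - 2 * ?z\<^sup>2 * ?U n - ?z ^ N * ?u"
  have r: "degree (2 * ?z\<^sup>2 * ?U n) \<le> n" "degree (?z ^ N * ?u) \<le> n"
    using deg_const[OF deg0(1), of "?U n"] V deg0(2) by auto
  have "degree (?x * ?U N) \<le> N"
    using U by (intro order.trans[OF degree_mult_le]) (simp add: n)
  then have A: "degree ?A \<le> N" using r by (auto intro!: degree_diff_le simp: n)
  have "coeff (2 * ?z\<^sup>2 * ?U n) N = 0" "coeff (?z ^ N * ?u) N = 0"
    by (rule coeff_eq_0, use r n in linarith)+
  then have A1: "coeff ?A N = 1" using U by (simp add: n)
  have l: "2 * (1 - ?x) = [:2, - 2:]" "(1 - ?x)\<^sup>2 = [:1, - 2, 1:]"
    by (simp_all add: numeral_poly one_pCons power2_eq_square)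
  have k: "kernel = [:2, - 2:] * ?A - ?U N * (4 * ?z\<^sup>2 - [:1, - 2, 1:])"
    unfolding kernel_def Let_def by (simp only: l[symmetric] n diff_Suc_1)
  have q: "4 * ?z\<^sup>2 - [:1, - 2, 1:] = [:[:- 1, 0, 4:], 2, - 1:]"
    by (simp add: numeral_poly power2_eq_square one_pCons)
  have "degree ([:2, - 2:] * ?A) \<le> Suc N"
    using A by (intro order.trans[OF degree_mult_le]) (simp add: order.trans)
  moreover have "degree (?U N * (4 * ?z\<^sup>2 - [:1, - 2, 1:])) \<le> Suc N"
    unfolding q using U by (intro order.trans[OF degree_mult_le]) (simp add: n)
  ultimately show "degree kernel \<le> Suc N" unfolding k by (rule degree_diff_le)
  have "coeff ([:2, - 2:] * ?A) (1 + N) = - 2"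
    by (subst coeff_mult_top) (use A A1 in auto)
  moreover have "coeff (?U N * (4 * ?z\<^sup>2 - [:1, - 2, 1:])) (n + 2) = - 1"
    unfolding q by (subst coeff_mult_top) (use U in \<open>auto simp: numeral_2_eq_2\<close>)
  ultimately show "coeff kernel (Suc N) = - 1" unfolding k by (simp add: n)
qed

theorem G_algebraic: "algebraic_series G"
proof (rule algebraic_series_inverse_shift)
  show "kernel \<noteq> 0" using kernel_monic(2) by auto
  show "G * (X - fps_of_poly [:0, e 1 + e (- 1):]) = 1"
    using G_inverse by (simp add: fps_of_poly_pCons mult.commute)
qed (rule poly_at_kernel)

end

locale bs_walk_domain = bs_walk N e for N and e :: "int \<Rightarrow> 'r::idom"
begin

text \<open>
  At \<open>z = 0\<close> one has \<open>X = 1\<close>, and the only term of the derivative without a factor \<open>z\<close> or \<open>1 - X\<close> comes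
  from the derivative of the factor \<open>1 - x\<close>.  So \<open>X\<close> is a simple root of its equation.
\<close>

lemma pderiv_kernel_nth_0: "fps_nth (poly_at X (pderiv kernel)) 0 = - 2"
proof -
  let ?x = "[:0, 1:] :: 'r poly poly" and ?z = "[:[:0, 1:]:] :: 'r poly poly"
  let ?U = "lucas_U ?x ?z"
  let ?u = "[:[:e (int N) + e (- int N):]:] :: 'r poly poly"
  define C where "C = ?x * ?U N - 2 * ?z\<^sup>2 * ?U (N - 1) - ?z ^ N * ?u"
  have z: "poly_at X ?z = fps_X" by (simp add: fps_of_poly_linear)
  have x: "poly_at X [:0, 1:] = X" by simp
  have C: "fps_nth (poly_at X C) 0 = 1"
    unfolding C_def poly_at_diff poly_at_mult poly_at_power lucas_U_poly_at x z
    using lucas_U_nth_0[OF fps_nth_X_0, of "N - 1"] N_pos by (simp add: power2_eq_square)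
  define y t M where "y = 1 - ?x" and "t = ?z" and "M = ?U N"
  have d: "pderiv y = - 1" "pderiv t = 0"
    by (simp_all add: y_def t_def pderiv_diff pderiv_pCons one_pCons)
  have k: "kernel = y * (2 * C) - M * (4 * (t * t) - y * y)"
  proof -
    have comm: "2 * a * c = a * (2 * c)" for a c :: "'r poly poly" by simp
    show ?thesis
      unfolding kernel_def Let_def C_def comm power2_eq_square y_def t_def M_def by (rule HOL.refl)
  qed
  have "pderiv kernel = - 2 * C + y * pderiv (2 * C) - pderiv M * (4 * (t * t) - y * y)
      - M * (pderiv 4 * (t * t) + 2 * y)"
    unfolding k by (simp only: pderiv_diff pderiv_mult d) (simp add: algebra_simps)
  also have "fps_nth (poly_at X \<dots>) 0 = - 2"
    unfolding poly_at_diff poly_at_mult poly_at_add y_def t_def x z by (simp add: C)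
  finally show ?thesis .
qed

end

section \<open>Laurent polynomials and derivations\<close>

text \<open>
  The form of the dimension bound for families, which may have repetitions.
\<close>

lemma (in vector_space) nontrivial_relation:
  assumes "finite I" "finite T" "card T < card I" and f: "\<And>i. i \<in> I \<Longrightarrow> f i \<in> span T"
  shows "\<exists>c. (\<exists>i\<in>I. c i \<noteq> 0) \<and> (\<Sum>i\<in>I. scale (c i) (f i)) = 0"
proof (cases "inj_on f I")
  case True
  have "dependent (f ` I)"
  proof (rule ccontr)
    assume "independent (f ` I)"
    then have "card (f ` I) \<le> card T"
      using independent_span_bound[of T "f ` I"] assms by auto
    then show False using assms(3) card_image[OF True] by simp
  qed
  then obtain u where u: "\<exists>v\<in>f ` I. u v \<noteq> 0" "(\<Sum>v\<in>f ` I. scale (u v) v) = 0"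
    using dependent_finite[of "f ` I"] assms(1) by auto
  have "(\<Sum>i\<in>I. scale (u (f i)) (f i)) = 0"
    using u(2) by (simp add: sum.reindex[OF True])
  then show ?thesis using u(1) by (intro exI[of _ "\<lambda>i. u (f i)"]) auto
next
  case False
  then obtain i j where ij: "i \<in> I" "j \<in> I" "i \<noteq> j" "f i = f j" unfolding inj_on_def by blast
  define c where "c = (\<lambda>k. if k = i then 1 else if k = j then - 1 else (0::'a))"
  have "(\<Sum>k\<in>I. scale (c k) (f k)) = (\<Sum>k\<in>{i, j}. scale (c k) (f k))"
    using ij assms(1) by (intro sum.mono_neutral_right) (auto simp: c_def)
  also have "\<dots> = 0" using ij by (simp add: c_def)
  finally show ?thesis using ij by (intro exI[of _ c]) (auto simp: c_def)
qed

type_synonym laurent = "int \<Rightarrow>\<^sub>0 rat"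

lemma poly_mapping_additive_induct [case_names single add]:
  fixes p :: "'a \<Rightarrow>\<^sub>0 'b::comm_monoid_add"
  assumes single: "\<And>k a. P (Poly_Mapping.single k a)" and add: "\<And>p q. P p \<Longrightarrow> P q \<Longrightarrow> P (p + q)"
  shows "P p"
proof -
  have "P (\<Sum>k\<in>I. Poly_Mapping.single k (Poly_Mapping.lookup p k))" if "finite I" for I
    using that
  proof induction
    case empty
    show ?case using single[of undefined 0] by simp
  qed (simp add: add single)
  moreover have "p = (\<Sum>k\<in>Poly_Mapping.keys p. Poly_Mapping.single k (Poly_Mapping.lookup p k))"
    by (rule poly_mapping_eqI) (auto simp: lookup_sum lookup_single when_def in_keys_iff sum.delta)
  ultimately show ?thesis by (metis finite_keys)
qed

definition q_deriv :: "laurent \<Rightarrow> laurent" where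
  "q_deriv p = Abs_poly_mapping (\<lambda>k. of_int (k + 1) * Poly_Mapping.lookup p (k + 1))"

lemma lookup_q_deriv: "Poly_Mapping.lookup (q_deriv p) k = of_int (k + 1) * Poly_Mapping.lookup p (k + 1)"
proof -
  have "{k. of_int (k + 1) * Poly_Mapping.lookup p (k + 1) \<noteq> 0} \<subseteq> (\<lambda>k. k - 1) ` Poly_Mapping.keys p"
  proof
    fix k assume "k \<in> {k. of_int (k + 1) * Poly_Mapping.lookup p (k + 1) \<noteq> 0}"
    then have "k + 1 \<in> Poly_Mapping.keys p" by (auto simp: in_keys_iff)
    then show "k \<in> (\<lambda>k. k - 1) ` Poly_Mapping.keys p" by (rule rev_image_eqI) simp
  qed
  then have "finite {k. of_int (k + 1) * Poly_Mapping.lookup p (k + 1) \<noteq> 0}"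
    by (rule finite_subset) simp
  then show ?thesis unfolding q_deriv_def by (subst lookup_Abs_poly_mapping) auto
qed

lemma q_deriv_add: "q_deriv (p + r) = q_deriv p + q_deriv r"
  by (rule poly_mapping_eqI) (simp add: lookup_q_deriv lookup_add distrib_left)

lemma q_deriv_0 [simp]: "q_deriv 0 = 0"
  by (rule poly_mapping_eqI) (simp add: lookup_q_deriv)

lemma q_deriv_single: "q_deriv (Poly_Mapping.single k a) = Poly_Mapping.single (k - 1) (of_int k * a)"
  by (rule poly_mapping_eqI) (auto simp: lookup_q_deriv lookup_single when_def)

lemma q_deriv_mult: "q_deriv (p * r) = q_deriv p * r + p * q_deriv r"
proof (induction p rule: poly_mapping_additive_induct)
  case (single k a)
  show ?case
  proof (induction r rule: poly_mapping_additive_induct)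
    case (single l b)
    have "k - 1 + l = k + l - 1" "k + (l - 1) = k + l - 1" by auto
    then show ?case
      by (simp add: mult_single q_deriv_single algebra_simps flip: single_add)
  qed (simp add: q_deriv_add algebra_simps)
qed (simp add: q_deriv_add algebra_simps)

lemma q_deriv_sum: "q_deriv (sum f I) = (\<Sum>i\<in>I. q_deriv (f i))"
  by (induction I rule: infinite_finite_induct) (simp_all add: q_deriv_add)

definition fps_q_deriv :: "laurent fps \<Rightarrow> laurent fps" where
  "fps_q_deriv F = Abs_fps (\<lambda>n. q_deriv (fps_nth F n))"

abbreviation rat_scale :: "rat \<Rightarrow> laurent fps \<Rightarrow> laurent fps" where
  "rat_scale c F \<equiv> fps_const (Poly_Mapping.single 0 c) * F"

interpretation laurent_space: vector_space rat_scale
  by unfold_locales (simp_all add: algebra_simps single_add mult_single flip: fps_const_add fps_const_mult)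

abbreviation q_power :: "int \<Rightarrow> laurent fps" where
  "q_power j \<equiv> fps_const (Poly_Mapping.single j 1)"

lemma q_power_add: "q_power (i + j) = q_power i * q_power j"
  by (simp add: mult_single)

text \<open>
  The two derivations in question, with respect to \<open>z\<close> and to \<open>q\<close>, map polynomials in \<open>z\<close> to
  polynomials, and monomials to multiples of monomials whose degree is larger by one at most.
\<close>

locale laurent_derivation =
  fixes D :: "laurent fps \<Rightarrow> laurent fps" and D' :: "laurent poly \<Rightarrow> laurent poly"
  assumes add: "D (f + g) = D f + D g"
    and mult: "D (f * g) = D f * g + f * D g"
    and of_poly: "D (fps_of_poly c) = fps_of_poly (D' c)"
    and D'_0: "D' 0 = 0"
    and rat: "D (fps_const (Poly_Mapping.single 0 a)) = 0"
    and monomial: "\<exists>a k l. D (fps_X ^ i * q_power j) = rat_scale a (fps_X ^ k * q_power l)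
      \<and> k \<le> i \<and> \<bar>l\<bar> \<le> \<bar>j\<bar> + 1"
begin

lemma scale: "D (rat_scale a f) = rat_scale a (D f)"
  by (simp add: mult rat)

lemma power: "f * D (f ^ n) = rat_scale (of_nat n) (f ^ n * D f)"
proof (induction n)
  case 0
  show ?case using rat[of 1] by simp
next
  case (Suc n)
  have "f * D (f ^ Suc n) = f * (f ^ n * D f) + f * (f * D (f ^ n))"
    by (simp add: mult algebra_simps)
  also have "\<dots> = rat_scale 1 (f ^ Suc n * D f) + rat_scale (of_nat n) (f ^ Suc n * D f)"
    unfolding Suc.IH by (simp add: mult_ac)
  finally show ?case by (simp add: algebra_simps single_add flip: fps_const_add)
qed

lemma poly_at: "D (poly_at F p) = poly_at F (map_poly D' p) + poly_at F (pderiv p) * D F"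
proof (induction p)
  case 0
  show ?case using rat[of 0] by simp
next
  case (pCons a p)
  show ?case using pCons by (simp add: add mult of_poly pderiv_pCons map_poly_pCons D'_0 algebra_simps)
qed

end

interpretation z_derivation: laurent_derivation fps_deriv pderiv
proof
  fix i :: nat and j
  have "fps_deriv (fps_X ^ i * q_power j) = rat_scale (of_nat i) (fps_X ^ (i - 1) * q_power j)"
    by (simp add: fps_deriv_power mult_ac flip: fps_of_nat)
  then show "\<exists>a k l. fps_deriv (fps_X ^ i * q_power j) = rat_scale a (fps_X ^ k * q_power l)
      \<and> k \<le> i \<and> \<bar>l\<bar> \<le> \<bar>j\<bar> + 1"
    by (intro exI[of _ "of_nat i"] exI[of _ "i - 1"] exI[of _ j]) simp
qed (simp_all add: fps_of_poly_pderiv algebra_simps)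

lemma fps_q_deriv_mult: "fps_q_deriv (f * g) = fps_q_deriv f * g + f * fps_q_deriv g"
  by (rule fps_ext)
    (simp add: fps_q_deriv_def fps_mult_nth q_deriv_sum q_deriv_mult sum.distrib)

interpretation q_derivation: laurent_derivation fps_q_deriv "map_poly q_deriv"
proof
  fix i :: nat and j
  have X: "fps_q_deriv (fps_X ^ i) = 0"
    by (rule fps_ext) (simp add: fps_q_deriv_def fps_X_power_nth q_deriv_single flip: single_one)
  have dq: "fps_q_deriv (q_power j) = fps_const (Poly_Mapping.single (j - 1) (of_int j))"
    by (rule fps_ext) (simp add: fps_q_deriv_def q_deriv_single del: single_of_int)
  have "fps_q_deriv (fps_X ^ i * q_power j) = rat_scale (of_int j) (fps_X ^ i * q_power (j - 1))"
    unfolding fps_q_deriv_mult X dq by (simp add: mult_single mult.left_commute del: single_of_int)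
  then show "\<exists>a k l. fps_q_deriv (fps_X ^ i * q_power j) = rat_scale a (fps_X ^ k * q_power l)
      \<and> k \<le> i \<and> \<bar>l\<bar> \<le> \<bar>j\<bar> + 1"
    by (intro exI[of _ "of_int j"] exI[of _ i] exI[of _ "j - 1"]) simp
qed (auto simp: fps_q_deriv_mult, auto simp: fps_q_deriv_def fps_eq_iff q_deriv_add coeff_map_poly q_deriv_single)

section \<open>Residues of algebraic series are D-finite\<close>

text \<open>
  A series \<open>F\<close> with a monic equation of degree \<open>d\<close> over the polynomials in \<open>z\<close>, \<open>q\<close> and \<open>1/q\<close>.
  The polynomials in \<open>F\<close> over this ring are then filtered by \<open>filt n\<close>, the rational span of the
  monomials whose degrees in \<open>z\<close> and \<open>q\<close> are at most \<open>n\<close> and whose degree in \<open>F\<close> is less than \<open>d\<close>.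
\<close>

locale monic_element =
  fixes F :: "laurent fps" and Q :: "laurent poly poly" and d :: nat
  assumes degree: "degree Q \<le> d" and monic: "coeff Q d = 1" and root: "poly_at F Q = 0"
begin

definition monomials :: "nat \<Rightarrow> laurent fps set" where
  "monomials n = (\<lambda>(i, j, s). fps_X ^ i * q_power j * F ^ s) ` ({..n} \<times> {- int n..int n} \<times> {..<d})"

abbreviation filt :: "nat \<Rightarrow> laurent fps set" where
  "filt n \<equiv> laurent_space.span (monomials n)"

lemma finite_monomials: "finite (monomials n)"
  by (simp add: monomials_def)

text \<open>
  Quadratic in \<open>n\<close>: this is what the counting argument in \<open>annihilator\<close> rests on.
\<close>

lemma card_monomials: "card (monomials n) \<le> (n + 1) * (2 * n + 1) * d"
proof -
  have c: "card {- int n..int n} = 2 * n + 1" by simp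
  have "card (monomials n) \<le> card ({..n} \<times> {- int n..int n} \<times> {..<d})"
    unfolding monomials_def by (rule card_image_le) simp
  also have "card ({..n} \<times> {- int n..int n} \<times> {..<d}) = (n + 1) * (2 * n + 1) * d"
    by (simp only: card_cartesian_product card_atMost card_lessThan c Suc_eq_plus1 mult.assoc)
  finally show ?thesis .
qed

lemma monomial_in_filt: "i \<le> n \<Longrightarrow> \<bar>j\<bar> \<le> int n \<Longrightarrow> s < d \<Longrightarrow> fps_X ^ i * q_power j * F ^ s \<in> filt n"
  unfolding monomials_def
  by (rule laurent_space.span_base, rule image_eqI[of _ _ "(i, j, s)"]) auto

lemma filt_mono: "m \<le> n \<Longrightarrow> f \<in> filt m \<Longrightarrow> f \<in> filt n"
proof -
  assume "m \<le> n" "f \<in> filt m"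
  moreover from \<open>m \<le> n\<close> have "monomials m \<subseteq> monomials n"
    unfolding monomials_def by (intro image_mono Sigma_mono) auto
  ultimately show ?thesis using laurent_space.span_mono by blast
qed

text \<open>
  Such an operator raises the filtration degree by a constant.  All operators in the argument are of
  this kind, so that \<open>n\<close> of them in a row raise the degree by \<open>O(n)\<close>.
\<close>

definition bounded_op :: "(laurent fps \<Rightarrow> laurent fps) \<Rightarrow> bool" where
  "bounded_op \<phi> \<longleftrightarrow> (\<exists>c. \<forall>n. \<forall>f\<in>filt n. \<phi> f \<in> filt (n + c))"

lemma bounded_opE:
  assumes "bounded_op \<phi>"
  obtains c where "\<And>n f. f \<in> filt n \<Longrightarrow> \<phi> f \<in> filt (n + c)"
  using assms unfolding bounded_op_def by blast

lemma bounded_op_add: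
  assumes "bounded_op \<phi>" "bounded_op \<psi>"
  shows "bounded_op (\<lambda>f. \<phi> f + \<psi> f)"
proof -
  obtain a b where a: "\<And>n f. f \<in> filt n \<Longrightarrow> \<phi> f \<in> filt (n + a)"
    and b: "\<And>n f. f \<in> filt n \<Longrightarrow> \<psi> f \<in> filt (n + b)"
    using assms by (metis bounded_opE)
  have "\<phi> f + \<psi> f \<in> filt (n + (a + b))" if "f \<in> filt n" for n f
    using filt_mono[OF _ a[OF that], of "n + (a + b)"] filt_mono[OF _ b[OF that], of "n + (a + b)"]
    by (simp add: laurent_space.span_add)
  then show ?thesis unfolding bounded_op_def by blast
qed

lemma bounded_op_comp:
  assumes "bounded_op \<phi>" "bounded_op \<psi>"
  shows "bounded_op (\<lambda>f. \<phi> (\<psi> f))"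
proof -
  obtain a b where a: "\<And>n f. f \<in> filt n \<Longrightarrow> \<phi> f \<in> filt (n + a)"
    and b: "\<And>n f. f \<in> filt n \<Longrightarrow> \<psi> f \<in> filt (n + b)"
    using assms by (metis bounded_opE)
  have "\<phi> (\<psi> f) \<in> filt (n + (b + a))" if "f \<in> filt n" for n f
    using a[OF b[OF that]] by (simp add: add.assoc)
  then show ?thesis unfolding bounded_op_def by blast
qed

lemma linear_filt:
  assumes add: "\<And>f g. \<phi> (f + g) = \<phi> f + \<phi> g" and scale: "\<And>a f. \<phi> (rat_scale a f) = rat_scale a (\<phi> f)"
    and base: "\<And>i j s. i \<le> n \<Longrightarrow> \<bar>j\<bar> \<le> int n \<Longrightarrow> s < d \<Longrightarrow> \<phi> (fps_X ^ i * q_power j * F ^ s) \<in> filt m"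
    and f: "f \<in> filt n"
  shows "\<phi> f \<in> filt m"
  using f
proof (induction rule: laurent_space.span_induct_alt)
  case base
  have "\<phi> (rat_scale 0 0) = rat_scale 0 (\<phi> 0)" by (rule scale)
  then have "\<phi> 0 = 0" by simp
  then show ?case by (simp add: laurent_space.span_zero)
next
  case (step c x y)
  then obtain i j s where x: "x = fps_X ^ i * q_power j * F ^ s" "i \<le> n" "\<bar>j\<bar> \<le> int n" "s < d"
    unfolding monomials_def by auto
  have "\<phi> x \<in> filt m" unfolding x(1) by (rule base) (use x in auto)
  then show ?case using step unfolding add scale
    by (intro laurent_space.span_add laurent_space.span_scale)
qed

definition bounded_mult :: "laurent fps \<Rightarrow> bool" where
  "bounded_mult b \<longleftrightarrow> bounded_op (\<lambda>f. b * f)"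

lemma bounded_mult_add: "bounded_mult a \<Longrightarrow> bounded_mult b \<Longrightarrow> bounded_mult (a + b)"
  unfolding bounded_mult_def distrib_right by (rule bounded_op_add)

lemma bounded_mult_mult: "bounded_mult a \<Longrightarrow> bounded_mult b \<Longrightarrow> bounded_mult (a * b)"
  unfolding bounded_mult_def mult.assoc by (rule bounded_op_comp)

lemma bounded_mult_rat: "bounded_mult (fps_const (Poly_Mapping.single 0 a))"
  unfolding bounded_mult_def bounded_op_def
  by (intro exI[of _ 0]) (auto intro: laurent_space.span_scale)

lemma bounded_mult_0: "bounded_mult 0"
  using bounded_mult_rat[of 0] by simp

lemma bounded_mult_minus: "bounded_mult a \<Longrightarrow> bounded_mult (- a)"
  using bounded_mult_mult[OF bounded_mult_rat[of "- 1"], of a]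
  by (simp add: single_uminus flip: fps_const_neg)

lemma fps_X_power_filt: "f \<in> filt n \<Longrightarrow> fps_X ^ k * f \<in> filt (n + k)"
proof (rule linear_filt[where \<phi> = "\<lambda>f. fps_X ^ k * f"])
  fix i j s assume "i \<le> n" "\<bar>j\<bar> \<le> int n" "s < d"
  then have "fps_X ^ (k + i) * q_power j * F ^ s \<in> filt (n + k)"
    by (intro monomial_in_filt) auto
  then show "fps_X ^ k * (fps_X ^ i * q_power j * F ^ s) \<in> filt (n + k)"
    by (simp add: power_add mult_ac)
qed (simp_all add: algebra_simps)

lemma bounded_mult_X: "bounded_mult fps_X"
  using fps_X_power_filt[of _ _ 1] unfolding bounded_mult_def bounded_op_def
  by (intro exI[of _ 1]) simp

lemma bounded_mult_q_power: "bounded_mult (q_power l)"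
proof -
  have "q_power l * f \<in> filt (n + nat \<bar>l\<bar>)" if "f \<in> filt n" for n f
    using _ _ _ that
  proof (rule linear_filt[where \<phi> = "\<lambda>f. q_power l * f"])
    fix i j s assume "i \<le> n" "\<bar>j\<bar> \<le> int n" "s < d"
    then have "fps_X ^ i * q_power (l + j) * F ^ s \<in> filt (n + nat \<bar>l\<bar>)"
      by (intro monomial_in_filt) auto
    then show "q_power l * (fps_X ^ i * q_power j * F ^ s) \<in> filt (n + nat \<bar>l\<bar>)"
      unfolding q_power_add by (simp add: mult_ac)
  qed (simp_all add: algebra_simps)
  then show ?thesis unfolding bounded_mult_def bounded_op_def by blast
qed

lemma bounded_mult_const: "bounded_mult (fps_const p)"
proof (induction p rule: poly_mapping_additive_induct)
  case (single k a)
  have "fps_const (Poly_Mapping.single k a) = fps_const (Poly_Mapping.single 0 a) * q_power k"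
    by (simp add: mult_single)
  then show ?case by (simp only: bounded_mult_mult bounded_mult_rat bounded_mult_q_power)
qed (simp add: bounded_mult_add flip: fps_const_add)

lemma bounded_mult_of_poly: "bounded_mult (fps_of_poly p)"
proof (induction p)
  case (pCons a p)
  have "fps_of_poly (pCons a p) = fps_const a + fps_X * fps_of_poly p"
    by (simp add: fps_of_poly_pCons mult.commute)
  then show ?case using pCons by (simp only: bounded_mult_add bounded_mult_mult bounded_mult_const bounded_mult_X)
qed (simp add: bounded_mult_0)

lemma F_power_d: "F ^ d = - (\<Sum>s<d. fps_of_poly (coeff Q s) * F ^ s)"
proof -
  have "0 = (\<Sum>s\<le>d. fps_of_poly (coeff Q s) * F ^ s)"
    unfolding root[symmetric] poly_at_altdef
    by (rule sum.mono_neutral_left) (use degree in \<open>auto simp: coeff_eq_0\<close>)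
  then show ?thesis by (simp add: lessThan_Suc_atMost[symmetric] monic add_eq_0_iff)
qed

text \<open>
  The only products that leave the span of the monomials are those with \<open>F ^ (d - 1)\<close>.  They are brought
  back by the equation of \<open>F\<close>, whose coefficients have bounded degree.
\<close>

lemma bounded_mult_F: "bounded_mult F"
proof -
  have "\<forall>s. \<exists>c. \<forall>n. \<forall>f\<in>filt n. fps_of_poly (coeff Q s) * f \<in> filt (n + c)"
    using bounded_mult_of_poly unfolding bounded_mult_def bounded_op_def by blast
  then obtain c where c: "\<And>s n f. f \<in> filt n \<Longrightarrow> fps_of_poly (coeff Q s) * f \<in> filt (n + c s)"
    by (auto dest!: choice)
  let ?c = "\<Sum>s<d. c s"
  have "F * f \<in> filt (n + ?c)" if "f \<in> filt n" for n f
    using _ _ _ that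
  proof (rule linear_filt[where \<phi> = "\<lambda>f. F * f"])
    fix i j s assume ij: "i \<le> n" "\<bar>j\<bar> \<le> int n" "s < d"
    show "F * (fps_X ^ i * q_power j * F ^ s) \<in> filt (n + ?c)"
    proof (cases "Suc s = d")
      case False
      then have "fps_X ^ i * q_power j * F ^ Suc s \<in> filt (n + ?c)"
        using ij by (intro filt_mono[OF _ monomial_in_filt[of i n j "Suc s"]]) auto
      then show ?thesis by (simp add: mult_ac)
    next
      case True
      have "F * (fps_X ^ i * q_power j * F ^ s) = fps_X ^ i * q_power j * F ^ d"
        by (simp add: mult_ac flip: True)
      also have "\<dots> = - (\<Sum>s<d. fps_of_poly (coeff Q s) * (fps_X ^ i * q_power j * F ^ s))"
        by (simp add: F_power_d sum_distrib_left mult_ac)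
      also have "\<dots> \<in> filt (n + ?c)"
      proof (intro laurent_space.span_neg laurent_space.span_sum)
        fix t assume t: "t \<in> {..<d}"
        then have "c t \<le> ?c" by (intro member_le_sum) auto
        then show "fps_of_poly (coeff Q t) * (fps_X ^ i * q_power j * F ^ t) \<in> filt (n + ?c)"
          using t ij by (intro filt_mono[OF _ c[OF monomial_in_filt[of i n j t]]]) auto
      qed
      finally show ?thesis .
    qed
  qed (simp_all add: algebra_simps)
  then show ?thesis unfolding bounded_mult_def bounded_op_def by blast
qed

lemma bounded_mult_poly_at: "bounded_mult (poly_at F p)"
  by (induction p) (simp_all add: bounded_mult_0 bounded_mult_add bounded_mult_mult bounded_mult_of_poly bounded_mult_F)

lemma poly_at_in_filt:
  assumes "0 < d"
  shows "\<exists>c. poly_at F p \<in> filt c"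
proof -
  obtain c where "\<And>n f. f \<in> filt n \<Longrightarrow> poly_at F p * f \<in> filt (n + c)"
    using bounded_mult_poly_at[of p] unfolding bounded_mult_def by (metis bounded_opE)
  from this[of 1 0] monomial_in_filt[of 0 0 0 0] assms show ?thesis by auto
qed

end

text \<open>
  Here \<open>H\<close> is the quotient \<open>b / v\<close> of two polynomials in \<open>F\<close>.  That \<open>F\<close> is a simple root of its equation
  makes its derivatives quotients with the denominator \<open>poly_at F (pderiv Q)\<close>.
\<close>

locale separable_element = monic_element +
  fixes v b :: "laurent poly poly" and H :: "laurent fps"
  assumes pderiv_nz: "poly_at F (pderiv Q) \<noteq> 0" and v_nz: "poly_at F v \<noteq> 0"
    and quotient: "poly_at F v * H = poly_at F b"
begin

definition \<Delta> :: "laurent fps" where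
  "\<Delta> = poly_at F (pderiv Q) * poly_at F v"

lemma Delta_nz: "\<Delta> \<noteq> 0"
  by (simp add: \<Delta>_def pderiv_nz v_nz)

lemma d_pos: "0 < d"
proof (rule ccontr)
  assume "\<not> 0 < d"
  then have "degree Q = 0" using degree by simp
  then have "pderiv Q = 0" by (simp add: pderiv_eq_0_iff)
  then show False using pderiv_nz by simp
qed

lemma bounded_mult_Delta: "bounded_mult \<Delta>"
  by (simp add: \<Delta>_def bounded_mult_mult bounded_mult_poly_at)

end

locale derivation_on_element = separable_element + laurent_derivation
begin

text \<open>
  Implicit differentiation of the equation of \<open>F\<close>.
\<close>

lemma deriv_F: "poly_at F (pderiv Q) * D F = - poly_at F (map_poly D' Q)"
  using poly_at[of F Q] rat[of 0] by (simp add: root add_eq_0_iff)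

lemma Delta_deriv_F: "\<Delta> * D F = - (poly_at F v * poly_at F (map_poly D' Q))"
proof -
  have "\<Delta> * D F = poly_at F v * (poly_at F (pderiv Q) * D F)"
    by (simp add: \<Delta>_def mult_ac)
  then show ?thesis by (simp add: deriv_F)
qed

lemma bounded_mult_Delta_deriv_F: "bounded_mult (\<Delta> * D F)"
  unfolding Delta_deriv_F by (intro bounded_mult_minus bounded_mult_mult bounded_mult_poly_at)

lemma bounded_mult_Delta_deriv_poly_at: "bounded_mult (\<Delta> * D (poly_at F p))"
proof -
  have "\<Delta> * D (poly_at F p) = \<Delta> * poly_at F (map_poly D' p) + poly_at F (pderiv p) * (\<Delta> * D F)"
    unfolding poly_at by (simp add: algebra_simps)
  then show ?thesis
    by (simp only: bounded_mult_add bounded_mult_mult bounded_mult_Delta bounded_mult_poly_at bounded_mult_Delta_deriv_F)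
qed

text \<open>
  A derivation need not preserve the polynomials in \<open>F\<close>, but its product with the denominator does.
\<close>

lemma bounded_op_Delta_deriv: "bounded_op (\<lambda>f. \<Delta> * D f)"
proof -
  obtain a where a: "\<And>n f. f \<in> filt n \<Longrightarrow> \<Delta> * f \<in> filt (n + a)"
    using bounded_mult_Delta unfolding bounded_mult_def by (metis bounded_opE)
  obtain c where c: "\<And>n f. f \<in> filt n \<Longrightarrow> \<Delta> * D F * f \<in> filt (n + c)"
    using bounded_mult_Delta_deriv_F unfolding bounded_mult_def by (metis bounded_opE)
  have "\<Delta> * D f \<in> filt (n + (1 + a + c))" if "f \<in> filt n" for n f
    using _ _ _ that
  proof (rule linear_filt[where \<phi> = "\<lambda>f. \<Delta> * D f"])
    fix i j s assume ij: "i \<le> n" "\<bar>j\<bar> \<le> int n" "s < d"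
    obtain x k l where m: "D (fps_X ^ i * q_power j) = rat_scale x (fps_X ^ k * q_power l)"
      "k \<le> i" "\<bar>l\<bar> \<le> \<bar>j\<bar> + 1" using monomial by blast
    have "fps_X ^ k * q_power l * F ^ s \<in> filt (n + 1)"
      using ij m by (intro monomial_in_filt) auto
    then have "\<Delta> * (fps_X ^ k * q_power l * F ^ s) \<in> filt (n + 1 + a)"
      by (rule a)
    then have "rat_scale x (\<Delta> * (fps_X ^ k * q_power l * F ^ s)) \<in> filt (n + (1 + a + c))"
      by (intro laurent_space.span_scale filt_mono[of "n + 1 + a" "n + (1 + a + c)"]) auto
    moreover have "\<Delta> * (fps_X ^ i * q_power j * D (F ^ s)) \<in> filt (n + (1 + a + c))"
    proof (cases s)
      case 0
      then show ?thesis using rat[of 1] by (simp add: laurent_space.span_zero)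
    next
      case (Suc t)
      have "D (F ^ s) = rat_scale (of_nat s) (F ^ t * D F)"
        unfolding Suc
      proof (induction t)
        case (Suc t)
        have "D (F ^ Suc (Suc t)) = D F * F ^ Suc t + F * D (F ^ Suc t)"
          by (simp only: power_Suc mult)
        also have "\<dots> = rat_scale 1 (F ^ Suc t * D F) + rat_scale (of_nat (Suc t)) (F ^ Suc t * D F)"
          unfolding Suc.IH by (simp add: mult_ac)
        also have "\<dots> = rat_scale (1 + of_nat (Suc t)) (F ^ Suc t * D F)"
          by (simp only: single_add fps_const_add[symmetric] distrib_right)
        finally show ?case by simp
      qed simp
      then have "\<Delta> * (fps_X ^ i * q_power j * D (F ^ s))
          = rat_scale (of_nat s) (\<Delta> * D F * (fps_X ^ i * q_power j * F ^ t))"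
        by (simp add: mult_ac)
      also have "\<dots> \<in> filt (n + (1 + a + c))"
        using ij Suc by (intro laurent_space.span_scale filt_mono[OF _ c[OF monomial_in_filt[of i n j t]]]) auto
      finally show ?thesis .
    qed
    moreover have "\<Delta> * D (fps_X ^ i * q_power j * F ^ s)
        = rat_scale x (\<Delta> * (fps_X ^ k * q_power l * F ^ s)) + \<Delta> * (fps_X ^ i * q_power j * D (F ^ s))"
      unfolding mult[of "fps_X ^ i * q_power j"] m(1) by (simp add: algebra_simps)
    ultimately show "\<Delta> * D (fps_X ^ i * q_power j * F ^ s) \<in> filt (n + (1 + a + c))"
      by (simp only: laurent_space.span_add)
  qed (simp_all only: add scale distrib_left mult.left_commute)
  then show ?thesis unfolding bounded_op_def by blast
qed

text \<open>
  The quotient rule: for a numerator \<open>g\<close> the derivative of \<open>g / \<Delta>\<^sup>m\<close> is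
  \<open>(\<Delta> * (\<Delta> * D g) - m * (\<Delta> * D \<Delta>) * g) / \<Delta>\<^bsup>m + 2\<^esup>\<close>, and both \<open>\<Delta> * D\<close> and the multiplications are bounded.
  The constant does not depend on \<open>m\<close>, since rational factors do not change the filtration degree.
\<close>

lemma numerator_step:
  "\<exists>c. \<forall>m n f. \<Delta> ^ m * f \<in> filt n \<longrightarrow> \<Delta> ^ (m + 2) * D f \<in> filt (n + c)"
proof -
  have 1: "bounded_op (\<lambda>g. \<Delta> * (\<Delta> * D g))"
    using bounded_op_comp[OF bounded_mult_Delta[unfolded bounded_mult_def] bounded_op_Delta_deriv] .
  have "\<Delta> = poly_at F (pderiv Q * v)" by (simp add: \<Delta>_def)
  then have 2: "bounded_op (\<lambda>g. \<Delta> * D \<Delta> * g)"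
    using bounded_mult_Delta_deriv_poly_at[of "pderiv Q * v"] unfolding bounded_mult_def by simp
  obtain a where a: "\<And>n g. g \<in> filt n \<Longrightarrow> \<Delta> * (\<Delta> * D g) \<in> filt (n + a)"
    using 1 by (metis bounded_opE)
  obtain c where c: "\<And>n g. g \<in> filt n \<Longrightarrow> \<Delta> * D \<Delta> * g \<in> filt (n + c)"
    using 2 by (metis bounded_opE)
  have "\<Delta> ^ (m + 2) * D f \<in> filt (n + (a + c))" if f: "\<Delta> ^ m * f \<in> filt n" for m n f
  proof -
    let ?g = "\<Delta> ^ m * f"
    have "\<Delta> * (\<Delta> * D ?g) = \<Delta> ^ (m + 2) * D f + \<Delta> * (\<Delta> * D (\<Delta> ^ m)) * f"
      unfolding mult by (simp add: algebra_simps power2_eq_square power_add)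
    also have "\<dots> = \<Delta> ^ (m + 2) * D f + rat_scale (of_nat m) (\<Delta> * D \<Delta> * ?g)"
      unfolding power by (simp add: mult_ac)
    finally have "\<Delta> ^ (m + 2) * D f = \<Delta> * (\<Delta> * D ?g) - rat_scale (of_nat m) (\<Delta> * D \<Delta> * ?g)"
      by simp
    also have "\<dots> \<in> filt (n + (a + c))"
      using filt_mono[OF _ a[OF f], of "n + (a + c)"] filt_mono[OF _ c[OF f], of "n + (a + c)"]
      by (intro laurent_space.span_diff laurent_space.span_scale) auto
    finally show ?thesis .
  qed
  then show ?thesis by blast
qed

lemma numerator_iterate:
  "\<exists>c. \<forall>k m n f. \<Delta> ^ m * f \<in> filt n \<longrightarrow> \<Delta> ^ (m + 2 * k) * (D ^^ k) f \<in> filt (n + k * c)"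
proof -
  obtain c where c: "\<And>m n f. \<Delta> ^ m * f \<in> filt n \<Longrightarrow> \<Delta> ^ (m + 2) * D f \<in> filt (n + c)"
    using numerator_step by blast
  have "\<Delta> ^ (m + 2 * k) * (D ^^ k) f \<in> filt (n + k * c)" if f: "\<Delta> ^ m * f \<in> filt n" for k m n f
  proof (induction k)
    case (Suc k)
    from c[OF Suc.IH] show ?case by (simp add: add_ac)
  qed (use f in simp)
  then show ?thesis by blast
qed

end

definition q_coeff :: "int \<Rightarrow> laurent fps \<Rightarrow> rat fps" where
  "q_coeff l H = Abs_fps (\<lambda>n. Poly_Mapping.lookup (fps_nth H n) l)"

lemma lookup_single_0_mult: "Poly_Mapping.lookup (Poly_Mapping.single 0 c * p) k = c * Poly_Mapping.lookup p k"
  for p :: laurent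
  by (simp add: map.rep_eq when_def flip: mult_map_scale_conv_mult)

lemma q_coeff_sum: "q_coeff l (sum f I) = (\<Sum>i\<in>I. q_coeff l (f i))"
  by (rule fps_ext) (simp add: q_coeff_def fps_sum_nth lookup_sum)

lemma q_coeff_scale: "q_coeff l (rat_scale c H) = fps_const c * q_coeff l H"
  by (rule fps_ext) (simp add: q_coeff_def lookup_single_0_mult)

lemma q_coeff_X_power: "q_coeff l (fps_X ^ i * H) = fps_X ^ i * q_coeff l H"
  by (rule fps_ext) (simp add: q_coeff_def fps_X_power_mult_nth)

lemma q_coeff_z_deriv: "q_coeff l (fps_deriv H) = fps_deriv (q_coeff l H)"
proof (rule fps_ext)
  fix n
  have "(of_nat (n + 1) :: laurent) = Poly_Mapping.single 0 (of_nat (n + 1))"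
    by (rule single_of_nat[symmetric])
  then show "fps_nth (q_coeff l (fps_deriv H)) n = fps_nth (fps_deriv (q_coeff l H)) n"
    by (simp only: q_coeff_def fps_deriv_nth fps_nth_Abs_fps lookup_single_0_mult)
qed

lemma q_coeff_z_deriv_iterate: "q_coeff l ((fps_deriv ^^ j) H) = (fps_deriv ^^ j) (q_coeff l H)"
  by (induction j) (simp_all add: q_coeff_z_deriv)

text \<open>
  The Pochhammer factor is \<open>(l + 1) \<dots> (l + k)\<close>.  It vanishes if and only if \<open>l < 0 \<le> l + k\<close>, that is
  when the differentiation leads from \<open>q\<^bsup>l + k\<^esup>\<close> through a constant.
\<close>

lemma q_coeff_q_deriv_iterate:
  "q_coeff l ((fps_q_deriv ^^ k) H) = fps_const (pochhammer (of_int (l + 1)) k) * q_coeff (l + int k) H"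
proof (induction k arbitrary: l)
  case (Suc k)
  have "q_coeff l (fps_q_deriv G) = fps_const (of_int (l + 1)) * q_coeff (l + 1) G" for G
    by (rule fps_ext) (simp add: q_coeff_def fps_q_deriv_def lookup_q_deriv)
  then have "q_coeff l ((fps_q_deriv ^^ Suc k) H)
      = fps_const (of_int (l + 1) * pochhammer (of_int (l + 1) + 1) k) * q_coeff (l + int (Suc k)) H"
    by (simp add: Suc.IH add_ac mult.assoc flip: fps_const_mult)
  then show ?case by (simp only: pochhammer_rec)
qed simp

context separable_element
begin

text \<open>
  Each of the at most \<open>2 * n\<close> derivatives costs two factors \<open>\<Delta>\<close>, and \<open>H\<close> itself one.
\<close>

lemma derivatives_bounded:
  "\<exists>K. \<forall>n i j k. i \<le> n \<longrightarrow> j \<le> n \<longrightarrow> k \<le> n \<longrightarrow>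
     \<Delta> ^ (4 * n + 1) * (fps_X ^ i * (fps_deriv ^^ j) ((fps_q_deriv ^^ k) H)) \<in> filt (K * (n + 1))"
proof -
  interpret dz: derivation_on_element F Q d v b H fps_deriv pderiv by unfold_locales
  interpret dq: derivation_on_element F Q d v b H fps_q_deriv "map_poly q_deriv" by unfold_locales
  have "\<Delta> * H = poly_at F (pderiv Q * b)"
    by (simp add: \<Delta>_def quotient[symmetric] mult_ac)
  then obtain c0 where c0: "\<Delta> ^ 1 * H \<in> filt c0"
    using poly_at_in_filt[OF d_pos, of "pderiv Q * b"] by auto
  obtain a where a: "\<And>k m n f. \<Delta> ^ m * f \<in> filt n \<Longrightarrow> \<Delta> ^ (m + 2 * k) * (fps_q_deriv ^^ k) f \<in> filt (n + k * a)"
    using dq.numerator_iterate by blast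
  obtain c where c: "\<And>k m n f. \<Delta> ^ m * f \<in> filt n \<Longrightarrow> \<Delta> ^ (m + 2 * k) * (fps_deriv ^^ k) f \<in> filt (n + k * c)"
    using dz.numerator_iterate by blast
  obtain w where w: "\<And>n f. f \<in> filt n \<Longrightarrow> \<Delta> * f \<in> filt (n + w)"
    using bounded_mult_Delta unfolding bounded_mult_def by (metis bounded_opE)
  have pow: "\<Delta> ^ p * f \<in> filt (n + p * w)" if "f \<in> filt n" for p n f
  proof (induction p)
    case (Suc p)
    from w[OF Suc.IH] show ?case by (simp add: algebra_simps)
  qed (use that in simp)
  let ?K = "c0 + a + c + 4 * w + 1"
  have "\<Delta> ^ (4 * n + 1) * (fps_X ^ i * (fps_deriv ^^ j) ((fps_q_deriv ^^ k) H)) \<in> filt (?K * (n + 1))"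
    if ijk: "i \<le> n" "j \<le> n" "k \<le> n" for n i j k
  proof -
    let ?f = "(fps_deriv ^^ j) ((fps_q_deriv ^^ k) H)"
    have "\<Delta> ^ (1 + 2 * k + 2 * j) * ?f \<in> filt (c0 + k * a + j * c)"
      by (intro c a c0)
    from fps_X_power_filt[OF pow[OF this, of "4 * n - 2 * k - 2 * j"], of i]
    have "fps_X ^ i * (\<Delta> ^ (4 * n - 2 * k - 2 * j) * (\<Delta> ^ (1 + 2 * k + 2 * j) * ?f))
        \<in> filt (c0 + k * a + j * c + (4 * n - 2 * k - 2 * j) * w + i)" .
    moreover have "\<Delta> ^ (4 * n + 1) = \<Delta> ^ (4 * n - 2 * k - 2 * j) * \<Delta> ^ (1 + 2 * k + 2 * j)"
      using ijk by (simp flip: power_add)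
    then have "\<Delta> ^ (4 * n + 1) * (fps_X ^ i * ?f)
        = fps_X ^ i * (\<Delta> ^ (4 * n - 2 * k - 2 * j) * (\<Delta> ^ (1 + 2 * k + 2 * j) * ?f))"
      by (simp only: mult_ac)
    ultimately have "\<Delta> ^ (4 * n + 1) * (fps_X ^ i * ?f)
        \<in> filt (c0 + k * a + j * c + (4 * n - 2 * k - 2 * j) * w + i)"
      by (simp only:)
    moreover have "c0 + k * a + j * c + (4 * n - 2 * k - 2 * j) * w + i \<le> ?K * (n + 1)"
    proof -
      have "k * a \<le> n * a" "j * c \<le> n * c" "(4 * n - 2 * k - 2 * j) * w \<le> (4 * n) * w"
        using ijk by (auto intro!: mult_le_mono1)
      moreover have "?K * (n + 1) = ?K + n * c0 + n * a + n * c + 4 * n * w + n"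
        by (simp add: algebra_simps)
      ultimately show ?thesis using ijk(1) by linarith
    qed
    ultimately show ?thesis by (rule filt_mono[rotated])
  qed
  then show ?thesis by blast
qed

text \<open>
  There are \<open>(n + 1)\<^sup>3\<close> series on the left hand side, and for a common denominator their numerators
  lie in a space whose dimension is quadratic in \<open>n\<close>.
\<close>

lemma annihilator:
  "\<exists>n c. (\<exists>i\<le>n. \<exists>j\<le>n. \<exists>k\<le>n. c (i, j, k) \<noteq> 0) \<and>
    (\<Sum>(i, j, k)\<in>{..n} \<times> {..n} \<times> {..n}.
       rat_scale (c (i, j, k)) (fps_X ^ i * (fps_deriv ^^ j) ((fps_q_deriv ^^ k) H))) = 0"
proof -
  obtain K where K: "\<And>n i j k. i \<le> n \<Longrightarrow> j \<le> n \<Longrightarrow> k \<le> n \<Longrightarrow>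
     \<Delta> ^ (4 * n + 1) * (fps_X ^ i * (fps_deriv ^^ j) ((fps_q_deriv ^^ k) H)) \<in> filt (K * (n + 1))"
    using derivatives_bounded by blast
  let ?g = "\<lambda>(i, j, k). fps_X ^ i * (fps_deriv ^^ j) ((fps_q_deriv ^^ k) H)"
  \<comment> \<open>large enough for \<open>(n + 1)\<^sup>3\<close> to exceed the number of monomials of degree \<open>K * (n + 1)\<close>,
    which is at most \<open>(K + 1) * (2 * K + 1) * d * (n + 1)\<^sup>2\<close>\<close>
  define n where "n = (K + 1) * (2 * K + 1) * d"
  let ?I = "{..n} \<times> {..n} \<times> {..n}"
  let ?m = "K * (n + 1)"
  have "card (monomials ?m) \<le> (?m + 1) * (2 * ?m + 1) * d" by (rule card_monomials)
  also have "\<dots> \<le> ((K + 1) * (n + 1)) * ((2 * K + 1) * (n + 1)) * d"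
    by (intro mult_le_mono) (simp_all add: algebra_simps)
  also have "\<dots> = ((K + 1) * (2 * K + 1) * d) * (n + 1) * (n + 1)"
    by (simp only: mult_ac)
  also have "\<dots> = n * (n + 1) * (n + 1)"
    by (simp only: n_def)
  also have "\<dots> < (n + 1) * (n + 1) * (n + 1)"
    by (intro mult_strict_right_mono) auto
  also have "\<dots> = card ?I" by (simp add: card_cartesian_product)
  finally have "card (monomials ?m) < card ?I" .
  then have "\<exists>c. (\<exists>t\<in>?I. c t \<noteq> 0) \<and> (\<Sum>t\<in>?I. rat_scale (c t) (\<Delta> ^ (4 * n + 1) * ?g t)) = 0"
    by (intro laurent_space.nontrivial_relation[of _ "monomials ?m"])
      (use K[of _ n] finite_monomials in \<open>auto split: prod.splits\<close>)
  then obtain c where c: "\<exists>t\<in>?I. c t \<noteq> 0" "(\<Sum>t\<in>?I. rat_scale (c t) (\<Delta> ^ (4 * n + 1) * ?g t)) = 0"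
    by blast
  have "\<Delta> ^ (4 * n + 1) * (\<Sum>t\<in>?I. rat_scale (c t) (?g t)) = 0"
    using c(2) by (simp only: sum_distrib_left mult.left_commute)
  then have "(\<Sum>t\<in>?I. rat_scale (c t) (?g t)) = 0"
    using Delta_nz by simp
  then have "(\<Sum>(i, j, k)\<in>?I. rat_scale (c (i, j, k)) (?g (i, j, k))) = 0"
    by (simp add: case_prod_beta)
  then show ?thesis using c(1) by (intro exI[of _ n] exI[of _ c]) auto
qed

text \<open>
  Let \<open>k0\<close> be the lowest order in \<open>\<partial>\<^sub>q\<close> that occurs in the annihilator, and take the coefficient of
  \<open>q\<^bsup>- 1 - k0\<^esup>\<close>.  For a derivative of order \<open>k > k0\<close> it comes from \<open>q\<^bsup>k - 1 - k0\<^esup>\<close>, whose \<open>k\<close>-th derivative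
  is \<open>0\<close>; for the order \<open>k0\<close> it is a nonzero multiple of the residue.  So a differential equation in
  \<open>z\<close> for the residue remains.
\<close>

theorem residue_D_finite: "D_finite (q_coeff (- 1) H)"
proof -
  obtain n c where nz: "\<exists>i\<le>n. \<exists>j\<le>n. \<exists>k\<le>n. c (i, j, k) \<noteq> 0"
    and rel: "(\<Sum>(i, j, k)\<in>{..n} \<times> {..n} \<times> {..n}.
       rat_scale (c (i, j, k)) (fps_X ^ i * (fps_deriv ^^ j) ((fps_q_deriv ^^ k) H))) = 0"
    using annihilator by blast
  let ?P = "\<lambda>k. k \<le> n \<and> (\<exists>i\<le>n. \<exists>j\<le>n. c (i, j, k) \<noteq> 0)"
  define k0 where "k0 = (LEAST k. ?P k)"
  have ex: "\<exists>k. ?P k" using nz by blast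
  have k0: "?P k0" unfolding k0_def by (rule LeastI_ex[OF ex])
  have less: "c (i, j, k) = 0" if "k < k0" "i \<le> n" "j \<le> n" for i j k
    using not_less_Least[of k ?P] that k0 unfolding k0_def[symmetric] by auto
  let ?f = "q_coeff (- 1) H"
  let ?l = "- 1 - int k0"
  let ?h = "pochhammer (- of_nat k0 :: rat) k0"
  have h: "?h \<noteq> 0" by (rule pochhammer_of_nat_eq_0_lemma') simp
  have l: "of_int (?l + 1) = (- of_nat k0 :: rat)" by simp
  have summand: "q_coeff ?l (rat_scale (c (i, j, k)) (fps_X ^ i * (fps_deriv ^^ j) ((fps_q_deriv ^^ k) H)))
      = (if k = k0 then fps_const (c (i, j, k)) * (fps_X ^ i * (fps_deriv ^^ j) (fps_const ?h * ?f)) else 0)"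
    if "i \<le> n" "j \<le> n" "k \<le> n" for i j k
  proof -
    consider "k < k0" | "k = k0" | "k > k0" by linarith
    then show ?thesis
    proof cases
      case 1
      then show ?thesis unfolding q_coeff_scale using less that by simp
    next
      case 2
      then show ?thesis
        by (simp add: q_coeff_scale q_coeff_X_power q_coeff_z_deriv_iterate q_coeff_q_deriv_iterate)
    next
      case 3
      have "pochhammer (of_int (?l + 1) :: rat) k = 0"
        unfolding l by (rule pochhammer_of_nat_eq_0_lemma[OF 3])
      moreover have "(fps_deriv ^^ j) 0 = (0 :: rat fps)" by (induction j) auto
      ultimately show ?thesis using 3
        by (simp add: q_coeff_scale q_coeff_X_power q_coeff_z_deriv_iterate q_coeff_q_deriv_iterate del: of_int_add)
    qed
  qed
  have const: "(fps_deriv ^^ j) (fps_const ?h * g) = fps_const ?h * (fps_deriv ^^ j) g" for j and g :: "rat fps"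
    by (induction j) simp_all
  have "0 = q_coeff ?l (\<Sum>(i, j, k)\<in>{..n} \<times> {..n} \<times> {..n}.
       rat_scale (c (i, j, k)) (fps_X ^ i * (fps_deriv ^^ j) ((fps_q_deriv ^^ k) H)))"
    unfolding rel by (simp add: q_coeff_def fps_eq_iff)
  also have "\<dots> = (\<Sum>(i, j, k)\<in>{..n} \<times> {..n} \<times> {..n}.
      if k = k0 then fps_const (c (i, j, k)) * (fps_X ^ i * (fps_deriv ^^ j) (fps_const ?h * ?f)) else 0)"
    unfolding q_coeff_sum by (intro sum.cong) (auto simp: summand)
  also have "\<dots> = (\<Sum>i\<le>n. \<Sum>j\<le>n. fps_const (c (i, j, k0)) * (fps_X ^ i * (fps_deriv ^^ j) (fps_const ?h * ?f)))"
    using k0 by (simp add: sum.cartesian_product[symmetric] sum.delta)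
  also have "\<dots> = fps_const ?h * (\<Sum>i\<le>n. \<Sum>j\<le>n. fps_const (c (i, j, k0)) * fps_X ^ i * (fps_deriv ^^ j) ?f)"
    unfolding const by (simp add: sum_distrib_left mult_ac)
  also have "\<dots> = fps_const ?h * (\<Sum>j\<le>n. \<Sum>i\<le>n. fps_const (c (i, j, k0)) * fps_X ^ i * (fps_deriv ^^ j) ?f)"
    by (subst sum.swap) simp
  finally have eq: "(\<Sum>j\<le>n. \<Sum>i\<le>n. fps_const (c (i, j, k0)) * fps_X ^ i * (fps_deriv ^^ j) ?f) = 0"
    using h by simp
  define p where "p = (\<Sum>j\<le>n. monom (\<Sum>i\<le>n. monom (c (i, j, k0)) i) j)"
  have coeff_p: "coeff p j = (if j \<le> n then \<Sum>i\<le>n. monom (c (i, j, k0)) i else 0)" for j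
    by (simp add: p_def coeff_sum coeff_monom)
  obtain i j where ij: "i \<le> n" "j \<le> n" "c (i, j, k0) \<noteq> 0" using k0 by blast
  then have "coeff (coeff p j) i \<noteq> 0" by (simp add: coeff_p coeff_sum coeff_monom)
  then have p: "p \<noteq> 0" by auto
  have deg: "degree p \<le> n" by (rule degree_le) (simp add: coeff_p)
  have "(\<Sum>j\<le>degree p. fps_of_poly (coeff p j) * (fps_deriv ^^ j) ?f)
      = (\<Sum>j\<le>n. fps_of_poly (coeff p j) * (fps_deriv ^^ j) ?f)"
    using deg by (intro sum.mono_neutral_left) (auto simp: coeff_eq_0)
  also have "\<dots> = (\<Sum>j\<le>n. \<Sum>i\<le>n. fps_const (c (i, j, k0)) * fps_X ^ i * (fps_deriv ^^ j) ?f)"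
    by (intro sum.cong) (simp_all add: coeff_p fps_of_poly_sum fps_of_poly_monom sum_distrib_right)
  finally show ?thesis using p eq unfolding D_finite_def by (intro exI[of _ p]) simp
qed

end

section \<open>Upper bound for the cogrowth rate\<close>

text \<open>
  For \<open>t = exp \<theta>\<close> the quantity \<open>tilt_w N t\<close> is \<open>sinh \<theta> * tanh (N * \<theta> / 2)\<close>, and \<open>tilt_lam N t\<close> is the
  positive root of \<open>y\<^sup>2 + 2 * tilt_w N t * y = 1\<close>.  The positive function \<open>tilt_potential\<close> on the states
  grows by the factor \<open>tilt_rate N t\<close> at most when it is summed over the neighbours of a state: at the exponents
  that \<open>N\<close> does not divide, the letters \<open>a\<close> and \<open>a\<^sup>-\<^sup>1\<close> together contribute \<open>t + 1 / t\<close>, and each of \<open>b\<close> and \<open>b\<^sup>-\<^sup>1\<close>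
  contributes \<open>tilt_lam N t\<close>.
\<close>

definition tilt_w :: "nat \<Rightarrow> real \<Rightarrow> real" where
  "tilt_w N t = (t - 1 / t) * (t ^ N - 1) / (2 * (t ^ N + 1))"

definition tilt_lam :: "nat \<Rightarrow> real \<Rightarrow> real" where
  "tilt_lam N t = sqrt (1 + (tilt_w N t)\<^sup>2) - tilt_w N t"

definition tilt_rate :: "nat \<Rightarrow> real \<Rightarrow> real" where
  "tilt_rate N t = t + 1 / t + 2 * tilt_lam N t"

lemma tilt_w_nonneg:
  assumes "1 \<le> t" shows "0 \<le> tilt_w N t"
proof -
  have "1 / t \<le> t" using assms by (simp add: divide_le_eq mult_ge1_I)
  moreover have "1 \<le> t ^ N" using assms by (rule one_le_power)
  ultimately show ?thesis by (simp add: tilt_w_def)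
qed

lemma tilt_lam_quadratic: "(tilt_lam N t)\<^sup>2 + 2 * tilt_w N t * tilt_lam N t = 1"
proof -
  have "(sqrt (1 + (tilt_w N t)\<^sup>2))\<^sup>2 = 1 + (tilt_w N t)\<^sup>2" by simp
  then show ?thesis by (simp add: tilt_lam_def power2_eq_square algebra_simps)
qed

lemma tilt_lam_pos: "0 < tilt_lam N t"
proof -
  have "\<bar>tilt_w N t\<bar> < sqrt (1 + (tilt_w N t)\<^sup>2)"
    by (rule real_less_rsqrt) simp
  then show ?thesis by (simp add: tilt_lam_def)
qed

lemma tilt_lam_unique:
  assumes "0 \<le> l" "0 \<le> tilt_w N t" "l\<^sup>2 + 2 * tilt_w N t * l = 1"
  shows "l = tilt_lam N t"
proof -
  have "(l + tilt_w N t)\<^sup>2 = 1 + (tilt_w N t)\<^sup>2"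
    using assms(3) by (simp add: power2_eq_square algebra_simps)
  then have "sqrt (1 + (tilt_w N t)\<^sup>2) = l + tilt_w N t"
    using assms(1,2) by (intro real_sqrt_unique) auto
  then show ?thesis by (simp add: tilt_lam_def)
qed

lemma tilt_lam_le_1:
  assumes "1 \<le> t" shows "tilt_lam N t \<le> 1"
proof -
  have "0 \<le> 2 * tilt_w N t * tilt_lam N t"
    using tilt_w_nonneg[OF assms] tilt_lam_pos[of N t] by simp
  then have "(tilt_lam N t)\<^sup>2 \<le> 1\<^sup>2"
    unfolding power_one using tilt_lam_quadratic[of N t] by linarith
  then show ?thesis by (rule power2_le_imp_le) simp
qed

text \<open>
  For \<open>t = exp \<theta>\<close> this is \<open>cosh (\<theta> * (r - N / 2)) / cosh (\<theta> * N / 2)\<close>, where \<open>r\<close> is the residue of \<open>k\<close>: an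
  eigenfunction of the random walk on the integers, folded to period \<open>N\<close>.  The folding causes the
  defect \<open>2 * tilt_w N t\<close> at the multiples of \<open>N\<close>.
\<close>

definition cosh_weight :: "nat \<Rightarrow> real \<Rightarrow> int \<Rightarrow> real" where
  "cosh_weight N t k = (t ^ nat (k mod int N) + t ^ (N - nat (k mod int N))) / (1 + t ^ N)"

lemma cosh_weight_pos: "0 < t \<Longrightarrow> 0 < cosh_weight N t k"
  unfolding cosh_weight_def by (intro divide_pos_pos add_pos_pos) auto

lemma cosh_weight_0:
  assumes "0 < t" "int N dvd k" shows "cosh_weight N t k = 1"
proof -
  have "k mod int N = 0" using assms(2) by simp
  moreover have "1 + t ^ N > 0" using assms(1) by (intro add_pos_pos) auto
  ultimately show ?thesis by (simp add: cosh_weight_def)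
qed

lemma cosh_weight_mod [simp]: "cosh_weight N t (k mod int N) = cosh_weight N t k"
  by (simp add: cosh_weight_def)

lemma cosh_weight_neighbours:
  assumes N: "0 < N" and t: "0 < t"
  shows "cosh_weight N t (k + 1) + cosh_weight N t (k - 1)
    = (t + 1 / t) * cosh_weight N t k - (if int N dvd k then 2 * tilt_w N t else 0)"
proof -
  define \<phi> where "\<phi> j = (t ^ j + t ^ (N - j)) / (1 + t ^ N)" for j
  have pos: "1 + t ^ N > 0" using t by (intro add_pos_pos) auto
  define r where "r = nat (k mod int N)"
  have r: "int r = k mod int N" "r < N" using N by (simp_all add: r_def nat_less_iff)
  have k: "cosh_weight N t k = \<phi> r" by (simp add: cosh_weight_def \<phi>_def r_def)
  have dvd: "int N dvd k \<longleftrightarrow> r = 0" using r(1) by (auto simp: dvd_eq_mod_eq_0)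
  have up: "cosh_weight N t (k + 1) = \<phi> (r + 1)"
  proof (cases "r + 1 = N")
    case True
    have "(k + 1) mod int N = (k mod int N + 1) mod int N" by (simp add: mod_add_left_eq)
    also have "\<dots> = int N mod int N" unfolding r(1)[symmetric] using True by (metis of_nat_Suc Suc_eq_plus1 add.commute)
    also have "\<dots> = 0" by simp
    finally show ?thesis unfolding True by (simp add: cosh_weight_def \<phi>_def add.commute)
  next
    case False
    have "(k + 1) mod int N = (k mod int N + 1) mod int N" by (simp add: mod_add_left_eq)
    also have "\<dots> = int (r + 1)" using False r(2) by (simp flip: r(1))
    finally have m: "(k + 1) mod int N = int (r + 1)" .
    show ?thesis unfolding cosh_weight_def m nat_int \<phi>_def by (rule HOL.refl)
  qed
  have km: "(k - 1) mod int N = (int r - 1) mod int N" unfolding r(1) by (simp add: mod_diff_left_eq)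
  show ?thesis
  proof (cases "r = 0")
    case True
    have "(k - 1) mod int N = int (N - 1)"
      unfolding km using N True zmod_minus1[of "int N"] by (simp add: of_nat_diff)
    then have down: "cosh_weight N t (k - 1) = \<phi> (N - 1)"
      by (simp add: cosh_weight_def \<phi>_def)
    obtain n where n: "N = Suc n" using N by (cases N) auto
    have T: "1 + t * t ^ n > 0" using pos by (simp add: n)
    have "\<phi> 1 + \<phi> (N - 1) = 2 * (t + t ^ n) / (1 + t * t ^ n)"
      by (simp add: \<phi>_def n add_divide_distrib)
    also have "\<dots> = (t + 1 / t) - 2 * tilt_w N t"
    proof -
      have "t * t ^ n + 1 \<noteq> 0" "1 + t * t ^ n \<noteq> 0" "t \<noteq> 0" using T t by auto
      then show ?thesis by (simp add: tilt_w_def n divide_simps) (simp add: algebra_simps)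
    qed
    finally show ?thesis unfolding up down k dvd using True pos by (simp add: \<phi>_def)
  next
    case False
    have "(k - 1) mod int N = int (r - 1)"
      unfolding km using False r(2) by (simp add: of_nat_diff)
    then have down: "cosh_weight N t (k - 1) = \<phi> (r - 1)"
      by (simp add: cosh_weight_def \<phi>_def)
    obtain i where i: "r = Suc i" using False by (cases r) auto
    obtain m where m: "N - r = Suc m" using r(2) by (cases "N - r") auto
    have e: "N - (r + 1) = m" "N - (r - 1) = Suc (Suc m)" using m i by auto
    have "\<phi> (r + 1) + \<phi> (r - 1) = (t ^ (r + 1) + t ^ m + t ^ i + t ^ Suc (Suc m)) / (1 + t ^ N)"
      unfolding \<phi>_def e by (simp add: i add_divide_distrib)
    also have "\<dots> = (t + 1 / t) * \<phi> r"
    proof -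
      have "t ^ (r + 1) + t ^ m + t ^ i + t ^ Suc (Suc m) = (t + 1 / t) * (t ^ r + t ^ Suc m)"
        using t by (simp add: i field_simps)
      then show ?thesis unfolding \<phi>_def m by simp
    qed
    finally show ?thesis unfolding up down k dvd using False by simp
  qed
qed

definition tilt_potential :: "nat \<Rightarrow> real \<Rightarrow> nf_state \<Rightarrow> real" where
  "tilt_potential N t st = cosh_weight N t (snd st)
     * (\<Prod>(j, s)\<leftarrow>fst st. tilt_lam N t * cosh_weight N t (int j))"

lemma tilt_potential_pos:
  assumes "0 < t" shows "0 < tilt_potential N t st"
proof -
  have "0 < (\<Prod>(j, s)\<leftarrow>ps. tilt_lam N t * cosh_weight N t (int j))" for ps :: "(nat \<times> bool) list"
    by (induction ps) (auto simp: tilt_lam_pos cosh_weight_pos[OF assms])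
  then show ?thesis by (simp add: tilt_potential_def cosh_weight_pos[OF assms])
qed

lemma tilt_potential_push:
  assumes "0 < N" "0 < t" and np: "\<nexists>j qs. ps = (j, \<not> s) # qs \<and> k mod int N = 0"
  shows "tilt_potential N t (nf_push N s (ps, k)) = tilt_lam N t * tilt_potential N t (ps, k)"
proof -
  have r: "0 \<le> k mod int N" using assms(1) by simp
  have d: "int N dvd k - k mod int N" by (simp add: mod_eq_dvd_iff[symmetric])
  have "nf_push N s (ps, k) = ((nat (k mod int N), s) # ps, k - k mod int N)"
    using np by (cases rule: nf_push_cases[of ps s k N]) auto
  then show ?thesis using r by (simp add: tilt_potential_def cosh_weight_0[OF assms(2) d])
qed

text \<open>
  A push multiplies the potential by \<open>tilt_lam N t\<close>, removing a block divides it by this number.  Where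
  a block can be removed the exponent is a multiple of \<open>N\<close>, and the surplus
  \<open>1 / tilt_lam N t - tilt_lam N t\<close> is just the defect \<open>2 * tilt_w N t\<close> of \<open>cosh_weight\<close>.  On the empty stack
  there is no block to remove, so the potential is only superharmonic there.
\<close>

lemma tilt_potential_step:
  assumes N: "0 < N" and t: "1 \<le> t"
  shows "(\<Sum>x\<in>{A, A', B, B'}. tilt_potential N t (nf_step N x st)) \<le> tilt_rate N t * tilt_potential N t st"
proof -
  obtain ps k where st: "st = (ps, k)" by (cases st)
  have t0: "0 < t" using t by simp
  let ?h = "tilt_potential N t" and ?l = "tilt_lam N t" and ?w = "tilt_w N t"
  have l: "0 < ?l" "?l \<le> 1" using tilt_lam_pos tilt_lam_le_1[OF t] by auto
  have inv: "1 / ?l = ?l + 2 * ?w"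
    using tilt_lam_quadratic[of N t] l by (simp add: field_simps power2_eq_square)
  have hpos: "0 < ?h st" for st using tilt_potential_pos[OF t0] .
  have "?h (ps, k + 1) + ?h (ps, k - 1)
      = (cosh_weight N t (k + 1) + cosh_weight N t (k - 1))
        * (\<Prod>(j, s)\<leftarrow>ps. ?l * cosh_weight N t (int j))"
    by (simp add: tilt_potential_def distrib_right)
  also have "\<dots> = (t + 1 / t) * ?h (ps, k) - (if int N dvd k then 2 * ?w * ?h (ps, k) else 0)"
    unfolding cosh_weight_neighbours[OF N t0]
    by (simp add: tilt_potential_def left_diff_distrib cosh_weight_0[OF t0])
  finally have a: "?h (ps, k + 1) + ?h (ps, k - 1)
      = (t + 1 / t) * ?h (ps, k) - (if int N dvd k then 2 * ?w * ?h (ps, k) else 0)" .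
  have b: "?h (nf_push N True (ps, k)) + ?h (nf_push N False (ps, k))
      \<le> 2 * ?l * ?h (ps, k) + (if int N dvd k then 2 * ?w * ?h (ps, k) else 0)"
  proof (cases "\<exists>j s qs. ps = (j, s) # qs \<and> int N dvd k")
    case True
    then obtain j s qs where ps: "ps = (j, s) # qs" and k: "int N dvd k" by blast
    have push: "?h (nf_push N s (ps, k)) = ?l * ?h (ps, k)"
      by (rule tilt_potential_push[OF N t0]) (simp add: ps)
    have m: "(int j + k) mod int N = int j mod int N"
      using k by (metis dvd_eq_mod_eq_0 mod_add_right_eq add.right_neutral)
    have "?h (nf_push N (\<not> s) (ps, k)) = ?h (qs, int j + k)"
      using k by (simp add: ps)
    also have "cosh_weight N t (int j + k) = cosh_weight N t (int j)"
      using m cosh_weight_mod[of N t "int j + k"] cosh_weight_mod[of N t "int j"] by simp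
    then have "?h (qs, int j + k) = 1 / ?l * ?h (ps, k)"
      using l by (simp add: tilt_potential_def ps cosh_weight_0[OF t0 k])
    finally have pop: "?h (nf_push N (\<not> s) (ps, k)) = ?l * ?h (ps, k) + 2 * ?w * ?h (ps, k)"
      unfolding inv by (simp add: distrib_right)
    have "?h (nf_push N True (ps, k)) + ?h (nf_push N False (ps, k))
        = ?h (nf_push N s (ps, k)) + ?h (nf_push N (\<not> s) (ps, k))"
      by (cases s) simp_all
    then show ?thesis using push pop k by simp
  next
    case False
    have "?h (nf_push N s (ps, k)) = ?l * ?h (ps, k)" for s
      by (rule tilt_potential_push[OF N t0]) (use False in \<open>auto simp: dvd_eq_mod_eq_0\<close>)
    moreover have "0 \<le> 2 * ?w * ?h (ps, k)"
      using tilt_w_nonneg[OF t] hpos[of "(ps, k)"] by simp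
    ultimately show ?thesis by simp
  qed
  have "(\<Sum>x\<in>{A, A', B, B'}. ?h (nf_step N x st)) = ?h (ps, k + 1) + ?h (ps, k - 1)
      + (?h (nf_push N True (ps, k)) + ?h (nf_push N False (ps, k)))"
    by (simp add: st add_ac)
  also have "\<dots> \<le> (t + 1 / t) * ?h (ps, k) + 2 * ?l * ?h (ps, k)"
    using a b by simp
  finally show ?thesis by (simp add: tilt_rate_def st algebra_simps)
qed

lemma tilt_potential_words:
  assumes N: "0 < N" and t: "1 \<le> t"
  shows "(\<Sum>w | length w = n. tilt_potential N t (nf_act N w st)) \<le> tilt_rate N t ^ n * tilt_potential N t st"
proof (induction n arbitrary: st)
  case (Suc n)
  have "0 < tilt_rate N t" using t tilt_lam_pos[of N t] by (simp add: tilt_rate_def add_pos_pos)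
  have "(\<Sum>w | length w = Suc n. tilt_potential N t (nf_act N w st))
      = (\<Sum>x\<in>{A, A', B, B'}. \<Sum>w | length w = n. tilt_potential N t (nf_act N w (nf_step N x st)))"
    by (simp only: sum_words_Suc nf_act_simps)
  also have "\<dots> \<le> (\<Sum>x\<in>{A, A', B, B'}. tilt_rate N t ^ n * tilt_potential N t (nf_step N x st))"
    by (intro sum_mono Suc.IH)
  also have "\<dots> \<le> tilt_rate N t ^ n * (tilt_rate N t * tilt_potential N t st)"
    unfolding sum_distrib_left[symmetric]
    using tilt_potential_step[OF N t] \<open>0 < tilt_rate N t\<close> by (intro mult_left_mono) auto
  finally show ?case by (simp add: mult_ac)
qed simp

theorem cogrowth_le_tilt_rate:
  assumes N: "0 < N" and t: "1 \<le> t"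
  shows "real (cogrowth N n) \<le> tilt_rate N t ^ n"
proof -
  have one: "tilt_potential N t ([], 0) = 1"
    using t by (simp add: tilt_potential_def cosh_weight_0)
  have fin: "finite {w :: letter list. length w = n}" by (rule finite_words)
  have "real (cogrowth N n) = (\<Sum>w\<in>{w. length w = n \<and> nf_act N w ([], 0) = ([], 0)}. tilt_potential N t (nf_act N w ([], 0)))"
    by (simp add: cogrowth_eq_g_count[OF N] g_count_nf_act[OF N] one)
  also have "\<dots> \<le> (\<Sum>w | length w = n. tilt_potential N t (nf_act N w ([], 0)))"
    using t by (intro sum_mono2[OF fin]) (auto intro!: less_imp_le[OF tilt_potential_pos])
  also have "\<dots> \<le> tilt_rate N t ^ n" using tilt_potential_words[OF N t, of "([], 0)" n] one by simp
  finally show ?thesis .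
qed

lemma tilt_rate_minimum: "\<exists>t0\<ge>1. \<forall>t\<ge>1. tilt_rate N t0 \<le> tilt_rate N t"
proof -
  have pos: "2 * (t ^ N + 1) \<noteq> 0" if "1 \<le> t" for t :: real
    using one_le_power[OF that, of N] by (smt (verit))
  \<comment> \<open>the value at \<open>1\<close> is \<open>4\<close>, and \<open>tilt_rate N t > t\<close>, so the interval from \<open>1\<close> to \<open>5\<close> suffices\<close>
  have "continuous_on {1..5} (tilt_rate N)"
    unfolding tilt_rate_def tilt_lam_def tilt_w_def
    by (intro continuous_intros) (use pos in \<open>auto simp del: distrib_left_numeral\<close>)
  then obtain t0 where t0: "t0 \<in> {1..5}" "\<And>t. t \<in> {1..5} \<Longrightarrow> tilt_rate N t0 \<le> tilt_rate N t"
    using continuous_attains_inf[of "{1..5::real}" "tilt_rate N"] by auto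
  have "tilt_rate N t0 \<le> tilt_rate N t" if "1 \<le> t" for t
  proof (cases "t \<le> 5")
    case False
    have "tilt_rate N t0 \<le> tilt_rate N 1" using t0(2) by simp
    also have "\<dots> = 4" by (simp add: tilt_rate_def tilt_lam_def tilt_w_def)
    also have "\<dots> \<le> tilt_rate N t"
      using False tilt_lam_pos[of N t] by (simp add: tilt_rate_def add_increasing2)
    finally show ?thesis .
  qed (use t0 that in auto)
  then show ?thesis using t0(1) by auto
qed

section \<open>Lower bound for the cogrowth rate\<close>

text \<open>
  The sum of the stored exponents and the current one is changed by the letters \<open>a\<close> and \<open>a\<^sup>-\<^sup>1\<close> only.
\<close>

lemma return_exponent_bound:
  assumes N: "0 < N" and w: "nf_act N w ([], 0) = ([], k)"
  shows "\<bar>k\<bar> \<le> int (length w)"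
proof -
  define \<sigma> where "\<sigma> st = (\<Sum>(j, s)\<leftarrow>fst st. int j) + snd st" for st :: nf_state
  have push: "\<sigma> (nf_push N s st) = \<sigma> st" for s st
  proof -
    obtain ps k where st: "st = (ps, k)" by (cases st)
    have "0 \<le> k mod int N" using N by simp
    then show ?thesis
      by (cases rule: nf_push_cases[of ps s k N]) (auto simp: st \<sigma>_def)
  qed
  have step: "\<bar>\<sigma> (nf_step N x st) - \<sigma> st\<bar> \<le> 1" for x st
    by (cases st; cases x) (auto simp: push, auto simp: \<sigma>_def)
  have "\<bar>\<sigma> (nf_act N w st) - \<sigma> st\<bar> \<le> int (length w)" for st
  proof (induction w arbitrary: st)
    case (Cons x w)
    show ?case using Cons.IH[of "nf_step N x st"] step[of x st] by simp
  qed simp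
  from this[of "([], 0)"] show ?thesis by (simp add: w \<sigma>_def)
qed

text \<open>
  If \<open>u\<close> and \<open>v\<close> both represent \<open>a\<^sup>k\<close>, then \<open>u v\<^sup>-\<^sup>1\<close> represents the identity.
\<close>

lemma g_count_square_le:
  assumes N: "0 < N"
  shows "(g_count N n k)\<^sup>2 \<le> cogrowth N (2 * n)"
proof -
  let ?S = "{w. length w = n \<and> nf_act N w ([], 0) = ([], k)}"
  let ?f = "\<lambda>(u, v). u @ rev (map inv_letter v)"
  have inj_inv: "u = v" if "map inv_letter u = map inv_letter v" for u v
  proof -
    have "map inv_letter (map inv_letter u) = map inv_letter (map inv_letter v)" using that by simp
    then show ?thesis by (simp add: comp_def)
  qed
  have "inj_on ?f (?S \<times> ?S)"
    by (auto simp: inj_on_def dest: inj_inv)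
  moreover have "?f ` (?S \<times> ?S) \<subseteq> {w. length w = 2 * n \<and> nf_act N w ([], 0) = ([], 0)}"
  proof safe
    fix u v assume u: "nf_act N u ([], 0) = ([], k)" and v: "nf_act N v ([], 0) = ([], k)"
    have "nf_act N (v @ rev (map inv_letter v)) ([], 0) = ([], 0)"
      using nf_act_cong[OF N bs_eq_inverse_right, of "([], 0)" v] by simp
    then show "nf_act N (u @ rev (map inv_letter v)) ([], 0) = ([], 0)"
      using u v by simp
  qed auto
  moreover have "finite {w. length w = 2 * n \<and> nf_act N w ([], 0) = ([], 0)}"
    by (rule finite_subset[OF _ finite_words[of "2 * n"]]) auto
  ultimately have "card (?S \<times> ?S) \<le> card {w. length w = 2 * n \<and> nf_act N w ([], 0) = ([], 0)}"
    by (rule card_inj_on_le)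
  then show ?thesis
    by (simp add: cogrowth_eq_g_count[OF N] g_count_nf_act[OF N] card_cartesian_product power2_eq_square)
qed

text \<open>
  The roots of \<open>y\<^sup>2 - x (t + 1 / t) y + x\<^sup>2\<close> are \<open>x t\<close> and \<open>x / t\<close>.
\<close>

lemma lucas_U_closed:
  fixes x t :: real
  assumes "t \<noteq> 0"
  shows "x * lucas_U (x * (t + 1 / t)) x n * (t - 1 / t) = x ^ n * (t ^ n - 1 / t ^ n)"
proof (induction n rule: induct_nat_012)
  case (ge2 n)
  have 1: "x * (y * a - x\<^sup>2 * b) * s = y * (x * a * s) - x\<^sup>2 * (x * b * s)" for y a b s
    by (simp add: algebra_simps)
  have 2: "x * a * (x ^ Suc n * b) - x\<^sup>2 * (x ^ n * c) = x ^ Suc (Suc n) * (a * b - c)" for a b c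
    by (simp add: algebra_simps power2_eq_square)
  have "x * lucas_U (x * (t + 1 / t)) x (Suc (Suc n)) * (t - 1 / t)
      = x ^ Suc (Suc n) * ((t + 1 / t) * (t ^ Suc n - 1 / t ^ Suc n) - (t ^ n - 1 / t ^ n))"
    unfolding lucas_U.simps 1 ge2 2 by (rule HOL.refl)
  also have "(t + 1 / t) * (t ^ Suc n - 1 / t ^ Suc n) - (t ^ n - 1 / t ^ n) = t ^ Suc (Suc n) - 1 / t ^ Suc (Suc n)"
    using assms by (simp add: field_simps)
  finally show ?case .
qed simp_all

text \<open>
  Writing \<open>1 - 2 * l = x * (t + 1 / t)\<close> turns the Lucas polynomials into powers of \<open>t\<close>.  The powers of
  \<open>x\<close> then cancel, and what remains is the quadratic equation of \<open>tilt_lam N t\<close> for \<open>l / x\<close>.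
\<close>

lemma tilt_rate_of_root:
  fixes x l :: real
  assumes N: "0 < N" and x: "0 < x" and l: "0 \<le> l" and gt: "2 * x < 1 - 2 * l"
    and eq: "l * ((1 - 2 * l) * lucas_U (1 - 2 * l) x N - 2 * x\<^sup>2 * lucas_U (1 - 2 * l) x (N - 1) - x ^ N * 2)
      = lucas_U (1 - 2 * l) x N * (x\<^sup>2 - l\<^sup>2)"
  shows "\<exists>t\<ge>1. 1 / x = tilt_rate N t"
proof -
  define a where "a = (1 - 2 * l) / x"
  have a: "2 < a" using gt x by (simp add: a_def field_simps)
  \<comment> \<open>the larger solution of \<open>t + 1 / t = a\<close>\<close>
  define t where "t = (a + sqrt (a\<^sup>2 - 4)) / 2"
  have "2\<^sup>2 \<le> a\<^sup>2" using a by (intro power_mono) auto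
  then have sq: "(sqrt (a\<^sup>2 - 4))\<^sup>2 = a\<^sup>2 - 4" by simp
  have "0 \<le> sqrt (a\<^sup>2 - 4)" using \<open>2\<^sup>2 \<le> a\<^sup>2\<close> by simp
  from add_less_le_mono[OF a this] have t: "1 < t" by (simp add: t_def)
  have "t * t - a * t + 1 = 0"
    using sq by (simp add: t_def power2_eq_square field_simps)
  then have at: "a = t + 1 / t" using t by (simp add: field_simps)
  have X: "1 - 2 * l = x * (t + 1 / t)" using x by (simp add: at[symmetric] a_def)
  define \<kappa> where "\<kappa> = l / x"
  have l': "l = x * \<kappa>" using x by (simp add: \<kappa>_def)
  define s T where "s = t - 1 / t" and "T = t ^ N"
  have "1 / t < 1" using t by simp
  then have s: "s > 0" using t unfolding s_def by linarith
  have T: "T > 1" using t N by (simp add: T_def)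
  define U V where "U = lucas_U (1 - 2 * l) x N" and "V = lucas_U (1 - 2 * l) x (N - 1)"
  have U: "x * U * s = x ^ N * (T - 1 / T)"
    unfolding U_def s_def X T_def using t by (intro lucas_U_closed) simp
  have "x * V * s = x ^ (N - 1) * (t ^ (N - 1) - 1 / t ^ (N - 1))"
    unfolding V_def s_def X using t by (intro lucas_U_closed) simp
  then have "x * (x * V * s) = x ^ N * (t ^ (N - 1) - 1 / t ^ (N - 1))"
    using N by (cases N) simp_all
  also have "t ^ (N - 1) = T / t" using N t by (cases N) (simp_all add: T_def)
  finally have V: "x * (x * V * s) = x ^ N * (T / t - t / T)" using t by simp
  have "x * s * ((1 - 2 * l) * U - 2 * x\<^sup>2 * V - x ^ N * 2)
      = x * (t + 1 / t) * (x * U * s) - 2 * x * (x * (x * V * s)) - x ^ N * (2 * (x * s))"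
    unfolding X by (simp add: algebra_simps power2_eq_square)
  also have "\<dots> = x * x ^ N * ((t + 1 / t) * (T - 1 / T) - 2 * (T / t - t / T) - 2 * s)"
    unfolding U V by (simp add: algebra_simps)
  also have "(t + 1 / t) * (T - 1 / T) - 2 * (T / t - t / T) - 2 * s = s * (T + 1 / T - 2)"
    using t T by (simp add: s_def field_simps)
  finally have C: "x * s * ((1 - 2 * l) * U - 2 * x\<^sup>2 * V - x ^ N * 2) = x * x ^ N * (s * (T + 1 / T - 2))" .
  have "x * (s * (l * ((1 - 2 * l) * U - 2 * x\<^sup>2 * V - x ^ N * 2))) = x * (s * (U * (x\<^sup>2 - l\<^sup>2)))"
    using eq by (simp only: U_def V_def)
  then have "l * (x * s * ((1 - 2 * l) * U - 2 * x\<^sup>2 * V - x ^ N * 2)) = x * U * s * (x\<^sup>2 - l\<^sup>2)"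
    by (simp only: mult_ac)
  then have "x * \<kappa> * (x * x ^ N * (s * (T + 1 / T - 2))) = x ^ N * (T - 1 / T) * (x\<^sup>2 - (x * \<kappa>)\<^sup>2)"
    unfolding C U by (simp only: l')
  then have "x\<^sup>2 * x ^ N * (\<kappa> * s * (T + 1 / T - 2)) = x\<^sup>2 * x ^ N * ((T - 1 / T) * (1 - \<kappa>\<^sup>2))"
    by (simp only: algebra_simps power2_eq_square)
  then have "\<kappa> * s * (T + 1 / T - 2) = (T - 1 / T) * (1 - \<kappa>\<^sup>2)" using x by simp
  then have "T * (\<kappa> * s * (T + 1 / T - 2)) = T * ((T - 1 / T) * (1 - \<kappa>\<^sup>2))" by simp
  then have "(T - 1) * (\<kappa> * s * (T - 1)) = (T - 1) * ((T + 1) * (1 - \<kappa>\<^sup>2))"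
    using T by (simp add: algebra_simps)
  then have k: "\<kappa> * s * (T - 1) = (T + 1) * (1 - \<kappa>\<^sup>2)" using T by simp
  have "2 * tilt_w N t * (T + 1) = s * (T - 1)"
  proof -
    have "2 * (p / (2 * c)) * c = p" if "0 < c" for p c :: real using that by simp
    from this[of "T + 1" "s * (T - 1)"] T show ?thesis
      unfolding tilt_w_def s_def[symmetric] T_def[symmetric] by linarith
  qed
  then have "(T + 1) * (\<kappa>\<^sup>2 + 2 * tilt_w N t * \<kappa>) = (T + 1) * \<kappa>\<^sup>2 + \<kappa> * (s * (T - 1))"
    by (simp only: distrib_left mult_ac)
  also have "\<kappa> * (s * (T - 1)) = (T + 1) * (1 - \<kappa>\<^sup>2)" using k by (simp only: mult.assoc)
  also have "(T + 1) * \<kappa>\<^sup>2 + (T + 1) * (1 - \<kappa>\<^sup>2) = (T + 1) * 1"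
    by (simp only: distrib_left[symmetric]) simp
  finally have "\<kappa>\<^sup>2 + 2 * tilt_w N t * \<kappa> = 1"
    using T by (simp only: mult_cancel_left) linarith
  moreover have "0 \<le> \<kappa>" using l x by (simp add: \<kappa>_def)
  ultimately have "\<kappa> = tilt_lam N t"
    using tilt_w_nonneg[of t N] t by (intro tilt_lam_unique) auto
  then have "tilt_rate N t = a + 2 * (l / x)"
    by (simp only: tilt_rate_def at \<kappa>_def)
  also have "\<dots> = 1 / x" unfolding a_def by (simp flip: add_divide_distrib)
  finally have "1 / x = tilt_rate N t" ..
  then show ?thesis using t by (intro exI[of _ t]) auto
qed

locale real_walk = bs_walk N "\<lambda>_. 1 :: real" for N
begin

lemma psi_coeff_nonneg: "0 \<le> psi_coeff n k"
proof (induction n arbitrary: k rule: less_induct)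
  case (less n)
  then show ?case by (cases n) (auto intro!: add_nonneg_nonneg mult_nonneg_nonneg sum_nonneg)
qed

lemma G_nth_card: "fps_nth G n = real (card {w. length w = n \<and> fst (nf_act N w ([], 0)) = []})"
proof -
  have "path_weight st = (if fst st = [] then 1 else 0)" for st
    by (cases st) simp
  then show ?thesis
    unfolding G_nth using finite_words[of n] by (simp add: sum.If_cases Collect_conj_eq)
qed

text \<open>
  An excursion returns to the empty stack.
\<close>

lemma Exc_nth_bounds: "0 \<le> fps_nth Exc n" "fps_nth Exc n \<le> fps_nth G n"
proof -
  show nn: "0 \<le> fps_nth Exc n" for n
    by (simp add: Exc_def Psi_def psi_coeff_nonneg)
  have G0: "fps_nth G 0 = 1" by (subst G_eq) (simp add: Exc_def)
  have Gnn: "0 \<le> fps_nth G n" for n by (simp add: G_nth_card)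
  have "fps_nth Exc n = fps_nth Exc n * fps_nth G (n - n)" by (simp add: G0)
  also have "\<dots> \<le> (\<Sum>i=0..n. fps_nth Exc i * fps_nth G (n - i))"
    using nn Gnn by (intro member_le_sum) auto
  also have "\<dots> = fps_nth (Exc * G) n" by (simp add: fps_mult_nth)
  also have "\<dots> \<le> fps_nth G n"
  proof -
    have "fps_nth G n = fps_nth (1 + fps_X * (fps_const 2 * G) + (fps_const 2 * (Exc * G))) n"
      by (subst G_eq) (simp add: mult.assoc numeral_fps_const)
    also have "\<dots> \<ge> fps_nth (Exc * G) n"
      using nn Gnn by (auto simp: fps_mult_nth[of Exc] intro!: add_increasing sum_nonneg)
    finally show ?thesis .
  qed
  finally show "fps_nth Exc n \<le> fps_nth G n" .
qed

text \<open>
  Inside the disc of convergence the algebraic equation of the series holds for their values.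
\<close>

lemma converges_imp_tilt_rate:
  assumes x: "0 < x" and conv: "ereal x < fps_conv_radius G"
  shows "\<exists>t\<ge>1. 1 / x = tilt_rate N t"
proof -
  define ok where "ok f \<longleftrightarrow> ereal (norm x) < fps_conv_radius f" for f :: "real fps"
  let ?ev = "\<lambda>f. eval_fps f x"
  have okG: "ok G" using conv x by (simp add: ok_def)
  have "fps_conv_radius G \<le> fps_conv_radius Exc"
    unfolding fps_conv_radius_def
  proof (rule conv_radius_geI_ex)
    fix r :: real assume r: "0 < r" "ereal r < conv_radius (fps_nth G)"
    then have "summable (\<lambda>n. fps_nth G n * r ^ n)" by (intro summable_in_conv_radius) simp
    then have "summable (\<lambda>n. fps_nth Exc n * r ^ n)"
      by (rule summable_comparison_test') (use r Exc_nth_bounds in \<open>auto intro!: mult_right_mono\<close>)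
    then show "\<exists>z. norm z = r \<and> summable (\<lambda>n. fps_nth Exc n * z ^ n)"
      using r by (intro exI[of _ r]) simp
  qed
  then have okE: "ok Exc" using okG unfolding ok_def by (rule less_le_trans[rotated])
  have ok_add: "ok (f + g)" if "ok f" "ok g" for f g
    using that unfolding ok_def by (intro less_le_trans[OF _ fps_conv_radius_add]) simp
  have ok_diff: "ok (f - g)" if "ok f" "ok g" for f g
    using that unfolding ok_def by (intro less_le_trans[OF _ fps_conv_radius_diff]) simp
  have ok_mult: "ok (f * g)" if "ok f" "ok g" for f g
    using that unfolding ok_def by (intro less_le_trans[OF _ fps_conv_radius_mult]) simp
  have ok_base: "ok (fps_const c)" "ok fps_X" "ok (fps_X ^ n)" "ok 1" "ok 2" for c n
    by (simp_all add: ok_def)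
  note ok_intros = ok_add ok_diff ok_mult ok_base
  have ev: "?ev (f + g) = ?ev f + ?ev g" "?ev (f - g) = ?ev f - ?ev g" "?ev (f * g) = ?ev f * ?ev g"
    if "ok f" "ok g" for f g
    using that unfolding ok_def by (auto simp: eval_fps_add eval_fps_diff eval_fps_mult)
  have okX: "ok X" unfolding X_def by (intro ok_intros okE)
  define l where "l = ?ev Exc"
  have X: "?ev X = 1 - 2 * l"
    unfolding X_def l_def by (simp add: ev ok_mult ok_base okE)
  have U: "ok (lucas_U X fps_X n) \<and> ?ev (lucas_U X fps_X n) = lucas_U (1 - 2 * l) x n" for n
  proof (induction n rule: induct_nat_012)
    case (ge2 n)
    then show ?case
      by (auto simp: ev ok_mult ok_diff ok_base okX X)
  qed (auto simp: ok_def)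
  have l: "0 \<le> l"
    unfolding l_def eval_fps_def using okE Exc_nth_bounds(1) x unfolding ok_def
    by (intro suminf_nonneg summable_fps) auto
  have "0 \<le> ?ev G"
    unfolding eval_fps_def using okG x unfolding ok_def
    by (intro suminf_nonneg summable_fps) (auto simp: G_nth_card)
  moreover have "?ev G * (1 - 2 * l - x * 2) = 1"
  proof -
    have "?ev (G * (X - fps_X * fps_const (1 + 1))) = ?ev G * (1 - 2 * l - x * (1 + 1))"
      using okG okX by (simp only: ev ok_mult ok_diff ok_base X) simp
    then show ?thesis unfolding G_inverse by simp
  qed
  ultimately have gt: "2 * x < 1 - 2 * l"
    by (smt (verit) mult_nonneg_nonpos)
  have "?ev (Exc * (X * lucas_U X fps_X N - 2 * fps_X\<^sup>2 * lucas_U X fps_X (N - 1) - fps_X ^ N * fps_const (1 + 1)))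
      = l * ((1 - 2 * l) * lucas_U (1 - 2 * l) x N - 2 * x\<^sup>2 * lucas_U (1 - 2 * l) x (N - 1) - x ^ N * 2)"
    using okE okX U by (simp add: ev ok_mult ok_diff ok_base X l_def[symmetric])
  moreover have "?ev (lucas_U X fps_X N * (fps_X\<^sup>2 - Exc\<^sup>2)) = lucas_U (1 - 2 * l) x N * (x\<^sup>2 - l\<^sup>2)"
    using okE okX U unfolding power2_eq_square by (simp add: ev ok_mult ok_diff ok_base X l_def[symmetric])
  ultimately have eq: "l * ((1 - 2 * l) * lucas_U (1 - 2 * l) x N - 2 * x\<^sup>2 * lucas_U (1 - 2 * l) x (N - 1) - x ^ N * 2)
      = lucas_U (1 - 2 * l) x N * (x\<^sup>2 - l\<^sup>2)"
    using Exc_algebraic by simp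
  show ?thesis by (rule tilt_rate_of_root[OF N_pos x l gt eq])
qed

text \<open>
  At most \<open>2 * n + 1\<close> exponents occur at the end of a path of length \<open>n\<close>, and each of them is the end of
  at most \<open>sqrt (cogrowth N (2 * n))\<close> paths.
\<close>

lemma G_nth_le:
  assumes "real (cogrowth N (2 * n)) \<le> r ^ (2 * n)" "0 \<le> r"
  shows "fps_nth G n \<le> real (2 * n + 1) * r ^ n"
proof -
  let ?S = "\<lambda>k. {w. length w = n \<and> nf_act N w ([], 0) = ([], k)}"
  have "{w. length w = n \<and> fst (nf_act N w ([], 0)) = []} \<subseteq> (\<Union>k\<in>{- int n..int n}. ?S k)"
  proof safe
    fix w assume "fst (nf_act N w ([], 0)) = []"
    then obtain k where k: "nf_act N w ([], 0) = ([], k)" by (metis prod.collapse)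
    then show "w \<in> (\<Union>k\<in>{- int (length w)..int (length w)}. {v. length v = length w \<and> nf_act N v ([], 0) = ([], k)})"
      using return_exponent_bound[OF N_pos k] by auto
  qed
  moreover have fin: "finite (?S k)" for k
    by (rule finite_subset[OF _ finite_words[of n]]) auto
  ultimately have "card {w. length w = n \<and> fst (nf_act N w ([], 0)) = []} \<le> card (\<Union>k\<in>{- int n..int n}. ?S k)"
    by (intro card_mono) auto
  also have "\<dots> \<le> (\<Sum>k\<in>{- int n..int n}. card (?S k))"
    by (rule card_UN_le) simp
  finally have "fps_nth G n \<le> (\<Sum>k\<in>{- int n..int n}. real (g_count N n k))"
    by (simp add: G_nth_card g_count_nf_act[OF N_pos] flip: of_nat_sum)
  also have "\<dots> \<le> of_nat (card {- int n..int n}) * r ^ n"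
  proof (rule sum_bounded_above)
    fix k
    have "(real (g_count N n k))\<^sup>2 \<le> (r ^ n)\<^sup>2"
      using order.trans[OF _ assms(1), of "(real (g_count N n k))\<^sup>2"] g_count_square_le[OF N_pos, of n k]
      by (simp add: power_mult[symmetric] mult.commute flip: of_nat_power)
    then show "real (g_count N n k) \<le> r ^ n" by (rule power2_le_imp_le) (use assms(2) in simp)
  qed
  also have "card {- int n..int n} = 2 * n + 1" by simp
  finally show ?thesis .
qed

end

text \<open>
  If the rate were smaller than the minimum, the series \<open>G\<close> would converge at some \<open>x\<close> with
  \<open>1 / x\<close> below the minimum, although \<open>1 / x\<close> is a value of \<open>tilt_rate N\<close>.
\<close>

theorem cogrowth_rate_eq:
  assumes N: "0 < N" and t0: "1 \<le> t0" and min: "\<And>t. 1 \<le> t \<Longrightarrow> tilt_rate N t0 \<le> tilt_rate N t"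
  shows "cogrowth_rate N = ereal (tilt_rate N t0)"
proof -
  let ?\<mu> = "tilt_rate N t0"
  interpret real_walk N by unfold_locales (use N in auto)
  have \<mu>: "0 < ?\<mu>" using t0 tilt_lam_pos[of N t0] by (simp add: tilt_rate_def add_pos_pos)
  have "root n (real (cogrowth N n)) \<le> ?\<mu>" if "n > 0" for n
  proof -
    have "root n (real (cogrowth N n)) \<le> root n (?\<mu> ^ n)"
      using cogrowth_le_tilt_rate[OF N t0, of n] that by (simp add: real_root_le_mono)
    then show ?thesis using \<mu> that by (simp add: real_root_power_cancel)
  qed
  then have upper: "cogrowth_rate N \<le> ereal ?\<mu>"
    unfolding cogrowth_rate_def by (intro Limsup_bounded eventually_sequentiallyI[of 1]) auto
  have "\<not> cogrowth_rate N < ereal ?\<mu>"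
  proof
    assume "cogrowth_rate N < ereal ?\<mu>"
    then have "max (cogrowth_rate N) 0 < ereal ?\<mu>" using \<mu> by simp
    then obtain r where r: "max (cogrowth_rate N) 0 < ereal r" "r < ?\<mu>"
      using ereal_dense2 by (metis ereal_less(2) less_ereal.simps(1))
    have r0: "0 < r" using r(1) by simp
    have "eventually (\<lambda>n. ereal (root n (real (cogrowth N n))) < ereal r) sequentially"
      using r(1) unfolding cogrowth_rate_def by (intro Limsup_lessD) simp
    then obtain n0 where n0: "\<And>n. n \<ge> n0 \<Longrightarrow> root n (real (cogrowth N n)) < r"
      unfolding eventually_sequentially by auto
    have c: "real (cogrowth N n) \<le> r ^ n" if "n \<ge> n0" "n > 0" for n
    proof -
      have "real (cogrowth N n) = root n (real (cogrowth N n)) ^ n"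
        using that by (simp add: real_root_pow_pos2)
      also have "\<dots> \<le> r ^ n" using n0[of n] that by (intro power_mono) auto
      finally show ?thesis .
    qed
    \<comment> \<open>\<open>1 / x\<close> and \<open>1 / y\<close> divide the interval between \<open>r\<close> and the minimum into thirds\<close>
    define x y where "x = 1 / (r + (?\<mu> - r) * 2 / 3)" and "y = 1 / (r + (?\<mu> - r) / 3)"
    have x: "0 < x" "1 / x < ?\<mu>" and xy: "x < y" and y: "0 < y" "r * y < 1"
      using r r0 unfolding x_def y_def by (auto simp: field_simps add_pos_pos)
    have "summable (\<lambda>n. fps_nth G n * y ^ n)"
    proof (rule summable_comparison_test_ev)
      have "summable (\<lambda>n. real (Suc n) * (r * y) ^ n)"
        using geometric_deriv_sums[of "r * y"] r0 y by (auto simp: sums_iff)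
      then show "summable (\<lambda>n. 2 * (real (Suc n) * (r * y) ^ n))" by (rule summable_mult)
      show "eventually (\<lambda>n. norm (fps_nth G n * y ^ n) \<le> 2 * (real (Suc n) * (r * y) ^ n)) sequentially"
      proof (rule eventually_sequentiallyI[of "n0 + 1"])
        fix n assume "n0 + 1 \<le> n"
        then have "fps_nth G n \<le> real (2 * n + 1) * r ^ n"
          using c[of "2 * n"] r0 by (intro G_nth_le) auto
        also have "\<dots> \<le> (2 * real (Suc n)) * r ^ n"
          using r0 by (intro mult_right_mono) auto
        finally have "fps_nth G n * y ^ n \<le> 2 * real (Suc n) * r ^ n * y ^ n"
          using y by (intro mult_right_mono) auto
        also have "\<dots> = 2 * (real (Suc n) * (r * y) ^ n)"
          by (simp only: power_mult_distrib mult_ac)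
        finally show "norm (fps_nth G n * y ^ n) \<le> 2 * (real (Suc n) * (r * y) ^ n)"
          using y by (simp add: G_nth_card)
      qed
    qed
    then have "ereal (norm y) \<le> fps_conv_radius G"
      unfolding fps_conv_radius_def by (rule conv_radius_geI)
    moreover have "ereal x < ereal (norm y)" using xy y by simp
    ultimately have "ereal x < fps_conv_radius G" by (rule less_le_trans[rotated])
    then obtain t where "1 \<le> t" "1 / x = tilt_rate N t"
      using converges_imp_tilt_rate[OF x(1)] by blast
    then show False using min[of t] x(2) by simp
  qed
  then show ?thesis using upper by simp
qed

section \<open>The cogrowth rate is an algebraic number\<close>

interpretation rat_space: vector_space "\<lambda>(c::rat) (x::'a::field_char_0). of_rat c * x"
  by unfold_locales (simp_all add: algebra_simps of_rat_add of_rat_mult)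

text \<open>
  In a finite-dimensional space that contains \<open>1\<close> and is stable under multiplication by \<open>x\<close>, the powers
  of \<open>x\<close> are linearly dependent.
\<close>

lemma algebraic_if_stable:
  fixes x :: "'a::field_char_0"
  assumes S: "finite S" and one: "1 \<in> rat_space.span S"
    and stable: "\<And>v. v \<in> rat_space.span S \<Longrightarrow> x * v \<in> rat_space.span S"
  shows "algebraic x"
proof -
  have pow: "x ^ i \<in> rat_space.span S" for i
    by (induction i) (auto intro: one stable)
  then obtain c where c: "\<exists>i\<in>{..card S}. c i \<noteq> 0" "(\<Sum>i\<le>card S. of_rat (c i) * x ^ i) = 0"
    using rat_space.nontrivial_relation[of "{..card S}" S "\<lambda>i. x ^ i"] S by auto
  define p where "p = (\<Sum>i\<le>card S. monom (of_rat (c i) :: 'a) i)"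
  have co: "coeff p i = (if i \<le> card S then of_rat (c i) else 0)" for i
    by (simp add: p_def coeff_sum coeff_monom)
  show ?thesis
  proof (rule algebraicI')
    show "coeff p i \<in> \<rat>" for i by (simp add: co)
    obtain i where "i \<le> card S" "c i \<noteq> 0" using c(1) by auto
    then have "coeff p i \<noteq> 0" by (simp add: co)
    then show "p \<noteq> 0" by auto
    show "poly p x = 0" using c(2) by (simp add: p_def poly_sum poly_monom)
  qed
qed

lemma algebraic_power_relation:
  fixes x :: "'a::field_char_0"
  assumes "algebraic x"
  shows "\<exists>d>0. \<exists>c::nat \<Rightarrow> rat. x ^ d = (\<Sum>i<d. of_rat (c i) * x ^ i)"
proof -
  obtain p where p: "\<And>i. coeff p i \<in> \<rat>" "p \<noteq> 0" "poly p x = 0"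
    using assms unfolding algebraic_altdef by blast
  define d where "d = degree p"
  have "d \<noteq> 0"
  proof
    assume "d = 0"
    then obtain a where "p = [:a:]" unfolding d_def using degree_eq_zeroE by blast
    then show False using p(2,3) by simp
  qed
  have "\<forall>i. \<exists>q. coeff p i = of_rat q"
    using p(1) Rats_cases by blast
  then obtain r where r: "\<And>i. coeff p i = of_rat (r i)" by (auto dest: choice)
  have rd: "r d \<noteq> 0" using p(2) r[of d] unfolding d_def by force
  have "(\<Sum>i\<le>d. of_rat (r i) * x ^ i) = 0"
    using p(3) by (simp add: poly_altdef d_def r)
  then have "of_rat (r d) * x ^ d = - (\<Sum>i<d. of_rat (r i) * x ^ i)"
    by (simp add: lessThan_Suc_atMost[symmetric] add_eq_0_iff)
  then have "x ^ d = - (\<Sum>i<d. of_rat (r i) * x ^ i) / of_rat (r d)"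
    using rd by (simp add: field_simps)
  also have "\<dots> = (\<Sum>i<d. of_rat (- r i / r d) * x ^ i)"
    by (simp add: sum_divide_distrib of_rat_divide of_rat_minus flip: sum_negf)
  finally have "x ^ d = (\<Sum>i<d. of_rat (- r i / r d) * x ^ i)" .
  moreover have "d > 0" using \<open>d \<noteq> 0\<close> by simp
  ultimately have "d > 0 \<and> (\<exists>c. x ^ d = (\<Sum>i<d. of_rat (c i) * x ^ i))"
    by (intro conjI exI[of _ "\<lambda>i. - r i / r d"])
  then show ?thesis by (rule exI)
qed

text \<open>
  The products of the powers of \<open>x\<close> and of \<open>y\<close> below the respective degrees span such a space for
  both \<open>x\<close> and \<open>y\<close>, and hence for their sum and product.
\<close>

lemma algebraic_common_module:
  fixes x y :: "'a::field_char_0"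
  assumes "algebraic x" "algebraic y"
  shows "\<exists>S. finite S \<and> 1 \<in> rat_space.span S \<and>
    (\<forall>v\<in>rat_space.span S. x * v \<in> rat_space.span S \<and> y * v \<in> rat_space.span S)"
proof -
  obtain d c where d: "d > 0" "x ^ d = (\<Sum>i<d. of_rat (c i) * x ^ i)"
    using algebraic_power_relation[OF assms(1)] by blast
  obtain m b where m: "m > 0" "y ^ m = (\<Sum>i<m. of_rat (b i) * y ^ i)"
    using algebraic_power_relation[OF assms(2)] by blast
  define S where "S = (\<lambda>(i, j). x ^ i * y ^ j) ` ({..<d} \<times> {..<m})"
  have S: "x ^ i * y ^ j \<in> rat_space.span S" if "i < d" "j < m" for i j
    using that by (intro rat_space.span_base) (auto simp: S_def)
  have xS: "x * s \<in> rat_space.span S \<and> y * s \<in> rat_space.span S" if "s \<in> S" for s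
  proof -
    obtain i j where ij: "s = x ^ i * y ^ j" "i < d" "j < m" using \<open>s \<in> S\<close> by (auto simp: S_def)
    have "x ^ Suc i * y ^ j \<in> rat_space.span S"
    proof (cases "Suc i = d")
      case True
      then have "x ^ Suc i * y ^ j = (\<Sum>i<d. of_rat (c i) * (x ^ i * y ^ j))"
        by (simp only: d(2) sum_distrib_right mult.assoc)
      then show ?thesis using S ij by (auto intro!: rat_space.span_sum rat_space.span_scale)
    qed (use S[of "Suc i" j] ij in auto)
    moreover have "x ^ i * y ^ Suc j \<in> rat_space.span S"
    proof (cases "Suc j = m")
      case True
      then have "x ^ i * y ^ Suc j = (\<Sum>j<m. of_rat (b j) * (x ^ i * y ^ j))"
        by (simp only: m(2) sum_distrib_left mult.left_commute[of "x ^ i"])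
      then show ?thesis using S ij by (auto intro!: rat_space.span_sum rat_space.span_scale)
    qed (use S[of i "Suc j"] ij in auto)
    ultimately show ?thesis by (simp add: ij mult_ac)
  qed
  have stable: "a * v \<in> rat_space.span S"
    if a: "\<And>s. s \<in> S \<Longrightarrow> a * s \<in> rat_space.span S" and v: "v \<in> rat_space.span S" for a v
    using v
  proof (induction rule: rat_space.span_induct_alt)
    case (step c s v)
    have "a * (of_rat c * s + v) = of_rat c * (a * s) + a * v" by (simp add: algebra_simps)
    then show ?case using a step by (simp add: rat_space.span_add rat_space.span_scale)
  qed (simp add: rat_space.span_zero)
  have "finite S" by (simp add: S_def)
  moreover have "1 \<in> rat_space.span S" using S[of 0 0] d(1) m(1) by simp
  ultimately show ?thesis using stable xS by blast
qed

lemma algebraic_add: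
  fixes x y :: "'a::field_char_0"
  assumes "algebraic x" "algebraic y"
  shows "algebraic (x + y)"
proof -
  obtain S where "finite S" "1 \<in> rat_space.span S"
    "\<forall>v\<in>rat_space.span S. x * v \<in> rat_space.span S \<and> y * v \<in> rat_space.span S"
    using algebraic_common_module[OF assms] by blast
  then show ?thesis by (intro algebraic_if_stable[of S]) (auto simp: distrib_right rat_space.span_add)
qed

lemma algebraic_mult:
  fixes x y :: "'a::field_char_0"
  assumes "algebraic x" "algebraic y"
  shows "algebraic (x * y)"
proof -
  obtain S where "finite S" "1 \<in> rat_space.span S"
    "\<forall>v\<in>rat_space.span S. x * v \<in> rat_space.span S \<and> y * v \<in> rat_space.span S"
    using algebraic_common_module[OF assms] by blast
  then show ?thesis by (intro algebraic_if_stable[of S]) (auto simp: mult.assoc)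
qed

lemma algebraic_power: "algebraic x \<Longrightarrow> algebraic (x ^ n)"
  for x :: "'a::field_char_0"
  by (induction n) (auto intro: algebraic_mult)

text \<open>
  The polynomial that is obtained by eliminating the critical value from the quadratic
  equation of \<open>tilt_rate N t\<close> and its derivative with respect to \<open>t\<close>, see \<open>double_root_elimination\<close>.
\<close>

definition tilt_poly :: "nat \<Rightarrow> real poly" where
  "tilt_poly N = (let x = [:0, 1:]; s = x ^ 2 - 1; T = monom 1 N; M = (x ^ 2 + 1) * (T - 1) * (T + 1)
       + of_nat (2 * N) * T * s - s * (T + 1) ^ 2
     in s ^ 3 * (T - 1) ^ 2 * (s * (T + 1) ^ 2 + 2 * M) - 4 * x ^ 2 * M ^ 2)"

definition int_coeffs :: "'a::comm_ring_1 poly \<Rightarrow> bool" where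
  "int_coeffs p \<longleftrightarrow> (\<forall>i. coeff p i \<in> \<int>)"

lemma int_coeffs_intros:
  "int_coeffs p \<Longrightarrow> int_coeffs q \<Longrightarrow> int_coeffs (p + q)"
  "int_coeffs p \<Longrightarrow> int_coeffs q \<Longrightarrow> int_coeffs (p - q)"
  "int_coeffs p \<Longrightarrow> int_coeffs q \<Longrightarrow> int_coeffs (p * q)"
  "int_coeffs (1 :: 'a poly)"
  for p q :: "'a::comm_ring_1 poly"
  by (auto simp: int_coeffs_def coeff_mult intro!: Ints_sum)

lemma int_coeffs_power: "int_coeffs p \<Longrightarrow> int_coeffs (p ^ n)"
  by (induction n) (auto intro: int_coeffs_intros)

lemma int_coeffs_of_nat: "int_coeffs (of_nat n :: 'a::comm_ring_1 poly)"
  by (simp add: int_coeffs_def of_nat_poly coeff_pCons split: nat.splits)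

lemma int_coeffs_base: "int_coeffs [:0, 1:]" "int_coeffs (monom 1 N)" "int_coeffs (numeral k)"
  using int_coeffs_of_nat[of "numeral k"]
  by (simp_all add: int_coeffs_def coeff_pCons split: nat.splits)

lemma int_coeffs_tilt_poly: "int_coeffs (tilt_poly N)"
  unfolding tilt_poly_def Let_def by (intro int_coeffs_intros int_coeffs_power int_coeffs_base int_coeffs_of_nat)

lemma tilt_poly_nonzero:
  assumes "0 < N" shows "tilt_poly N \<noteq> 0"
proof -
  have "poly (tilt_poly N) 0 = 1"
    using assms by (simp add: tilt_poly_def Let_def poly_monom power_0_left)
  then show ?thesis by auto
qed

text \<open>
  Up to the factor \<open>4 * t\<^sup>2 * (t ^ N + 1)\<close> the left hand side is the quadratic polynomial
  \<open>y\<^sup>2 + 2 * tilt_w N t * y - 1\<close> at \<open>y = (\<mu> - t - 1 / t) / 2\<close>, which increases for \<open>y > 0\<close> and vanishes at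
  \<open>tilt_lam N t\<close>.
\<close>

lemma tilt_quadratic_sign:
  assumes t: "1 < t" and l: "0 < \<mu> * t - t\<^sup>2 - 1" and le: "\<mu> \<le> tilt_rate N t"
  shows "(\<mu> * t - t\<^sup>2 - 1)\<^sup>2 * (t ^ N + 1) + 2 * (t\<^sup>2 - 1) * (t ^ N - 1) * (\<mu> * t - t\<^sup>2 - 1)
    - 4 * t\<^sup>2 * (t ^ N + 1) \<le> 0"
    and "\<mu> = tilt_rate N t \<Longrightarrow> (\<mu> * t - t\<^sup>2 - 1)\<^sup>2 * (t ^ N + 1) + 2 * (t\<^sup>2 - 1) * (t ^ N - 1) * (\<mu> * t - t\<^sup>2 - 1)
    - 4 * t\<^sup>2 * (t ^ N + 1) = 0"
proof -
  define y w \<rho> where "y = (\<mu> * t - t\<^sup>2 - 1) / (2 * t)" and "w = tilt_w N t" and "\<rho> = t ^ N + 1"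
  have \<rho>: "0 < \<rho>" using t by (simp add: \<rho>_def add_pos_pos)
  have y: "\<mu> * t - t\<^sup>2 - 1 = 2 * t * y" using t by (simp add: y_def)
  have "(t - 1 / t) * t = t\<^sup>2 - 1" using t by (simp add: power2_eq_square left_diff_distrib)
  then have w: "(t\<^sup>2 - 1) * (t ^ N - 1) = 2 * t * w * \<rho>"
  proof -
    have "w * (2 * \<rho>) = (t - 1 / t) * (t ^ N - 1)"
      unfolding w_def tilt_w_def \<rho>_def[symmetric] using \<rho> by simp
    moreover have "2 * t * w * \<rho> = t * (w * (2 * \<rho>))"
      by (simp only: mult_ac)
    ultimately have "2 * t * w * \<rho> = t * ((t - 1 / t) * (t ^ N - 1))" by (simp only:)
    also have "\<dots> = ((t - 1 / t) * t) * (t ^ N - 1)"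
      by (simp only: mult_ac)
    finally show ?thesis unfolding \<open>(t - 1 / t) * t = t\<^sup>2 - 1\<close> ..
  qed
  have eq: "(\<mu> * t - t\<^sup>2 - 1)\<^sup>2 * (t ^ N + 1) + 2 * (t\<^sup>2 - 1) * (t ^ N - 1) * (\<mu> * t - t\<^sup>2 - 1)
      - 4 * t\<^sup>2 * (t ^ N + 1) = 4 * t\<^sup>2 * \<rho> * (y\<^sup>2 + 2 * w * y - 1)"
  proof -
    have "2 * (t\<^sup>2 - 1) * (t ^ N - 1) * (\<mu> * t - t\<^sup>2 - 1) = 2 * (2 * t * w * \<rho>) * (2 * t * y)"
      unfolding w[symmetric] y by simp
    then show ?thesis unfolding y \<rho>_def[symmetric] by (simp add: algebra_simps power2_eq_square)
  qed
  have rate: "tilt_rate N t * t - t\<^sup>2 - 1 = 2 * t * tilt_lam N t"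
    using t by (simp add: tilt_rate_def algebra_simps power2_eq_square)
  have "2 * t * y \<le> 2 * t * tilt_lam N t"
    unfolding rate[symmetric] y[symmetric] using le t by (simp add: mult_right_mono)
  then have yl: "y \<le> tilt_lam N t" using t by simp
  have y0: "0 < y" using l t by (simp add: y_def)
  have w0: "0 \<le> w" unfolding w_def using t by (intro tilt_w_nonneg) simp
  have "y\<^sup>2 + 2 * w * y \<le> (tilt_lam N t)\<^sup>2 + 2 * w * tilt_lam N t"
    using yl y0 w0 by (intro add_mono power_mono mult_left_mono) auto
  then have "y\<^sup>2 + 2 * w * y - 1 \<le> 0" using tilt_lam_quadratic[of N t] by (simp add: w_def)
  then show "(\<mu> * t - t\<^sup>2 - 1)\<^sup>2 * (t ^ N + 1) + 2 * (t\<^sup>2 - 1) * (t ^ N - 1) * (\<mu> * t - t\<^sup>2 - 1)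
    - 4 * t\<^sup>2 * (t ^ N + 1) \<le> 0"
    unfolding eq using t \<rho> by (intro mult_nonneg_nonpos) auto
  assume "\<mu> = tilt_rate N t"
  then have "2 * t * y = 2 * t * tilt_lam N t"
    unfolding rate[symmetric] y[symmetric] by (simp only:)
  then have "y = tilt_lam N t" using t by auto
  then show "(\<mu> * t - t\<^sup>2 - 1)\<^sup>2 * (t ^ N + 1) + 2 * (t\<^sup>2 - 1) * (t ^ N - 1) * (\<mu> * t - t\<^sup>2 - 1)
    - 4 * t\<^sup>2 * (t ^ N + 1) = 0"
    unfolding eq using tilt_lam_quadratic[of N t] by (simp add: w_def)
qed

text \<open>
  In the application \<open>\<sigma>\<close> and \<open>\<rho>\<close> are \<open>t\<^sup>N - 1\<close> and \<open>t\<^sup>N + 1\<close>, \<open>K\<close> is \<open>N * t\<^sup>N\<close>, and \<open>l\<close> is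
  \<open>\<mu> * t - t\<^sup>2 - 1\<close> for the critical value \<open>\<mu>\<close>.  A combination of the equation and its derivative is
  linear in \<open>l\<close>; it determines \<open>l\<close>, and the quadratic equation becomes a condition on \<open>t\<close>.
\<close>

lemma double_root_elimination:
  fixes t l s K \<sigma> \<rho> :: real
  assumes s: "s = t\<^sup>2 - 1" and \<rho>: "\<rho> = \<sigma> + 2" "\<rho> \<noteq> 0" and M: "M = (t\<^sup>2 + 1) * \<sigma> * \<rho> + 2 * K * s - s * \<rho>\<^sup>2"
    and E1: "l\<^sup>2 * \<rho> + 2 * s * \<sigma> * l - 4 * t\<^sup>2 * \<rho> = 0"
    and E2: "2 * l * \<rho> * (l - s) + l\<^sup>2 * K + 4 * t\<^sup>2 * \<sigma> * l + 2 * s * K * l + 2 * s * \<sigma> * (l - s)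
      - 8 * t\<^sup>2 * \<rho> - 4 * t\<^sup>2 * K = 0"
  shows "s ^ 3 * \<sigma>\<^sup>2 * (s * \<rho>\<^sup>2 + 2 * M) - 4 * t\<^sup>2 * M\<^sup>2 = 0"
proof -
  have "2 * (l * M - s\<^sup>2 * \<sigma> * \<rho>)
      = \<rho> * (2 * l * \<rho> * (l - s) + l\<^sup>2 * K + 4 * t\<^sup>2 * \<sigma> * l + 2 * s * K * l + 2 * s * \<sigma> * (l - s)
          - 8 * t\<^sup>2 * \<rho> - 4 * t\<^sup>2 * K)
        - (2 * \<rho> + K) * (l\<^sup>2 * \<rho> + 2 * s * \<sigma> * l - 4 * t\<^sup>2 * \<rho>)"
    unfolding M s \<rho>(1) by algebra
  then have lM: "l * M = s\<^sup>2 * \<sigma> * \<rho>" using E1 E2 by simp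
  have "\<rho> * (s ^ 3 * \<sigma>\<^sup>2 * (s * \<rho>\<^sup>2 + 2 * M) - 4 * t\<^sup>2 * M\<^sup>2)
      = (s\<^sup>2 * \<sigma> * \<rho>)\<^sup>2 * \<rho> + 2 * s * \<sigma> * (s\<^sup>2 * \<sigma> * \<rho>) * M - 4 * t\<^sup>2 * \<rho> * M\<^sup>2"
    by algebra
  also have "\<dots> = M\<^sup>2 * (l\<^sup>2 * \<rho> + 2 * s * \<sigma> * l - 4 * t\<^sup>2 * \<rho>)"
    unfolding lM[symmetric] by algebra
  also have "\<dots> = 0" using E1 by simp
  finally show ?thesis using \<rho>(2) by simp
qed

text \<open>
  For the minimal value \<open>\<mu>\<close> the quadratic expression of \<open>tilt_quadratic_sign\<close> has a local maximum with
  value \<open>0\<close> at \<open>t0\<close>, so \<open>t0\<close> is a double root.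
\<close>

lemma critical_point_root:
  assumes N: "0 < N" and t0: "1 < t0" and min: "\<And>t. 1 \<le> t \<Longrightarrow> tilt_rate N t0 \<le> tilt_rate N t"
  shows "poly (tilt_poly N) t0 = 0"
proof -
  define \<mu> where "\<mu> = tilt_rate N t0"
  define g where "g t = (\<mu> * t - t\<^sup>2 - 1)\<^sup>2 * (t ^ N + 1) + 2 * (t\<^sup>2 - 1) * (t ^ N - 1) * (\<mu> * t - t\<^sup>2 - 1)
    - 4 * t\<^sup>2 * (t ^ N + 1)" for t
  have "\<mu> * t0 - t0\<^sup>2 - 1 = 2 * t0 * tilt_lam N t0"
    using t0 by (simp add: \<mu>_def tilt_rate_def algebra_simps power2_eq_square)
  then have pos: "0 < \<mu> * t0 - t0\<^sup>2 - 1" using t0 tilt_lam_pos[of N t0] by simp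
  have "isCont (\<lambda>t. \<mu> * t - t\<^sup>2 - 1) t0" by (intro continuous_intros)
  then have "((\<lambda>t. \<mu> * t - t\<^sup>2 - 1) \<longlongrightarrow> \<mu> * t0 - t0\<^sup>2 - 1) (nhds t0)"
    using tendsto_at_iff_tendsto_nhds[of "\<lambda>t. \<mu> * t - t\<^sup>2 - 1" t0] by (simp only: isCont_def)
  then have "eventually (\<lambda>t. 0 < \<mu> * t - t\<^sup>2 - 1) (nhds t0)"
    using pos by (rule order_tendstoD(1))
  moreover have "eventually (\<lambda>t. 1 < t) (nhds t0)"
    using t0 eventually_nhds_in_open[of "{1<..}" t0] by simp
  ultimately have "eventually (\<lambda>t. 0 < \<mu> * t - t\<^sup>2 - 1 \<and> 1 < t) (nhds t0)"
    by (rule eventually_conj)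
  then obtain d where d: "d > 0" "\<And>t. dist t t0 < d \<Longrightarrow> 0 < \<mu> * t - t\<^sup>2 - 1 \<and> 1 < t"
    unfolding eventually_nhds_metric by blast
  have g0: "g t0 = 0"
    unfolding g_def using pos t0 by (intro tilt_quadratic_sign(2)) (simp_all add: \<mu>_def)
  have max: "\<forall>t. \<bar>t0 - t\<bar> < d \<longrightarrow> g t \<le> g t0"
  proof (intro allI impI)
    fix t assume "\<bar>t0 - t\<bar> < d"
    then have t: "0 < \<mu> * t - t\<^sup>2 - 1" "1 < t" using d(2)[of t] by (auto simp: dist_real_def abs_minus_commute)
    then show "g t \<le> g t0"
      unfolding g0 unfolding g_def using min[of t] by (intro tilt_quadratic_sign(1)) (simp_all add: \<mu>_def)
  qed
  define l K P where "l = \<mu> * t0 - t0\<^sup>2 - 1" and "K = real N * t0 ^ N" and "P = real N * t0 ^ (N - 1)"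
  have K: "t0 * P = K" using N by (cases N) (simp_all add: K_def P_def)
  let ?D = "2 * l * (\<mu> - 2 * t0) * (t0 ^ N + 1) + l\<^sup>2 * P
     + 2 * (2 * t0 * (t0 ^ N - 1) * l + (t0\<^sup>2 - 1) * P * l + (t0\<^sup>2 - 1) * (t0 ^ N - 1) * (\<mu> - 2 * t0))
     - 8 * t0 * (t0 ^ N + 1) - 4 * t0\<^sup>2 * P"
  have "(g has_field_derivative ?D) (at t0)"
    unfolding g_def l_def P_def
    by (rule derivative_eq_intros HOL.refl | simp)+ (simp add: algebra_simps power2_eq_square)
  then have "?D = 0" using DERIV_local_max d(1) max by blast
  then have "t0 * ?D = 0" by simp
  moreover have "t0 * ?D = 2 * l * (t0 ^ N + 1) * (l - (t0\<^sup>2 - 1)) + l\<^sup>2 * K + 4 * t0\<^sup>2 * (t0 ^ N - 1) * l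
      + 2 * (t0\<^sup>2 - 1) * K * l + 2 * (t0\<^sup>2 - 1) * (t0 ^ N - 1) * (l - (t0\<^sup>2 - 1))
      - 8 * t0\<^sup>2 * (t0 ^ N + 1) - 4 * t0\<^sup>2 * K"
    unfolding K[symmetric] l_def by algebra
  ultimately have E2: "2 * l * (t0 ^ N + 1) * (l - (t0\<^sup>2 - 1)) + l\<^sup>2 * K + 4 * t0\<^sup>2 * (t0 ^ N - 1) * l
      + 2 * (t0\<^sup>2 - 1) * K * l + 2 * (t0\<^sup>2 - 1) * (t0 ^ N - 1) * (l - (t0\<^sup>2 - 1))
      - 8 * t0\<^sup>2 * (t0 ^ N + 1) - 4 * t0\<^sup>2 * K = 0" by (simp only:)
  have E1: "l\<^sup>2 * (t0 ^ N + 1) + 2 * (t0\<^sup>2 - 1) * (t0 ^ N - 1) * l - 4 * t0\<^sup>2 * (t0 ^ N + 1) = 0"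
    using g0 by (simp only: g_def l_def)
  have "0 < t0 ^ N + 1" using t0 by (simp add: add_pos_pos)
  then have "t0 ^ N + 1 = (t0 ^ N - 1) + 2" "t0 ^ N + 1 \<noteq> 0" by simp_all
  from double_root_elimination[OF HOL.refl this HOL.refl E1 E2]
  show ?thesis
    by (simp add: tilt_poly_def Let_def poly_monom K_def mult_ac
      del: distrib_left_numeral distrib_right_numeral left_diff_distrib_numeral right_diff_distrib_numeral)
qed

theorem algebraic_minimum:
  assumes N: "0 < N" and t0: "1 \<le> t0" and min: "\<And>t. 1 \<le> t \<Longrightarrow> tilt_rate N t0 \<le> tilt_rate N t"
  shows "algebraic (tilt_rate N t0)"
proof -
  have num: "algebraic (1::real)" "algebraic (2::real)" by (simp_all add: rat_imp_algebraic)
  have "algebraic t0"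
  proof (cases "t0 = 1")
    case False
    show ?thesis
      using int_coeffs_tilt_poly[of N] critical_point_root[OF N _ min] t0 False
      by (intro algebraicI[of "tilt_poly N"]) (auto simp: int_coeffs_def tilt_poly_nonzero[OF N])
  qed (use num in simp)
  note intros = algebraic_add algebraic_mult algebraic_power algebraic_inverse algebraic_sqrt algebraic_minus num this
  have w: "algebraic (tilt_w N t0)"
    unfolding tilt_w_def divide_inverse diff_conv_add_uminus by (intro intros)
  show ?thesis
    unfolding tilt_rate_def tilt_lam_def divide_inverse diff_conv_add_uminus by (intro intros w)
qed

section \<open>Conclusion\<close>

lemma laurent_walk: "0 < N \<Longrightarrow> bs_walk_domain N (\<lambda>k. Poly_Mapping.single k (1::rat))"
  by unfold_locales (simp_all add: mult_single)

lemma G_series_eq_G: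
  assumes N: "0 < N"
  shows "G_series N = bs_walk.G N (\<lambda>k. Poly_Mapping.single k 1)"
proof -
  interpret bs_walk_domain N "\<lambda>k. Poly_Mapping.single k (1::rat)" by (rule laurent_walk[OF N])
  show ?thesis
  proof (rule fps_ext, rule poly_mapping_eqI)
    fix n k
    have lookup: "Poly_Mapping.lookup (path_weight st) k = (if st = ([], k) then 1 else 0)" for st
      by (cases st) (simp add: lookup_single)
    have "Poly_Mapping.lookup (fps_nth G n) k = of_nat (card {w. length w = n \<and> nf_act N w ([], 0) = ([], k)})"
      unfolding G_nth lookup_sum lookup using finite_words[of n] by (simp add: sum.If_cases Collect_conj_eq)
    then show "Poly_Mapping.lookup (fps_nth (G_series N) n) k = Poly_Mapping.lookup (fps_nth G n) k"
      by (simp add: lookup_G_series[OF N] g_count_nf_act[OF N])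
  qed
qed

text \<open>
  The constant term of \<open>G\<close> is the residue of \<open>G / q\<close>.
\<close>

lemma G_series_constant_term_D_finite:
  assumes N: "0 < N"
  shows "D_finite (q0_coeff (G_series N))"
proof -
  interpret bs_walk_domain N "\<lambda>k. Poly_Mapping.single k (1::rat)" by (rule laurent_walk[OF N])
  let ?v = "[:- [:0, Poly_Mapping.single 1 1 + Poly_Mapping.single (- 1) 1:], 1:]"
  have v: "poly_at X ?v = X - fps_X * fps_const (Poly_Mapping.single 1 1 + Poly_Mapping.single (- 1) 1)"
    by (simp add: fps_of_poly_uminus fps_of_poly_pCons mult.commute)
  interpret separable_element X "- kernel" "Suc N" ?v "[:[:Poly_Mapping.single (- 1) 1:]:]" "q_power (- 1) * G"
  proof
    show "degree (- kernel) \<le> Suc N" "coeff (- kernel) (Suc N) = 1" "poly_at X (- kernel) = 0"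
      using kernel_monic poly_at_kernel by simp_all
    have "(2 :: laurent) \<noteq> 0" by simp
    then show "poly_at X (pderiv (- kernel)) \<noteq> 0"
      using pderiv_kernel_nth_0 by (auto simp: pderiv_minus)
    show "poly_at X ?v \<noteq> 0"
      using G_inverse unfolding v by auto
    show "poly_at X ?v * (q_power (- 1) * G) = poly_at X [:[:Poly_Mapping.single (- 1) 1:]:]"
      using G_inverse unfolding v by (simp add: mult_ac)
  qed
  have "Poly_Mapping.lookup (Poly_Mapping.single (- 1) 1 * p) (- 1) = Poly_Mapping.lookup p 0" for p :: laurent
  proof (induction p rule: poly_mapping_additive_induct)
    case (single k a)
    show ?case by (auto simp: mult_single lookup_single when_def)
  qed (simp add: lookup_add distrib_left)
  then have "q_coeff (- 1) (q_power (- 1) * G) = q0_coeff G"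
    by (simp add: q_coeff_def q0_coeff_def)
  then show ?thesis using residue_D_finite by (simp add: G_series_eq_G[OF N])
qed

theorem theorem4p1:
  fixes N :: nat
  assumes "N > 0"
  shows "algebraic_series (G_series N)
    \<and> q0_coeff (G_series N) = Abs_fps (\<lambda>n. of_nat (g_count N n 0))
    \<and> q0_coeff (G_series N) = cogrowth_series N
    \<and> D_finite (cogrowth_series N)
    \<and> (\<exists>\<rho>::real. cogrowth_rate N = ereal \<rho> \<and> algebraic \<rho>)"
proof (intro conjI)
  show "algebraic_series (G_series N)"
    unfolding G_series_eq_G[OF assms] using laurent_walk[OF assms] by (intro bs_walk.G_algebraic bs_walk_domain.axioms)
  show q0: "q0_coeff (G_series N) = Abs_fps (\<lambda>n. of_nat (g_count N n 0))"
    by (simp add: q0_coeff_def lookup_G_series[OF assms])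
  then show c: "q0_coeff (G_series N) = cogrowth_series N"
    by (simp add: cogrowth_series_def cogrowth_eq_g_count[OF assms])
  show "D_finite (cogrowth_series N)"
    using G_series_constant_term_D_finite[OF assms] by (simp only: c)
  obtain t0 where t0: "1 \<le> t0" "\<And>t. 1 \<le> t \<Longrightarrow> tilt_rate N t0 \<le> tilt_rate N t"
    using tilt_rate_minimum by blast
  show "\<exists>\<rho>::real. cogrowth_rate N = ereal \<rho> \<and> algebraic \<rho>"
    using cogrowth_rate_eq[OF assms t0] algebraic_minimum[OF assms t0] by blast
qed

end
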